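(* Let $M$ be an $F$-structure manifold of degree $K$. The following conditions are equivalent, where each of the identities (ii)–(vii) is required for all vector fields $X,Y$ on $M$: (i) $D_l$ is integrable; (ii) $N_l(lX,lY)=0$; (iii) $N_F(X,Y)=l\,N_F(X,Y)$; (iv) $m\,N_F(X,Y)=0$; (v) $m\,N_F(FX,FY)=0$; (vi) $m\,N_F(lX,lY)=0$; (vii) $N_l(FX,FY)=0$.
   Context: An $F$-structure manifold of degree $K$ is a smooth $n$-dimensional manifold $M$ with a nonzero smooth $(1,1)$-tensor field $F$ of constant rank $r$ satisfying $\alpha F^{K+1}+\beta F^{K}+F=0$, where $K\ge 3$ is an integer and $\alpha,\beta$ are real or complex numbers (polynomials in $F$ with complex coefficients are regarded as endomorphisms of the complexified tangent bundle). Put $l=-(\alpha F^{K}+\beta F^{K-1})$ and $m=I+\alpha F^{K}+\beta F^{K-1}$; $D_l=\mathrm{Im}\,l$ and $D_m=\mathrm{Im}\,m$ are complementary distributions of dimensions $r$ and $n-r$. For a $(1,1)$-tensor field $T$, the Nijenhuis tensor is $N_T(X,Y)=[TX,TY]-T[TX,Y]-T[X,TY]+T^2[X,Y]$. A distribution $D$ is integrable if through each point of $M$ there is an integral manifold of $D$ (equivalently, by Frobenius, $D$ is involutive). *)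

theory Defs
  imports "HOL-Analysis.Analysis" "HOL-Library.Function_Algebras"
begin

section \<open>Smooth maps between open subsets of Euclidean spaces\<close>

text \<open>Intended for open \<^term>\<open>S\<close>. In finite dimension \<^term>\<open>Ck_on n S f\<close> says that \<^term>\<open>f\<close> is
  \<^term>\<open>n\<close> times continuously differentiable: the recursion asks the directional derivatives in all
  directions to be \<^term>\<open>n - (1::nat)\<close> times continuously differentiable.\<close>

primrec Ck_on :: "nat \<Rightarrow> 'e::euclidean_space set \<Rightarrow> ('e \<Rightarrow> 'b::real_normed_vector) \<Rightarrow> bool" where
  "Ck_on 0 S f \<longleftrightarrow> continuous_on S f"
| "Ck_on (Suc n) S f \<longleftrightarrow> (\<forall>x\<in>S. f differentiable (at x)) \<and>
     (\<forall>v. Ck_on n S (\<lambda>x. frechet_derivative f (at x) v))"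

definition smooth_on :: "'e::euclidean_space set \<Rightarrow> ('e \<Rightarrow> 'b::real_normed_vector) \<Rightarrow> bool" where
  "smooth_on S f \<longleftrightarrow> (\<forall>n. Ck_on n S f)"


section \<open>Smooth manifolds\<close>

text \<open>The manifold is the set \<^term>\<open>topspace X\<close> with an explicit topology, so that an immersed
  submanifold can be a subset of the same type with a topology of its own. Charts take values in
  \<^typ>\<open>'e::euclidean_space\<close>, so the dimension is the dimension of this type. The atlas need not be
  maximal.\<close>

datatype ('a, 'e) manifold = Manifold (mtop: "'a topology") (atlas: "('a set \<times> ('a \<Rightarrow> 'e)) set")

abbreviation points :: "('a, 'e) manifold \<Rightarrow> 'a set" where
  "points M \<equiv> topspace (mtop M)"

definition smooth_manifold :: "('a, 'e::euclidean_space) manifold \<Rightarrow> bool" where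
  "smooth_manifold M \<longleftrightarrow>
     Hausdorff_space (mtop M) \<and> second_countable (mtop M) \<and>
     (\<Union>(U, \<phi>)\<in>atlas M. U) = points M \<and>
     (\<forall>(U, \<phi>)\<in>atlas M. openin (mtop M) U \<and> open (\<phi> ` U) \<and>
        homeomorphic_map (subtopology (mtop M) U) (top_of_set (\<phi> ` U)) \<phi>) \<and>
     (\<forall>(U, \<phi>)\<in>atlas M. \<forall>(V, \<psi>)\<in>atlas M. smooth_on (\<phi> ` (U \<inter> V)) (\<psi> \<circ> inv_into U \<phi>))"

definition smooth_map ::
    "('a, 'e::euclidean_space) manifold \<Rightarrow> ('b, 'd::euclidean_space) manifold \<Rightarrow> ('a \<Rightarrow> 'b) \<Rightarrow> bool" where
  "smooth_map M N h \<longleftrightarrow> continuous_map (mtop M) (mtop N) h \<and>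
     (\<forall>(U, \<phi>)\<in>atlas M. \<forall>(V, \<psi>)\<in>atlas N.
        smooth_on (\<phi> ` (U \<inter> h -` V)) (\<psi> \<circ> h \<circ> inv_into U \<phi>))"

text \<open>The values of \<^term>\<open>f\<close> outside \<^term>\<open>points M\<close> are unconstrained. They are also irrelevant to
  the derivations below: if \<^term>\<open>f\<close> vanishes on \<^term>\<open>points M\<close>, then \<^term>\<open>f = f * g\<close> for the
  indicator function \<^term>\<open>g\<close> of the complement, and the Leibniz rule at \<^term>\<open>p \<in> points M\<close>
  gives \<^term>\<open>v f = 0\<close>.\<close>

definition smooth_funs :: "('a, 'e::euclidean_space) manifold \<Rightarrow> ('a \<Rightarrow> real) set" where
  "smooth_funs M = {f. \<forall>(U, \<phi>)\<in>atlas M. smooth_on (\<phi> ` U) (f \<circ> inv_into U \<phi>)}"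


section \<open>Tangent vectors, vector fields and tensor fields\<close>

type_synonym 'a tvec = "('a \<Rightarrow> real) \<Rightarrow> real"

type_synonym 'a ctvec = "('a \<Rightarrow> real) \<Rightarrow> complex"

definition scale :: "'c::times \<Rightarrow> ('b \<Rightarrow> 'c) \<Rightarrow> 'b \<Rightarrow> 'c" (infixr \<open>\<odot>\<close> 75) where
  "c \<odot> v = (\<lambda>f. c * v f)"

text \<open>Derivations at \<^term>\<open>p\<close> of the algebra of smooth functions, set to zero on the other functions
  so that they are determined by their values on smooth functions. Sums and products of functions
  are pointwise.\<close>

definition tangent_space :: "('a, 'e::euclidean_space) manifold \<Rightarrow> 'a \<Rightarrow> 'a tvec set" where
  "tangent_space M p = {v.
     (\<forall>f\<in>smooth_funs M. \<forall>g\<in>smooth_funs M. v (f + g) = v f + v g) \<and>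
     (\<forall>f\<in>smooth_funs M. \<forall>c. v (c \<odot> f) = c * v f) \<and>
     (\<forall>f\<in>smooth_funs M. \<forall>g\<in>smooth_funs M. v (f * g) = f p * v g + g p * v f) \<and>
     (\<forall>f. f \<notin> smooth_funs M \<longrightarrow> v f = 0)}"

definition vector_fields :: "('a, 'e::euclidean_space) manifold \<Rightarrow> ('a \<Rightarrow> 'a tvec) set" where
  "vector_fields M = {X. (\<forall>p\<in>points M. X p \<in> tangent_space M p) \<and>
     (\<forall>f\<in>smooth_funs M. (\<lambda>p. X p f) \<in> smooth_funs M)}"

definition field_app :: "('a \<Rightarrow> 'v \<Rightarrow> 'v) \<Rightarrow> ('a \<Rightarrow> 'v) \<Rightarrow> 'a \<Rightarrow> 'v" (infixr \<open>\<cdot>\<close> 80) where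
  "T \<cdot> X = (\<lambda>p. T p (X p))"

text \<open>Smooth (1,1)-tensor fields, as fields of endomorphisms of the tangent spaces which map smooth
  vector fields to smooth vector fields.\<close>

definition tensor_field :: "('a, 'e::euclidean_space) manifold \<Rightarrow> ('a \<Rightarrow> 'a tvec \<Rightarrow> 'a tvec) \<Rightarrow> bool" where
  "tensor_field M F \<longleftrightarrow>
     (\<forall>p\<in>points M. \<forall>v\<in>tangent_space M p.
        F p v \<in> tangent_space M p \<and>
        (\<forall>w\<in>tangent_space M p. F p (v + w) = F p v + F p w) \<and>
        (\<forall>c. F p (c \<odot> v) = c \<odot> F p v)) \<and>
     (\<forall>X\<in>vector_fields M. F \<cdot> X \<in> vector_fields M)"

definition rank_at :: "('a, 'e::euclidean_space) manifold \<Rightarrow> ('a \<Rightarrow> 'a tvec \<Rightarrow> 'a tvec) \<Rightarrow> 'a \<Rightarrow> nat" where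
  "rank_at M F p = vector_space.dim (\<odot>) (F p ` tangent_space M p)"


section \<open>The complexified tangent bundle\<close>

text \<open>The complex vector \<open>v + \<i> w\<close>, where \<open>v\<close> and \<open>w\<close> are real tangent vectors, is represented by the
  complex-valued functional \<open>f \<mapsto> v f + \<i> w f\<close>.\<close>

definition Re_vec :: "'a ctvec \<Rightarrow> 'a tvec" where
  "Re_vec w = (\<lambda>f. Re (w f))"

definition Im_vec :: "'a ctvec \<Rightarrow> 'a tvec" where
  "Im_vec w = (\<lambda>f. Im (w f))"

definition complexify_space :: "'a tvec set \<Rightarrow> 'a ctvec set" where
  "complexify_space V = {w. Re_vec w \<in> V \<and> Im_vec w \<in> V}"

definition complexify_field :: "('a \<Rightarrow> 'a tvec) \<Rightarrow> 'a \<Rightarrow> 'a ctvec" where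
  "complexify_field X = (\<lambda>p f. complex_of_real (X p f))"

definition complexify_tensor :: "('a \<Rightarrow> 'a tvec \<Rightarrow> 'a tvec) \<Rightarrow> 'a \<Rightarrow> 'a ctvec \<Rightarrow> 'a ctvec" where
  "complexify_tensor F = (\<lambda>p w f. Complex (F p (Re_vec w) f) (F p (Im_vec w) f))"

definition cderiv :: "'a ctvec \<Rightarrow> ('a \<Rightarrow> complex) \<Rightarrow> complex" where
  "cderiv w g = w (\<lambda>q. Re (g q)) + \<i> * w (\<lambda>q. Im (g q))"

definition bracket ::
    "('a, 'e::euclidean_space) manifold \<Rightarrow> ('a \<Rightarrow> 'a ctvec) \<Rightarrow> ('a \<Rightarrow> 'a ctvec) \<Rightarrow> 'a \<Rightarrow> 'a ctvec" where
  "bracket M X Y = (\<lambda>p f. if f \<in> smooth_funs M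
     then cderiv (X p) (\<lambda>q. Y q f) - cderiv (Y p) (\<lambda>q. X q f) else 0)"

definition nijenhuis ::
    "('a, 'e::euclidean_space) manifold \<Rightarrow> ('a \<Rightarrow> 'a ctvec \<Rightarrow> 'a ctvec) \<Rightarrow>
     ('a \<Rightarrow> 'a ctvec) \<Rightarrow> ('a \<Rightarrow> 'a ctvec) \<Rightarrow> 'a \<Rightarrow> 'a ctvec" where
  "nijenhuis M T X Y =
     bracket M (T \<cdot> X) (T \<cdot> Y) - T \<cdot> bracket M (T \<cdot> X) Y - T \<cdot> bracket M X (T \<cdot> Y)
     + T \<cdot> T \<cdot> bracket M X Y"


section \<open>Integrable distributions\<close>

definition differential ::
    "('b, 'd::euclidean_space) manifold \<Rightarrow> ('a, 'e::euclidean_space) manifold \<Rightarrow> ('b \<Rightarrow> 'a) \<Rightarrow>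
     'b tvec \<Rightarrow> 'a tvec" where
  "differential N M h v = (\<lambda>f. if f \<in> smooth_funs M then v (f \<circ> h) else 0)"

text \<open>An immersed submanifold \<open>N\<close> is a subset of \<open>M\<close> with a topology and an atlas of its own whose
  inclusion map is an immersion. It is an integral manifold of a distribution \<open>D\<close> of complex tangent
  vectors if at each of its points the complexification of its tangent space is the value of \<open>D\<close>.
  If \<open>D\<close> is the complexification of a real distribution, this says that the tangent spaces of \<open>N\<close>
  are the values of the real distribution.\<close>

definition immersed_submanifold ::
    "('a, 'e::euclidean_space) manifold \<Rightarrow> ('a, 'd::euclidean_space) manifold \<Rightarrow> bool" where
  "immersed_submanifold M N \<longleftrightarrow> smooth_manifold N \<and> points N \<subseteq> points M \<and> smooth_map N M (\<lambda>x. x) \<and>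
     (\<forall>q\<in>points N. inj_on (differential N M (\<lambda>x. x)) (tangent_space N q))"

definition integral_manifold ::
    "('a, 'e::euclidean_space) manifold \<Rightarrow> ('a \<Rightarrow> 'a ctvec set) \<Rightarrow>
     ('a, 'd::euclidean_space) manifold \<Rightarrow> bool" where
  "integral_manifold M D N \<longleftrightarrow> immersed_submanifold M N \<and>
     (\<forall>q\<in>points N. complexify_space (differential N M (\<lambda>x. x) ` tangent_space N q) = D q)"

text \<open>The type argument is the Euclidean space on which the integral manifolds are modelled; its
  dimension has to be the rank of the distribution.\<close>

definition integrable_distribution ::
    "'d::euclidean_space itself \<Rightarrow> ('a, 'e::euclidean_space) manifold \<Rightarrow> ('a \<Rightarrow> 'a ctvec set) \<Rightarrow> bool" where
  "integrable_distribution _ M D \<longleftrightarrow>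
     (\<forall>p\<in>points M. \<exists>N :: ('a, 'd) manifold. p \<in> points N \<and> integral_manifold M D N)"


section \<open>F-structures\<close>

definition F_structure_manifold ::
    "('a, 'e::euclidean_space) manifold \<Rightarrow> nat \<Rightarrow> complex \<Rightarrow> complex \<Rightarrow> nat \<Rightarrow>
     ('a \<Rightarrow> 'a tvec \<Rightarrow> 'a tvec) \<Rightarrow> bool" where
  "F_structure_manifold M K \<alpha> \<beta> r F \<longleftrightarrow>
     smooth_manifold M \<and> K \<ge> 3 \<and> tensor_field M F \<and>
     (\<exists>p\<in>points M. \<exists>v\<in>tangent_space M p. F p v \<noteq> 0) \<and>
     (\<forall>p\<in>points M. rank_at M F p = r) \<and>
     (\<forall>p\<in>points M. \<forall>w\<in>complexify_space (tangent_space M p).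
        \<alpha> \<odot> (complexify_tensor F p ^^ (K + 1)) w + \<beta> \<odot> (complexify_tensor F p ^^ K) w
        + complexify_tensor F p w = 0)"

definition l_tensor :: "nat \<Rightarrow> complex \<Rightarrow> complex \<Rightarrow> ('a \<Rightarrow> 'a tvec \<Rightarrow> 'a tvec) \<Rightarrow> 'a \<Rightarrow> 'a ctvec \<Rightarrow> 'a ctvec" where
  "l_tensor K \<alpha> \<beta> F = (\<lambda>p w.
     - (\<alpha> \<odot> (complexify_tensor F p ^^ K) w + \<beta> \<odot> (complexify_tensor F p ^^ (K - 1)) w))"

definition m_tensor :: "nat \<Rightarrow> complex \<Rightarrow> complex \<Rightarrow> ('a \<Rightarrow> 'a tvec \<Rightarrow> 'a tvec) \<Rightarrow> 'a \<Rightarrow> 'a ctvec \<Rightarrow> 'a ctvec" where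
  "m_tensor K \<alpha> \<beta> F = (\<lambda>p w.
     w + \<alpha> \<odot> (complexify_tensor F p ^^ K) w + \<beta> \<odot> (complexify_tensor F p ^^ (K - 1)) w)"

definition image_distribution ::
    "('a, 'e::euclidean_space) manifold \<Rightarrow> ('a \<Rightarrow> 'a ctvec \<Rightarrow> 'a ctvec) \<Rightarrow> 'a \<Rightarrow> 'a ctvec set" where
  "image_distribution M T = (\<lambda>p. T p ` complexify_space (tangent_space M p))"

text \<open>An identity holds for all vector fields \<open>X\<close>, \<open>Y\<close>, which are real and are regarded as sections of
  the complexified tangent bundle. Fields are compared on \<^term>\<open>points M\<close> only.\<close>

definition for_all_fields ::
    "('a, 'e::euclidean_space) manifold \<Rightarrow>
     (('a \<Rightarrow> 'a ctvec) \<Rightarrow> ('a \<Rightarrow> 'a ctvec) \<Rightarrow> 'a \<Rightarrow> bool) \<Rightarrow> bool" where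
  "for_all_fields M P \<longleftrightarrow> (\<forall>X\<in>vector_fields M. \<forall>Y\<in>vector_fields M. \<forall>p\<in>points M.
     P (complexify_field X) (complexify_field Y) p)"

end

theory Submission
  imports Defs
begin

text \<open>Since \<open>F l = l F = F\<close>, the operator \<open>l\<close> is the projection onto \<open>Im F\<close> along \<open>Ker F\<close>; hence it is real
  although \<open>\<alpha>\<close> and \<open>\<beta>\<close> may be complex, and \<open>D\<^sub>l\<close> is the complexification of \<open>Im F\<close>. As \<open>m l = m F = 0\<close>, each of
  (ii)--(vii) reduces to \<open>m [A, B] = 0\<close> for a family of fields \<open>A\<close>, \<open>B\<close> that runs through all sections of
  \<open>Im F\<close>, that is, to the involutivity of \<open>Im F\<close>, and what remains is Frobenius' theorem.
  In a chart, an involutive distribution has a frame of commuting fields \<open>B(x) v\<close>, linear in \<open>v\<close>, obtained by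
  normalizing a linear projection of the frame to the identity. The integral manifold is the image of the
  solution \<open>y\<close> of \<open>D y(s) = B(y(s))\<close>, which is found as a fixed point along rays from the origin. Conversely,
  the fields tangent to an immersed submanifold lift to it and their brackets are tangent by the symmetry
  of second derivatives.\<close>

section \<open>Calculus of smooth maps\<close>

text \<open>Two obstacles shape the proof. Vector fields, smooth functions and derivations are
  global objects, so a local construction becomes usable only after multiplication by a bump
  function; the same device makes derivations local and, with Hadamard's lemma, identifies them with
  directional derivatives in a chart. In Frobenius' theorem, solving along rays avoids composing
  flows and their dependence on parameters, but the fixed point is at first only Lipschitz across
  the rays. Commutation of the frame is what makes it differentiable there; once the derivative of
  \<open>y\<close> is \<open>B \<circ> y\<close>, smoothness follows by bootstrapping. The algebra
  rests on the factorization \<open>L = F pre\<close>, where \<open>L\<close> is the real form of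
  \<open>l\<close> and \<open>pre\<close> the same polynomial one power lower. With
  \<open>L F = F\<close> it gives idempotence and equality of the images, and it writes every field
  \<open>L X\<close> as \<open>F Y\<close> with a smooth \<open>Y\<close>. Hence the families of
  fields in the different conditions can be compared globally, without extending local
  sections.\<close>

abbreviation \<D> where "\<D> f x \<equiv> frechet_derivative f (at x)"

lemma frechet_derivative_cong_open:
  assumes "open S" "x \<in> S" "\<And>y. y \<in> S \<Longrightarrow> f y = g y"
  shows "\<D> f x = \<D> g x"
proof -
  have "(f has_derivative D) (at x) \<longleftrightarrow> (g has_derivative D) (at x)" for D
    using has_derivative_transform_within_open[OF _ assms(1,2)] assms(3) by metis
  then show ?thesis by (simp add: frechet_derivative_def)
qed

lemma differentiable_cong_open:
  assumes "open S" "x \<in> S" "\<And>y. y \<in> S \<Longrightarrow> f y = g y" "f differentiable at x"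
  shows "g differentiable at x"
  using has_derivative_transform_within_open[OF _ assms(1,2)] assms(3,4)
  unfolding differentiable_def by metis

lemma Ck_on_cong:
  assumes "open S" "\<And>x. x \<in> S \<Longrightarrow> f x = g x" "Ck_on n S f"
  shows "Ck_on n S g"
  using assms(2,3)
proof (induction n arbitrary: f g)
  case 0
  then show ?case by (simp cong: continuous_on_cong)
next
  case (Suc n)
  have "Ck_on n S (\<lambda>x. \<D> g x v)" for v
    by (rule Suc.IH[of "\<lambda>x. \<D> f x v"])
       (use Suc.prems frechet_derivative_cong_open[OF assms(1), of _ f g] in auto)
  moreover have "\<forall>x\<in>S. g differentiable at x"
    using Suc.prems differentiable_cong_open[OF assms(1), of _ f g] by auto
  ultimately show ?case by simp
qed

lemma Ck_on_SucD:
  assumes "Ck_on (Suc n) S f"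
  shows "x \<in> S \<Longrightarrow> (f has_derivative \<D> f x) (at x)"
    and "Ck_on n S (\<lambda>x. \<D> f x v)"
  using assms by (auto simp: frechet_derivative_works[symmetric])

text \<open>Lets a derivative computed by the usual rules stand in for \<open>\<D> f\<close>, which
  the recursion names. Most inductions on the order of differentiability below go through
  it.\<close>

lemma Ck_on_SucI:
  assumes "open S" "\<And>x. x \<in> S \<Longrightarrow> (f has_derivative f' x) (at x)"
    and "\<And>v. Ck_on n S (\<lambda>x. f' x v)"
  shows "Ck_on (Suc n) S f"
proof -
  have "Ck_on n S (\<lambda>x. \<D> f x v)" for v
    by (rule Ck_on_cong[OF assms(1) _ assms(3)[of v]])
       (use assms(2) frechet_derivative_at in metis)
  then show ?thesis using assms(2) by (auto simp: differentiable_def)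
qed

lemma Ck_on_Suc_imp: "Ck_on (Suc n) S f \<Longrightarrow> Ck_on n S f"
proof (induction n arbitrary: f)
  case 0
  then show ?case
    by (auto intro!: continuous_at_imp_continuous_on differentiable_imp_continuous_within)
next
  case (Suc n)
  then show ?case by (metis Ck_on.simps(2))
qed

lemma Ck_on_imp_continuous_on: "Ck_on n S f \<Longrightarrow> continuous_on S f"
proof (induction n)
  case (Suc n)
  then show ?case using Ck_on_Suc_imp by blast
qed simp

lemma Ck_on_subset: "Ck_on n S f \<Longrightarrow> T \<subseteq> S \<Longrightarrow> Ck_on n T f"
  by (induction n arbitrary: f) (auto intro: continuous_on_subset)

lemma Ck_on_local:
  assumes "\<And>x. x \<in> S \<Longrightarrow> \<exists>T. open T \<and> x \<in> T \<and> Ck_on n T f"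
  shows "Ck_on n S f"
  using assms
proof (induction n arbitrary: f)
  case 0
  then show ?case
    by (auto intro!: continuous_at_imp_continuous_on simp: continuous_on_eq_continuous_at)
       (metis continuous_on_eq_continuous_at)
next
  case (Suc n)
  have "Ck_on n S (\<lambda>x. \<D> f x v)" for v
    by (rule Suc.IH) (use Suc.prems in \<open>metis Ck_on.simps(2)\<close>)
  then show ?case using Suc.prems by fastforce
qed

lemma Ck_on_const: "Ck_on n S (\<lambda>x. c)"
proof (induction n arbitrary: c)
  case (Suc n)
  then show ?case by (auto simp: frechet_derivative_const)
qed simp

lemma Ck_on_bounded_linear_comp:
  assumes "bounded_linear L" "open S" "Ck_on n S f"
  shows "Ck_on n S (\<lambda>x. L (f x))"
  using assms(3)
proof (induction n arbitrary: f)
  case 0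
  then show ?case using bounded_linear.continuous_on[OF assms(1)] by auto
next
  case (Suc n)
  show ?case
    by (rule Ck_on_SucI[OF assms(2), of _ "\<lambda>x v. L (\<D> f x v)"])
       (auto intro!: bounded_linear.has_derivative[OF assms(1)] Ck_on_SucD[OF Suc.prems] Suc.IH
         simp del: Ck_on.simps)
qed

lemma Ck_on_bounded_linear: 
  assumes "bounded_linear L" "open S" shows "Ck_on n S L"
proof -
  have "Ck_on n S (\<lambda>x. x)"
  proof (cases n)
    case (Suc k)
    show ?thesis unfolding Suc
      by (rule Ck_on_SucI[OF assms(2)]) (auto intro!: derivative_eq_intros Ck_on_const)
  qed simp
  then show ?thesis by (rule Ck_on_bounded_linear_comp[OF assms])
qed

lemma Ck_on_add:
  assumes "open S" "Ck_on n S f" "Ck_on n S g"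
  shows "Ck_on n S (\<lambda>x. f x + g x)"
  using assms(2,3)
proof (induction n arbitrary: f g)
  case 0
  then show ?case by (auto intro: continuous_intros)
next
  case (Suc n)
  show ?case
    by (rule Ck_on_SucI[OF assms(1) has_derivative_add])
       (use Ck_on_SucD[OF Suc.prems(1)] Ck_on_SucD[OF Suc.prems(2)] Suc.IH in auto)
qed

lemma Ck_on_sum:
  assumes "open S" "\<And>i. i \<in> I \<Longrightarrow> Ck_on n S (f i)"
  shows "Ck_on n S (\<lambda>x. \<Sum>i\<in>I. f i x)"
  using assms(2)
proof (induction I rule: infinite_finite_induct)
  case (insert i I)
  then show ?case using Ck_on_add[OF assms(1), of n "f i" "\<lambda>x. \<Sum>i\<in>I. f i x"] by auto
qed (auto simp: Ck_on_const)

lemma Ck_on_bilinear: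
  assumes "bounded_bilinear pr" "open S" "Ck_on n S f" "Ck_on n S g"
  shows "Ck_on n S (\<lambda>x. pr (f x) (g x))"
  using assms(3,4)
proof (induction n arbitrary: f g)
  case 0
  then show ?case using bounded_bilinear.continuous_on[OF assms(1)] by auto
next
  case (Suc n)
  show ?case
  proof (rule Ck_on_SucI[OF assms(2)])
    fix x assume "x \<in> S"
    then show "((\<lambda>x. pr (f x) (g x)) has_derivative
       (\<lambda>v. pr (f x) (\<D> g x v) + pr (\<D> f x v) (g x))) (at x)"
      by (intro bounded_bilinear.FDERIV[OF assms(1)] Ck_on_SucD(1)[OF Suc.prems(1)] Ck_on_SucD(1)[OF Suc.prems(2)])
  next
    fix v
    show "Ck_on n S (\<lambda>x. pr (f x) (\<D> g x v) + pr (\<D> f x v) (g x))"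
      by (intro Ck_on_add[OF assms(2)] Suc.IH Ck_on_SucD(2)[OF Suc.prems(1)] Ck_on_SucD(2)[OF Suc.prems(2)]
          Ck_on_Suc_imp[OF Suc.prems(1)] Ck_on_Suc_imp[OF Suc.prems(2)])
  qed
qed

lemma linear_Basis_expansion:
  fixes L :: "'e::euclidean_space \<Rightarrow> 'b::real_normed_vector"
  assumes "linear L"
  shows "L v = (\<Sum>i\<in>Basis. (v \<bullet> i) *\<^sub>R L i)"
proof -
  have "L v = L (\<Sum>i\<in>Basis. (v \<bullet> i) *\<^sub>R i)" by (simp add: euclidean_representation)
  also have "\<dots> = (\<Sum>i\<in>Basis. (v \<bullet> i) *\<^sub>R L i)"
    by (simp add: linear_sum[OF assms] linear_scale[OF assms])
  finally show ?thesis .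
qed

text \<open>In the chain rule both the base point and the direction of the outer derivative vary
  with \<open>x\<close>. Expanding the direction in the basis leaves products of a scalar function
  with composites in a fixed direction, to which the induction, generalized over \<open>f\<close>,
  applies.\<close>

lemma Ck_on_compose:
  fixes f :: "'e::euclidean_space \<Rightarrow> 'b::real_normed_vector"
  assumes "open S" "open T" "g ` S \<subseteq> T" "Ck_on n S g" "Ck_on n T f"
  shows "Ck_on n S (\<lambda>x. f (g x))"
  using assms(4,5)
proof (induction n arbitrary: f)
  case 0
  then show ?case using continuous_on_compose2[OF _ _ assms(3)] by auto
next
  case (Suc n)
  note f = Ck_on_SucD[OF Suc.prems(2)] and g = Ck_on_SucD[OF Suc.prems(1)]
  show ?case
  proof (rule Ck_on_SucI[OF assms(1)])
    fix x assume x: "x \<in> S"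
    then have gx: "g x \<in> T" using assms(3) by auto
    have lin: "linear (\<D> f (g x))"
      using f(1)[OF gx] has_derivative_linear by blast
    have "((\<lambda>x. f (g x)) has_derivative (\<lambda>v. \<D> f (g x) (\<D> g x v))) (at x)"
      using diff_chain_at[OF g(1)[OF x] f(1)[OF gx]] by (simp add: o_def)
    then show "((\<lambda>x. f (g x)) has_derivative (\<lambda>v. \<Sum>i\<in>Basis. (\<D> g x v \<bullet> i) *\<^sub>R \<D> f (g x) i)) (at x)"
      unfolding linear_Basis_expansion[OF lin, symmetric] .
  next
    fix v
    have "Ck_on n S (\<lambda>x. \<D> f (g x) i)" for i
      using Suc.IH[OF Ck_on_Suc_imp[OF Suc.prems(1)] f(2)] .
    then show "Ck_on n S (\<lambda>x. \<Sum>i\<in>Basis. (\<D> g x v \<bullet> i) *\<^sub>R \<D> f (g x) i)"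
      by (intro Ck_on_sum assms(1) Ck_on_bilinear[OF bounded_bilinear_scaleR]
          Ck_on_bounded_linear_comp[OF bounded_linear_inner_left] g(2))
  qed
qed

section \<open>Inversion of operator-valued maps\<close>

text \<open>A product rule in which one factor is merely continuous, which is possible because the
  other vanishes at \<open>x\<close>. It differentiates an inverse operator that is so far only
  known to be continuous.\<close>

lemma bounded_bilinear_has_derivative_zero_factor:
  assumes "bounded_bilinear pr" "isCont f x" "(g has_derivative g') (at x)" "g x = 0"
  shows "((\<lambda>y. pr (f y) (g y)) has_derivative (\<lambda>h. pr (f x) (g' h))) (at x)"
proof -
  interpret bounded_bilinear pr by fact
  interpret g': bounded_linear g' using assms(3) by (rule has_derivative_bounded_linear)
  obtain K where K: "\<And>h. norm (g' h) \<le> norm h * K" using g'.bounded by blast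
  have 1: "((\<lambda>y. (norm (g y - g' (y - x)) / norm (y - x))) \<longlongrightarrow> 0) (at x)"
    using assms(3,4) by (simp add: has_derivative_iff_norm)
  \<comment> \<open>The remainder quotient splits into a null factor times the bounded quotient of
    \<open>g y\<close> by \<open>norm (y - x)\<close>, and the image under \<open>pr (f x)\<close>
    of the remainder quotient of \<open>g\<close>.\<close>
  have "((\<lambda>y. pr (f y - f x) (g y /\<^sub>R norm (y - x)) + pr (f x) ((g y - g' (y - x)) /\<^sub>R norm (y - x))) \<longlongrightarrow> 0) (at x)"
  proof (rule tendsto_add_zero)
    have "((\<lambda>y. f y - f x) \<longlongrightarrow> 0) (at x)"
      using assms(2) by (simp add: isCont_def LIM_zero)
    moreover have "Bfun (\<lambda>y. g y /\<^sub>R norm (y - x)) (at x)"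
    proof (rule BfunI[of _ "1 + K"])
      have "\<forall>\<^sub>F y in at x. norm (g y - g' (y - x)) / norm (y - x) < 1"
        using order_tendstoD(2)[OF 1] by simp
      moreover have "\<forall>\<^sub>F y in at x. y \<noteq> x" by (simp add: eventually_neq_at_within)
      ultimately show "\<forall>\<^sub>F y in at x. norm (g y /\<^sub>R norm (y - x)) \<le> 1 + K"
      proof eventually_elim
        case (elim y)
        have "norm (g y) \<le> norm (g y - g' (y - x)) + norm (g' (y - x))"
          by (metis diff_add_cancel norm_triangle_ineq)
        also have "\<dots> \<le> norm (y - x) + norm (y - x) * K"
          using elim K[of "y - x"] by (intro add_mono) (auto simp: divide_simps)
        finally show ?case using elim by (simp add: divide_simps algebra_simps)
      qed
    qed
    ultimately show "((\<lambda>y. pr (f y - f x) (g y /\<^sub>R norm (y - x))) \<longlongrightarrow> 0) (at x)"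
      by (simp add: tendsto_Zfun_iff Zfun_prod_Bfun)
    have "((\<lambda>y. (g y - g' (y - x)) /\<^sub>R norm (y - x)) \<longlongrightarrow> 0) (at x)"
      by (subst tendsto_norm_zero_iff[symmetric]) (use 1 in \<open>simp add: divide_inverse mult.commute\<close>)
    then show "((\<lambda>y. pr (f x) ((g y - g' (y - x)) /\<^sub>R norm (y - x))) \<longlongrightarrow> 0) (at x)"
      by (rule tendsto_right_zero)
  qed
  then have "((\<lambda>y. (pr (f y) (g y) - pr (f x) (g x) - pr (f x) (g' (y - x))) /\<^sub>R norm (y - x)) \<longlongrightarrow> 0) (at x)"
    by (rule Lim_transform_eventually)
       (simp add: assms(4) diff_left diff_right scaleR_right algebra_simps zero_right)
  then have "((\<lambda>y. norm (pr (f y) (g y) - pr (f x) (g x) - pr (f x) (g' (y - x))) / norm (y - x)) \<longlongrightarrow> 0) (at x)"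
    by (subst (asm) tendsto_norm_zero_iff[symmetric]) (simp add: divide_inverse mult.commute)
  moreover have "bounded_linear (\<lambda>h. pr (f x) (g' h))"
    using bounded_linear_compose[OF bounded_linear_right g'.bounded_linear_axioms] .
  ultimately show ?thesis by (simp add: has_derivative_iff_norm)
qed

text \<open>All rests on the resolvent identity \<open>C y = C x - C y (A y - A x) C x\<close>. With
  the bound on \<open>C\<close> it gives continuity; then \<open>A y - A x\<close> is the factor
  vanishing at \<open>x\<close>, and the derivative is \<open>- C A' C\<close>. As this contains
  \<open>C\<close> undifferentiated, the order of differentiability rises by one at each step of the
  induction.\<close>

lemma Ck_on_blinfun_inverse:
  fixes A C :: "'e::euclidean_space \<Rightarrow> 'b::real_normed_vector \<Rightarrow>\<^sub>L 'b"
  assumes S: "open S" and CA: "\<And>x. x \<in> S \<Longrightarrow> C x o\<^sub>L A x = id_blinfun"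
    and AC: "\<And>x. x \<in> S \<Longrightarrow> A x o\<^sub>L C x = id_blinfun"
    and bd: "\<And>x. x \<in> S \<Longrightarrow> norm (C x) \<le> c"
    and A: "Ck_on n S A"
  shows "Ck_on n S C"
proof -
  interpret comp: bounded_bilinear "(o\<^sub>L)" by (rule bounded_bilinear_blinfun_compose)
  have eq: "C y = C x - (C y o\<^sub>L ((A y - A x) o\<^sub>L C x))" if "x \<in> S" "y \<in> S" for x y
  proof -
    have "C y o\<^sub>L ((A y - A x) o\<^sub>L C x) = ((C y o\<^sub>L A y) o\<^sub>L C x) - (C y o\<^sub>L (A x o\<^sub>L C x))"
      by (rule blinfun_eqI) (simp add: blinfun.bilinear_simps)
    also have "\<dots> = C x - C y"
      unfolding CA[OF that(2)] AC[OF that(1)] by (rule blinfun_eqI) (simp add: blinfun.bilinear_simps)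
    finally show ?thesis by simp
  qed
  have cont: "continuous_on S C" if cA: "continuous_on S A"
  proof (rule continuous_at_imp_continuous_on, rule)
    fix x assume x: "x \<in> S"
    have "((\<lambda>y. norm (C y - C x)) \<longlongrightarrow> 0) (at x)"
    proof (rule Lim_null_comparison[of _ "\<lambda>y. \<bar>c\<bar> * (norm (A y - A x) * norm (C x))"])
      have "\<forall>\<^sub>F y in at x. y \<in> S" using S x by (simp add: eventually_at_in_open')
      then show "\<forall>\<^sub>F y in at x. norm (norm (C y - C x)) \<le> \<bar>c\<bar> * (norm (A y - A x) * norm (C x))"
      proof eventually_elim
        case (elim y)
        have "norm (C y - C x) = norm (C y o\<^sub>L ((A y - A x) o\<^sub>L C x))"
          using eq[OF x elim] by (metis add_diff_cancel_left' norm_minus_commute diff_add_cancel)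
        also have "\<dots> \<le> norm (C y) * (norm (A y - A x) * norm (C x))"
          using norm_blinfun_compose[of "C y"] norm_blinfun_compose[of "A y - A x" "C x"]
          by (smt (verit, best) mult_left_mono norm_ge_zero)
        also have "\<dots> \<le> \<bar>c\<bar> * (norm (A y - A x) * norm (C x))"
          using bd[OF elim] by (intro mult_right_mono) auto
        finally show ?case by simp
      qed
      have "isCont A x" using cA S x continuous_on_eq_continuous_at by blast
      then have "((\<lambda>y. norm (A y - A x)) \<longlongrightarrow> 0) (at x)"
        by (simp add: isCont_def LIM_zero tendsto_norm_zero)
      then show "((\<lambda>y. \<bar>c\<bar> * (norm (A y - A x) * norm (C x))) \<longlongrightarrow> 0) (at x)"
        by (intro tendsto_mult_right_zero tendsto_mult_left_zero)
    qed
    then show "isCont C x" by (simp add: isCont_def LIM_zero_cancel tendsto_norm_zero_iff)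
  qed
  from A show ?thesis
  proof (induction n)
    case 0
    then show ?case using cont by simp
  next
    case (Suc n)
    note dA = Ck_on_SucD[OF Suc.prems]
    have cC: "continuous_on S C" using cont Ck_on_imp_continuous_on[OF Suc.prems] by blast
    show ?case
    proof (rule Ck_on_SucI[OF S])
      fix x assume x: "x \<in> S"
      have 1: "((\<lambda>y. (A y - A x) o\<^sub>L C x) has_derivative (\<lambda>h. \<D> A x h o\<^sub>L C x)) (at x)"
        using bounded_linear.has_derivative[OF comp.bounded_linear_left has_derivative_diff[OF dA(1)[OF x] has_derivative_const]]
        by simp
      have "isCont C x" using cC S x continuous_on_eq_continuous_at by blast
      from bounded_bilinear_has_derivative_zero_factor[OF comp.bounded_bilinear_axioms this 1]
      have "((\<lambda>y. C y o\<^sub>L ((A y - A x) o\<^sub>L C x)) has_derivative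
          (\<lambda>h. C x o\<^sub>L (\<D> A x h o\<^sub>L C x))) (at x)"
        by simp
      then have "((\<lambda>y. C x - (C y o\<^sub>L ((A y - A x) o\<^sub>L C x))) has_derivative
          (\<lambda>h. 0 - (C x o\<^sub>L (\<D> A x h o\<^sub>L C x)))) (at x)"
        by (intro has_derivative_diff has_derivative_const)
      then show "(C has_derivative (\<lambda>h. - (C x o\<^sub>L (\<D> A x h o\<^sub>L C x)))) (at x)"
        using has_derivative_transform_within_open[OF _ S x] eq[OF x] by fastforce
  next
      fix v
      have C: "Ck_on n S C" using Suc.IH[OF Ck_on_Suc_imp[OF Suc.prems]] .
      show "Ck_on n S (\<lambda>x. - (C x o\<^sub>L (\<D> A x v o\<^sub>L C x)))"
        by (intro Ck_on_bounded_linear_comp[OF bounded_linear_minus[OF bounded_linear_ident]] S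
            Ck_on_bilinear[OF comp.bounded_bilinear_axioms] C dA(2))
    qed
  qed
qed

subsection \<open>Smooth maps\<close>

lemma smooth_on_cong: "open S \<Longrightarrow> smooth_on S f \<Longrightarrow> (\<And>x. x \<in> S \<Longrightarrow> f x = g x) \<Longrightarrow> smooth_on S g"
  unfolding smooth_on_def using Ck_on_cong by blast

lemma smooth_on_has_derivative:
  "smooth_on S f \<Longrightarrow> x \<in> S \<Longrightarrow> (f has_derivative \<D> f x) (at x)"
  unfolding smooth_on_def using Ck_on_SucD(1) by blast

lemma smooth_on_derivative: "smooth_on S f \<Longrightarrow> smooth_on S (\<lambda>x. \<D> f x v)"
  unfolding smooth_on_def using Ck_on_SucD(2) by blast

lemma smooth_on_imp_continuous_on: "smooth_on S f \<Longrightarrow> continuous_on S f"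
  unfolding smooth_on_def using Ck_on_imp_continuous_on by blast

lemma smooth_on_subset: "smooth_on S f \<Longrightarrow> T \<subseteq> S \<Longrightarrow> smooth_on T f"
  unfolding smooth_on_def using Ck_on_subset by blast

lemma smooth_on_local:
  "(\<And>x. x \<in> S \<Longrightarrow> \<exists>T. open T \<and> x \<in> T \<and> smooth_on T f) \<Longrightarrow> smooth_on S f"
  unfolding smooth_on_def by (auto intro!: Ck_on_local)

lemma smooth_on_const: "smooth_on S (\<lambda>x. c)"
  by (simp add: smooth_on_def Ck_on_const)

lemma smooth_on_bounded_linear_comp:
  "bounded_linear L \<Longrightarrow> open S \<Longrightarrow> smooth_on S f \<Longrightarrow> smooth_on S (\<lambda>x. L (f x))"
  by (simp add: smooth_on_def Ck_on_bounded_linear_comp)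

lemma smooth_on_bounded_linear: "bounded_linear L \<Longrightarrow> open S \<Longrightarrow> smooth_on S L"
  by (simp add: smooth_on_def Ck_on_bounded_linear)

lemma smooth_on_add: "open S \<Longrightarrow> smooth_on S f \<Longrightarrow> smooth_on S g \<Longrightarrow> smooth_on S (\<lambda>x. f x + g x)"
  by (simp add: smooth_on_def Ck_on_add)

lemma smooth_on_diff: "open S \<Longrightarrow> smooth_on S f \<Longrightarrow> smooth_on S g \<Longrightarrow> smooth_on S (\<lambda>x. f x - g x)"
  using smooth_on_add[of S f "\<lambda>x. - g x"]
    smooth_on_bounded_linear_comp[OF bounded_linear_minus[OF bounded_linear_ident]] by fastforce

lemma smooth_on_sum: "open S \<Longrightarrow> (\<And>i. i \<in> I \<Longrightarrow> smooth_on S (f i)) \<Longrightarrow> smooth_on S (\<lambda>x. \<Sum>i\<in>I. f i x)"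
  by (simp add: smooth_on_def Ck_on_sum)

lemma smooth_on_bilinear:
  "bounded_bilinear pr \<Longrightarrow> open S \<Longrightarrow> smooth_on S f \<Longrightarrow> smooth_on S g \<Longrightarrow> smooth_on S (\<lambda>x. pr (f x) (g x))"
  by (simp add: smooth_on_def Ck_on_bilinear)

lemma smooth_on_mult:
  fixes f g :: "_ \<Rightarrow> real"
  shows "open S \<Longrightarrow> smooth_on S f \<Longrightarrow> smooth_on S g \<Longrightarrow> smooth_on S (\<lambda>x. f x * g x)"
  by (rule smooth_on_bilinear[OF bounded_bilinear_mult])

lemma smooth_on_compose:
  fixes f :: "'e::euclidean_space \<Rightarrow> 'b::real_normed_vector"
  shows "open S \<Longrightarrow> open T \<Longrightarrow> g ` S \<subseteq> T \<Longrightarrow> smooth_on S g \<Longrightarrow> smooth_on T f \<Longrightarrow> smooth_on S (\<lambda>x. f (g x))"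
  by (simp add: smooth_on_def Ck_on_compose)

lemma smooth_on_componentwise:
  fixes f :: "'e::euclidean_space \<Rightarrow> 'b::euclidean_space"
  assumes "open S" "\<And>i. i \<in> Basis \<Longrightarrow> smooth_on S (\<lambda>x. f x \<bullet> i)"
  shows "smooth_on S f"
proof -
  have "smooth_on S (\<lambda>x. \<Sum>i\<in>Basis. (f x \<bullet> i) *\<^sub>R i)"
    by (intro smooth_on_sum assms(1) smooth_on_bounded_linear_comp[OF bounded_linear_scaleR_left] assms(2))
  then show ?thesis by (simp add: euclidean_representation)
qed

text \<open>The operator is reassembled from its values on the basis as a sum of rank-one operators,
  each depending linearly on one of these values.\<close>

lemma smooth_on_blinfun_componentwise:
  fixes B :: "'e::euclidean_space \<Rightarrow> 'd::euclidean_space \<Rightarrow>\<^sub>L 'b::real_normed_vector"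
  assumes "open S" "\<And>i. i \<in> Basis \<Longrightarrow> smooth_on S (\<lambda>x. blinfun_apply (B x) i)"
  shows "smooth_on S B"
proof -
  have bl: "bounded_linear (\<lambda>w. blinfun_scaleR_left w o\<^sub>L blinfun_inner_left i :: 'd \<Rightarrow>\<^sub>L 'b)" for i
    using bounded_linear_compose[OF bounded_bilinear.bounded_linear_left[OF bounded_bilinear_blinfun_compose]
        bounded_linear_blinfun_scaleR_left] .
  have "smooth_on S (\<lambda>x. \<Sum>i\<in>Basis. blinfun_scaleR_left (blinfun_apply (B x) i) o\<^sub>L blinfun_inner_left i)"
    by (intro smooth_on_sum assms(1) smooth_on_bounded_linear_comp[OF bl] assms(2))
  moreover have "(\<Sum>i\<in>Basis. blinfun_scaleR_left (blinfun_apply (B x) i) o\<^sub>L blinfun_inner_left i) = B x" for x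
    by (rule blinfun_eqI, subst (2) linear_Basis_expansion)
       (auto simp: blinfun.sum_left bounded_linear.linear blinfun.bounded_linear_right inner_commute)
  ultimately show ?thesis by simp
qed

lemma smooth_on_blinfun_inverse:
  fixes A C :: "'e::euclidean_space \<Rightarrow> 'b::real_normed_vector \<Rightarrow>\<^sub>L 'b"
  assumes "open S" "\<And>x. x \<in> S \<Longrightarrow> C x o\<^sub>L A x = id_blinfun"
    "\<And>x. x \<in> S \<Longrightarrow> A x o\<^sub>L C x = id_blinfun" "\<And>x. x \<in> S \<Longrightarrow> norm (C x) \<le> c" "smooth_on S A"
  shows "smooth_on S C"
  using assms unfolding smooth_on_def using Ck_on_blinfun_inverse by blast

subsection \<open>Bump functions\<close>

text \<open>The functions \<open>x^(-k) e^(-1/x)\<close> on the positive half-line, extended by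
  zero. Derivatives of members are linear combinations of members, so one induction treats all
  orders.\<close>

definition flat_exp :: "nat \<Rightarrow> real \<Rightarrow> real" where
  "flat_exp k x = (if x \<le> 0 then 0 else exp (- inverse x) * inverse x ^ k)"

lemma flat_exp_tendsto_0: "(flat_exp k \<longlongrightarrow> 0) (at 0)"
proof -
  have "((\<lambda>x. inverse x ^ k / exp (inverse x)) \<longlongrightarrow> 0) (at_right (0::real))"
    by (rule filterlim_compose[OF tendsto_power_div_exp_0 filterlim_inverse_at_top_right])
  then have "(flat_exp k \<longlongrightarrow> 0) (at_right 0)"
    by (rule Lim_transform_eventually)
       (auto simp: flat_exp_def eventually_at_right_field exp_minus divide_inverse mult.commute intro!: exI[of _ 1])
  moreover have "(flat_exp k \<longlongrightarrow> 0) (at_left 0)"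
    by (rule Lim_transform_eventually[OF tendsto_const])
       (auto simp: flat_exp_def eventually_at_left_field intro!: exI[of _ "-1"])
  ultimately show ?thesis by (rule filterlim_split_at[rotated])
qed

lemma flat_exp_has_derivative:
  "(flat_exp k has_real_derivative flat_exp (k + 2) x - real k * flat_exp (k + 1) x) (at x)"
proof -
  consider "x < 0" | "x = 0" | "x > 0" by linarith
  then show ?thesis
  proof cases
    case 1
    have "((\<lambda>_. 0) has_real_derivative 0) (at x)" by simp
    then have "(flat_exp k has_real_derivative 0) (at x)"
      by (rule has_field_derivative_transform_within_open[of _ _ _ "{..<0}"]) (use 1 in \<open>auto simp: flat_exp_def\<close>)
    then show ?thesis using 1 by (simp add: flat_exp_def)
  next
    case 2
    \<comment> \<open>At the origin the difference quotient of \<open>flat_exp k\<close> is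
      \<open>flat_exp (Suc k)\<close>, which tends to 0.\<close>
    have "((\<lambda>h. (flat_exp k (0 + h) - flat_exp k 0) / h) \<longlongrightarrow> 0) (at 0)"
      by (rule Lim_transform_eventually[OF flat_exp_tendsto_0[of "Suc k"]])
         (auto simp: flat_exp_def divide_inverse)
    then show ?thesis using 2 by (simp add: has_field_derivative_def[symmetric] DERIV_def flat_exp_def)
  next
    case 3
    have "((\<lambda>x. exp (- inverse x) * inverse x ^ k) has_real_derivative
        exp (- inverse x) * (inverse x * inverse x) * inverse x ^ k
        - real k * (exp (- inverse x) * (inverse x ^ (k - 1) * (inverse x * inverse x)))) (at x)"
      using 3 by (auto intro!: derivative_eq_intros simp del: power_inverse simp: algebra_simps)
    moreover have "exp (- inverse x) * (inverse x * inverse x) * inverse x ^ k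
        - real k * (exp (- inverse x) * (inverse x ^ (k - 1) * (inverse x * inverse x)))
        = flat_exp (k + 2) x - real k * flat_exp (k + 1) x"
      using 3 by (cases k) (auto simp: flat_exp_def mult_ac)
    ultimately have "((\<lambda>x. exp (- inverse x) * inverse x ^ k) has_real_derivative
        flat_exp (k + 2) x - real k * flat_exp (k + 1) x) (at x)" by simp
    then show ?thesis
      by (rule has_field_derivative_transform_within_open[of _ _ _ "{0<..}"]) (use 3 in \<open>auto simp: flat_exp_def\<close>)
  qed
qed

lemma smooth_on_flat_exp: "smooth_on UNIV (flat_exp k)"
proof -
  have "Ck_on n UNIV (flat_exp k)" for n
  proof (induction n arbitrary: k)
    case 0
    show ?case
      by (auto intro!: continuous_at_imp_continuous_on DERIV_isCont[OF flat_exp_has_derivative])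
  next
    case (Suc n)
    have bl: "bounded_linear (\<lambda>y::real. c * y)" for c by (rule bounded_linear_mult_right)
    show ?case
    proof (rule Ck_on_SucI)
      show "(flat_exp k has_derivative (\<lambda>v. v * flat_exp (k + 2) x + (- v * real k) * flat_exp (k + 1) x)) (at x)" for x
        using flat_exp_has_derivative[of k x] unfolding has_field_derivative_def
        by (rule has_derivative_eq_rhs) (auto simp: algebra_simps)
      show "Ck_on n UNIV (\<lambda>x. v * flat_exp (k + 2) x + (- v * real k) * flat_exp (k + 1) x)" for v
        by (intro Ck_on_add Ck_on_bounded_linear_comp[OF bl] Suc.IH open_UNIV)
    qed simp
  qed
  then show ?thesis by (simp add: smooth_on_def)
qed

text \<open>Two nested uses of \<open>flat_exp 0\<close> avoid a quotient of functions. The inner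
  one, \<open>u\<close>, vanishes on the small ball and, by monotonicity, is at least
  \<open>c\<close> outside the large one; hence \<open>flat_exp 0 (c - u x)\<close> is a positive
  constant on the first and zero outside the second.\<close>

lemma smooth_bump:
  fixes x0 :: "'e::euclidean_space"
  assumes "0 < r1" "r1 < r2"
  obtains bump :: "'e \<Rightarrow> real" where "smooth_on UNIV bump" "\<And>x. x \<in> ball x0 r1 \<Longrightarrow> bump x = 1"
    "\<And>x. x \<notin> ball x0 r2 \<Longrightarrow> bump x = 0"
proof -
  define c where "c = flat_exp 0 (r2\<^sup>2 - r1\<^sup>2)"
  have mono: "flat_exp 0 a \<le> flat_exp 0 b" if "a \<le> b" for a b
    using that by (auto simp: flat_exp_def le_imp_inverse_le)
  have "r1\<^sup>2 < r2\<^sup>2" using assms by (simp add: power_strict_mono)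
  then have c: "c > 0" by (simp add: c_def flat_exp_def)
  then have fc: "flat_exp 0 c > 0" by (simp add: flat_exp_def)
  define u where "u x = flat_exp 0 ((x - x0) \<bullet> (x - x0) - r1\<^sup>2)" for x
  define bump where "bump x = inverse (flat_exp 0 c) * flat_exp 0 (c - u x)" for x
  have sm_id: "smooth_on UNIV (\<lambda>x. x - x0)"
    by (intro smooth_on_diff smooth_on_const smooth_on_bounded_linear[OF bounded_linear_ident] open_UNIV)
  have 1: "smooth_on UNIV u" unfolding u_def
    by (rule smooth_on_compose[OF open_UNIV open_UNIV _ _ smooth_on_flat_exp])
       (auto intro!: smooth_on_diff smooth_on_const smooth_on_bilinear[OF bounded_bilinear_inner] sm_id)
  have "smooth_on UNIV (\<lambda>x. flat_exp 0 (c - u x))"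
    by (rule smooth_on_compose[OF open_UNIV open_UNIV _ _ smooth_on_flat_exp])
       (auto intro!: smooth_on_diff smooth_on_const 1)
  then have "smooth_on UNIV bump" unfolding bump_def
    by (intro smooth_on_bounded_linear_comp[OF bounded_linear_mult_right] open_UNIV)
  moreover have "bump x = 1" if "x \<in> ball x0 r1" for x
  proof -
    have "norm (x - x0) ^ 2 \<le> r1 ^ 2" using that by (intro power_mono) (auto simp: dist_norm norm_minus_commute)
    then have "u x = 0" by (simp add: u_def flat_exp_def power2_norm_eq_inner)
    then show ?thesis using fc by (simp add: bump_def)
  qed
  moreover have "bump x = 0" if "x \<notin> ball x0 r2" for x
  proof -
    have "r2 ^ 2 \<le> norm (x - x0) ^ 2" using that assms by (intro power_mono) (auto simp: dist_norm norm_minus_commute)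
    then have "c \<le> u x" unfolding c_def u_def by (intro mono) (simp add: power2_norm_eq_inner)
    then show ?thesis by (simp add: bump_def flat_exp_def)
  qed
  ultimately show thesis by (rule that)
qed

subsection \<open>Hadamard's lemma and the symmetry of second derivatives\<close>

text \<open>Differentiation under the integral sign raises the weight from \<open>t ^ k\<close> to
  \<open>t ^ Suc k\<close> and replaces \<open>g\<close> by a directional derivative. Keeping
  \<open>k\<close> general therefore makes the family of ray integrals closed under
  differentiation.\<close>

lemma ray_integral_has_derivative:
  fixes g :: "'e::euclidean_space \<Rightarrow> 'b::banach"
  assumes g: "smooth_on (ball x0 r) g" and x: "x \<in> ball x0 r"
  shows "((\<lambda>x. integral (cbox 0 1) (\<lambda>t. t ^ k *\<^sub>R g (x0 + t *\<^sub>R (x - x0)))) has_derivative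
    (\<lambda>v. integral (cbox 0 1) (\<lambda>t. t ^ Suc k *\<^sub>R \<D> g (x0 + t *\<^sub>R (x - x0)) v))) (at x)"
proof -
  let ?S = "ball x0 r"
  define G where "G y = Blinfun (\<D> g y)" for y
  have G: "blinfun_apply (G y) = \<D> g y" if "y \<in> ?S" for y
    unfolding G_def using smooth_on_has_derivative[OF g that] by (simp add: bounded_linear_Blinfun_apply has_derivative_bounded_linear)
  have ray: "x0 + t *\<^sub>R (y - x0) \<in> ?S" if "y \<in> ?S" "t \<in> cbox 0 1" for y and t :: real
  proof -
    have "(1 - t) *\<^sub>R x0 + t *\<^sub>R y \<in> ?S"
      using that by (intro convexD) (auto intro: le_less_trans[OF zero_le_dist])
    then show ?thesis by (simp add: algebra_simps)
  qed
  have cont_ray: "continuous_on (?S \<times> cbox 0 1) (\<lambda>(y, t). x0 + t *\<^sub>R (y - x0))"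
    by (auto intro!: continuous_intros simp: case_prod_beta)
  have contG: "continuous_on ?S G"
    using continuous_on_cong[of ?S ?S "\<lambda>y. G y i" "\<lambda>y. \<D> g y i" for i] G
      smooth_on_imp_continuous_on[OF smooth_on_derivative[OF g]]
    by (intro continuous_on_blinfun_componentwise) fastforce
  define fx where "fx y t = t ^ Suc k *\<^sub>R G (x0 + t *\<^sub>R (y - x0))" for y t
  have cont_fx: "continuous_on (?S \<times> cbox 0 1) (\<lambda>(y, t). fx y t)"
    unfolding fx_def case_prod_beta
    by (intro continuous_intros continuous_on_compose2[OF contG]) (use ray in auto)
  have "((\<lambda>x. integral (cbox 0 1) (\<lambda>t. t ^ k *\<^sub>R g (x0 + t *\<^sub>R (x - x0)))) has_derivative
      blinfun_apply (integral (cbox 0 1) (fx x))) (at x within ?S)"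
  proof (rule leibniz_rule[OF _ _ cont_fx x])
    fix y and t :: real assume y: "y \<in> ?S" "t \<in> cbox 0 1"
    have "((\<lambda>y. x0 + t *\<^sub>R (y - x0)) has_derivative (\<lambda>v. t *\<^sub>R v)) (at y)"
      by (auto intro!: derivative_eq_intros)
    from diff_chain_at[OF this smooth_on_has_derivative[OF g ray[OF y]]]
    have "((\<lambda>y. g (x0 + t *\<^sub>R (y - x0))) has_derivative (\<lambda>v. G (x0 + t *\<^sub>R (y - x0)) (t *\<^sub>R v))) (at y)"
      by (simp add: o_def G[OF ray[OF y]])
    from has_derivative_scaleR_right[OF this, of "t ^ k"]
    have "((\<lambda>y. t ^ k *\<^sub>R g (x0 + t *\<^sub>R (y - x0))) has_derivative blinfun_apply (fx y t)) (at y)"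
      by (rule has_derivative_eq_rhs) (auto simp: fx_def blinfun.bilinear_simps mult.commute)
    then show "((\<lambda>y. t ^ k *\<^sub>R g (x0 + t *\<^sub>R (y - x0))) has_derivative blinfun_apply (fx y t)) (at y within ?S)"
      by (rule has_derivative_at_withinI)
  next
    fix y assume y: "y \<in> ?S"
    show "(\<lambda>t. t ^ k *\<^sub>R g (x0 + t *\<^sub>R (y - x0))) integrable_on cbox 0 1"
      by (intro integrable_continuous continuous_intros continuous_on_compose2[OF smooth_on_imp_continuous_on[OF g]])
         (use ray[OF y] in auto)
  qed simp
  then have "((\<lambda>x. integral (cbox 0 1) (\<lambda>t. t ^ k *\<^sub>R g (x0 + t *\<^sub>R (x - x0)))) has_derivative
      blinfun_apply (integral (cbox 0 1) (fx x))) (at x)"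
    by (simp add: at_within_open[OF x open_ball])
  moreover have "blinfun_apply (integral (cbox 0 1) (fx x)) v =
      integral (cbox 0 1) (\<lambda>t. t ^ Suc k *\<^sub>R \<D> g (x0 + t *\<^sub>R (x - x0)) v)" for v
  proof -
    have "fx x integrable_on cbox 0 1" unfolding fx_def
      by (intro integrable_continuous continuous_intros continuous_on_compose2[OF contG]) (use ray[OF x] in auto)
    then have "blinfun_apply (integral (cbox 0 1) (fx x)) v = integral (cbox 0 1) (\<lambda>t. blinfun_apply (fx x t) v)"
      by (rule blinfun_apply_integral)
    also have "\<dots> = integral (cbox 0 1) (\<lambda>t. t ^ Suc k *\<^sub>R \<D> g (x0 + t *\<^sub>R (x - x0)) v)"
      by (intro Henstock_Kurzweil_Integration.integral_cong)
         (use ray[OF x] in \<open>auto simp: fx_def blinfun.bilinear_simps G\<close>)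
    finally show ?thesis .
  qed
  ultimately show ?thesis by (rule has_derivative_eq_rhs[OF _ ext])
qed

lemma smooth_on_ray_integral:
  fixes g :: "'e::euclidean_space \<Rightarrow> 'b::banach"
  assumes "smooth_on (ball x0 r) g"
  shows "smooth_on (ball x0 r) (\<lambda>x. integral (cbox 0 1) (\<lambda>t. t ^ k *\<^sub>R g (x0 + t *\<^sub>R (x - x0))))"
proof -
  have "Ck_on n (ball x0 r) (\<lambda>x. integral (cbox 0 1) (\<lambda>t. t ^ k *\<^sub>R g (x0 + t *\<^sub>R (x - x0))))" for n
    using assms
  proof (induction n arbitrary: k g)
    case 0
    show ?case unfolding Ck_on.simps
      by (rule continuous_at_imp_continuous_on)
         (use has_derivative_continuous[OF ray_integral_has_derivative[OF 0]] in blast)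
  next
    case (Suc n)
    show ?case
      by (rule Ck_on_SucI[OF open_ball ray_integral_has_derivative[OF Suc.prems]])
         (simp_all only: Suc.IH[OF smooth_on_derivative[OF Suc.prems]])
  qed
  then show ?thesis by (simp add: smooth_on_def)
qed

text \<open>The fundamental theorem of calculus along the segment from \<open>x0\<close> to
  \<open>x\<close>; \<open>h i\<close> is the average of the partial derivative in direction
  \<open>i\<close> over that segment. It serves both the symmetry of second derivatives and the
  description of derivations.\<close>

lemma Hadamard:
  fixes g :: "'e::euclidean_space \<Rightarrow> 'b::banach"
  assumes g: "smooth_on (ball x0 r) g"
  obtains h where "\<And>i. smooth_on (ball x0 r) (h i)"
    "\<And>x. x \<in> ball x0 r \<Longrightarrow> g x = g x0 + (\<Sum>i\<in>Basis. ((x - x0) \<bullet> i) *\<^sub>R h i x)"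
proof
  let ?D = "\<lambda>x v. \<D> g x v"
  let ?h = "\<lambda>i x. integral (cbox 0 1) (\<lambda>t. t ^ 0 *\<^sub>R ?D (x0 + t *\<^sub>R (x - x0)) i)"
  show "smooth_on (ball x0 r) (?h i)" for i
    by (rule smooth_on_ray_integral[OF smooth_on_derivative[OF g]])
  fix x assume x: "x \<in> ball x0 r"
  have ray: "x0 + t *\<^sub>R (x - x0) \<in> ball x0 r" if "t \<in> cbox 0 1" for t :: real
  proof -
    have "(1 - t) *\<^sub>R x0 + t *\<^sub>R x \<in> ball x0 r"
      using that x by (intro convexD) (auto intro: le_less_trans[OF zero_le_dist])
    then show ?thesis by (simp add: algebra_simps)
  qed
  have "((\<lambda>t. ?D (x0 + t *\<^sub>R (x - x0)) (x - x0)) has_integral g (x0 + 1 *\<^sub>R (x - x0)) - g (x0 + 0 *\<^sub>R (x - x0))) {0..1}"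
  proof (rule fundamental_theorem_of_calculus)
    fix t :: real assume t: "t \<in> {0..1}"
    have "((\<lambda>t. x0 + t *\<^sub>R (x - x0)) has_derivative (\<lambda>s. s *\<^sub>R (x - x0))) (at t within {0..1})"
      by (auto intro!: derivative_eq_intros)
    from has_derivative_compose[OF this, of g] smooth_on_has_derivative[OF g ray] t
    have "((\<lambda>t. g (x0 + t *\<^sub>R (x - x0))) has_derivative (\<lambda>s. ?D (x0 + t *\<^sub>R (x - x0)) (s *\<^sub>R (x - x0)))) (at t within {0..1})"
      by (simp add: o_def)
    moreover have "linear (?D (x0 + t *\<^sub>R (x - x0)))"
      using smooth_on_has_derivative[OF g ray, of t] t has_derivative_linear by auto
    ultimately show "((\<lambda>t. g (x0 + t *\<^sub>R (x - x0))) has_vector_derivative ?D (x0 + t *\<^sub>R (x - x0)) (x - x0)) (at t within {0..1})"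
      by (simp add: has_vector_derivative_def linear_scale)
  qed simp
  then have "g x - g x0 = integral (cbox 0 1) (\<lambda>t. ?D (x0 + t *\<^sub>R (x - x0)) (x - x0))"
    by (simp add: integral_unique)
  also have "\<dots> = integral (cbox 0 1) (\<lambda>t. \<Sum>i\<in>Basis. ((x - x0) \<bullet> i) *\<^sub>R ?D (x0 + t *\<^sub>R (x - x0)) i)"
    by (intro Henstock_Kurzweil_Integration.integral_cong linear_Basis_expansion
        has_derivative_linear[OF smooth_on_has_derivative[OF g ray]])
  also have "\<dots> = (\<Sum>i\<in>Basis. integral (cbox 0 1) (\<lambda>t. ((x - x0) \<bullet> i) *\<^sub>R ?D (x0 + t *\<^sub>R (x - x0)) i))"
    by (intro Henstock_Kurzweil_Integration.integral_sum integrable_continuous continuous_intros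
        continuous_on_compose2[OF smooth_on_imp_continuous_on[OF smooth_on_derivative[OF g]]])
       (use ray in auto)
  also have "\<dots> = (\<Sum>i\<in>Basis. ((x - x0) \<bullet> i) *\<^sub>R ?h i x)"
    by (simp only: Henstock_Kurzweil_Integration.integral_cmul power_0 scaleR_one)
  finally show "g x = g x0 + (\<Sum>i\<in>Basis. ((x - x0) \<bullet> i) *\<^sub>R ?h i x)"
    by (simp only: diff_eq_eq add.commute)
qed

text \<open>Hadamard's expansion is taken around the very point \<open>x\<close>. Second derivatives
  of the functions \<open>h i\<close> would carry a factor vanishing at \<open>x\<close>, and what
  remains is visibly symmetric in \<open>v\<close> and \<open>w\<close>.\<close>

lemma second_derivative_symmetric:
  fixes f :: "'e::euclidean_space \<Rightarrow> 'b::banach"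
  assumes "open S" "smooth_on S f" "x \<in> S"
  shows "\<D> (\<lambda>y. \<D> f y v) x w =
    \<D> (\<lambda>y. \<D> f y w) x v"
proof -
  obtain r where r: "r > 0" "ball x r \<subseteq> S" using assms open_contains_ball by blast
  let ?B = "ball x r"
  obtain h where h: "\<And>i. smooth_on ?B (h i)"
    "\<And>y. y \<in> ?B \<Longrightarrow> f y = f x + (\<Sum>i\<in>Basis. ((y - x) \<bullet> i) *\<^sub>R h i y)"
    using Hadamard[OF smooth_on_subset[OF assms(2) r(2)]] by blast
  let ?D = "\<lambda>i y. \<D> (h i) y"
  have 1: "\<D> f y v = (\<Sum>i\<in>Basis. ((y - x) \<bullet> i) *\<^sub>R ?D i y v + (v \<bullet> i) *\<^sub>R h i y)"
    if y: "y \<in> ?B" for y v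
  proof -
    have "((\<lambda>y. f x + (\<Sum>i\<in>Basis. ((y - x) \<bullet> i) *\<^sub>R h i y)) has_derivative
        (\<lambda>v. \<Sum>i\<in>Basis. ((y - x) \<bullet> i) *\<^sub>R ?D i y v + (v \<bullet> i) *\<^sub>R h i y)) (at y)"
      by (auto intro!: derivative_eq_intros smooth_on_has_derivative[OF h(1) y])
    then have "(f has_derivative (\<lambda>v. \<Sum>i\<in>Basis. ((y - x) \<bullet> i) *\<^sub>R ?D i y v + (v \<bullet> i) *\<^sub>R h i y)) (at y)"
      by (rule has_derivative_transform_within_open[OF _ open_ball y]) (simp add: h(2))
    then show ?thesis by (rule fun_cong[OF frechet_derivative_at, symmetric])
  qed
  have 2: "\<D> (\<lambda>y. \<D> f y v) x w =
      (\<Sum>i\<in>Basis. (w \<bullet> i) *\<^sub>R ?D i x v + (v \<bullet> i) *\<^sub>R ?D i x w)" for v w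
  proof -
    have x: "x \<in> ?B" using r by simp
    have "((\<lambda>y. \<Sum>i\<in>Basis. ((y - x) \<bullet> i) *\<^sub>R ?D i y v + (v \<bullet> i) *\<^sub>R h i y) has_derivative
        (\<lambda>w. \<Sum>i\<in>Basis. (w \<bullet> i) *\<^sub>R ?D i x v + (v \<bullet> i) *\<^sub>R ?D i x w)) (at x)"
      by (auto intro!: derivative_eq_intros smooth_on_has_derivative[OF h(1) x]
          smooth_on_has_derivative[OF smooth_on_derivative[OF h(1)] x])
    then have "((\<lambda>y. \<D> f y v) has_derivative
        (\<lambda>w. \<Sum>i\<in>Basis. (w \<bullet> i) *\<^sub>R ?D i x v + (v \<bullet> i) *\<^sub>R ?D i x w)) (at x)"
      by (rule has_derivative_transform_within_open[OF _ open_ball x]) (simp add: 1)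
    then show ?thesis by (rule fun_cong[OF frechet_derivative_at, symmetric])
  qed
  show ?thesis unfolding 2 by (rule sum.cong) (auto simp: add.commute)
qed

section \<open>The local Frobenius theorem\<close>

text \<open>The derivative as a bounded operator, so that it has a norm and can itself be a smooth
  map into a normed space.\<close>

definition bderiv :: "('e::euclidean_space \<Rightarrow> 'b::real_normed_vector) \<Rightarrow> 'e \<Rightarrow> 'e \<Rightarrow>\<^sub>L 'b" where
  "bderiv f x = Blinfun (\<D> f x)"

lemma bderiv_apply:
  assumes "smooth_on S f" "x \<in> S"
  shows "blinfun_apply (bderiv f x) = \<D> f x"
  unfolding bderiv_def using smooth_on_has_derivative[OF assms]
  by (simp add: bounded_linear_Blinfun_apply has_derivative_bounded_linear)

lemma smooth_on_bderiv:
  assumes "open S" "smooth_on S f"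
  shows "smooth_on S (bderiv f)"
proof (rule smooth_on_blinfun_componentwise[OF assms(1)])
  fix i :: 'a
  show "smooth_on S (\<lambda>x. blinfun_apply (bderiv f x) i)"
    by (rule smooth_on_cong[OF assms(1) smooth_on_derivative[OF assms(2), of i]])
       (simp add: bderiv_apply[OF assms(2)])
qed

lemma smooth_on_derivative_bound:
  assumes "open S" "smooth_on S f" "compact K" "K \<subseteq> S"
  obtains L where "L > 0" "\<And>x. x \<in> K \<Longrightarrow> norm (bderiv f x) \<le> L"
proof -
  have "compact (bderiv f ` K)"
    using assms smooth_on_imp_continuous_on[OF smooth_on_bderiv[OF assms(1,2)]]
    by (intro compact_continuous_image) (auto intro: continuous_on_subset)
  then show thesis using that compact_imp_bounded bounded_pos by (metis imageI)
qed

text \<open>The first-order remainder is small uniformly in the base point: the mean value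
  inequality is applied to \<open>f\<close> minus its linear part at \<open>x\<close>, whose
  derivative on the segment is controlled by the uniform continuity of \<open>bderiv f\<close> on
  the compact convex set.\<close>

lemma smooth_on_uniform_derivative:
  assumes "open S" "smooth_on S f" "compact K" "convex K" "K \<subseteq> S" "\<epsilon> > 0"
  obtains \<delta> where "\<delta> > 0" "\<And>x y. x \<in> K \<Longrightarrow> y \<in> K \<Longrightarrow> norm (y - x) < \<delta> \<Longrightarrow>
    norm (f y - f x - bderiv f x (y - x)) \<le> \<epsilon> * norm (y - x)"
proof -
  have "uniformly_continuous_on K (bderiv f)"
    using assms smooth_on_imp_continuous_on[OF smooth_on_bderiv[OF assms(1,2)]]
    by (intro compact_uniformly_continuous) (auto intro: continuous_on_subset)
  then obtain \<delta> where \<delta>: "\<delta> > 0" "\<And>x y. x \<in> K \<Longrightarrow> y \<in> K \<Longrightarrow> norm (y - x) < \<delta> \<Longrightarrow>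
      norm (bderiv f y - bderiv f x) < \<epsilon>"
    using \<open>\<epsilon> > 0\<close> unfolding uniformly_continuous_on_def dist_norm by metis
  show thesis
  proof (rule that[OF \<delta>(1)])
    fix x y assume xy: "x \<in> K" "y \<in> K" "norm (y - x) < \<delta>"
    have seg: "closed_segment x y \<subseteq> K" using xy assms(4) closed_segment_subset by blast
    have "norm ((f y - bderiv f x y) - (f x - bderiv f x x)) \<le> \<epsilon> * norm (y - x)"
    proof (rule differentiable_bound[of "closed_segment x y" _ "\<lambda>z v. (bderiv f z - bderiv f x) v"])
      fix z assume z: "z \<in> closed_segment x y"
      then have zS: "z \<in> S" using seg assms(5) by auto
      show "((\<lambda>z. f z - bderiv f x z) has_derivative (\<lambda>v. (bderiv f z - bderiv f x) v)) (at z within closed_segment x y)"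
        unfolding blinfun.diff_left
        by (rule has_derivative_at_withinI[OF has_derivative_diff[OF
            smooth_on_has_derivative[OF assms(2) zS, folded bderiv_apply[OF assms(2) zS]]
            bounded_linear_imp_has_derivative[OF blinfun.bounded_linear_right]]])
      have "norm (z - x) < \<delta>" using segment_bound1[OF z] xy(3) by linarith
      then have "norm (bderiv f z - bderiv f x) \<le> \<epsilon>" by (intro less_imp_le \<delta>(2)) (use z seg xy in auto)
      then show "onorm (\<lambda>v. (bderiv f z - bderiv f x) v) \<le> \<epsilon>"
        by (simp add: norm_blinfun.rep_eq)
    qed auto
    moreover have "f y - f x - bderiv f x (y - x) = (f y - bderiv f x y) - (f x - bderiv f x x)"
      by (simp add: blinfun.bilinear_simps)
    ultimately show "norm (f y - f x - bderiv f x (y - x)) \<le> \<epsilon> * norm (y - x)" by (simp only:)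
  qed
qed

section \<open>Integration of a commuting frame along rays\<close>

text \<open>Banach's fixed point theorem, applied to bounded continuous maps with values in the ball
  and Lipschitz constant \<open>2 * M\<close>. The bound \<open>\<rho> * M \<le> R\<close> keeps
  values in the ball, and \<open>\<rho> * L \<le> 1 / 2\<close> gives the contraction factor. The
  Lipschitz bound is built into the space because differentiability across the rays is later deduced
  from it.\<close>

lemma ray_integral_equation_solvable:
  fixes B :: "'e::euclidean_space \<Rightarrow> 'd::euclidean_space \<Rightarrow>\<^sub>L 'e"
  assumes R: "R > 0" and M: "\<And>x. x \<in> cball x0 R \<Longrightarrow> norm (B x) \<le> M" "M > 0"
    and L: "\<And>x y. x \<in> cball x0 R \<Longrightarrow> y \<in> cball x0 R \<Longrightarrow> norm (B x - B y) \<le> L * norm (x - y)" "L > 0"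
    and \<rho>: "\<rho> > 0" "\<rho> * M \<le> R" "\<rho> * L \<le> 1 / 2"
  obtains y where "\<And>s. y s \<in> cball x0 R" "\<And>s s'. norm (y s - y s') \<le> 2 * M * norm (s - s')"
    "\<And>s. s \<in> cball 0 \<rho> \<Longrightarrow> y s = x0 + integral {0..1} (\<lambda>t. B (y (t *\<^sub>R s)) s)"
proof -
  \<comment> \<open>Members of \<open>bcontfun\<close> are total, so the equation is extended from
    the ball of radius \<open>\<rho>\<close> to the whole space by a retraction. Being 1-Lipschitz,
    it preserves the Lipschitz estimate.\<close>
  define P :: "'d \<Rightarrow> 'd" where "P = closest_point (cball 0 \<rho>)"
  have P: "norm (P s) \<le> \<rho>" "s \<in> cball 0 \<rho> \<Longrightarrow> P s = s" "norm (P s - P s') \<le> norm (s - s')" for s s'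
    using closest_point_in_set[of "cball (0::'d) \<rho>" s] \<rho> closest_point_self[of s "cball 0 \<rho>"]
      closest_point_lipschitz[of "cball (0::'d) \<rho>" s s']
    by (auto simp: P_def dist_norm)
  define \<S> :: "('d \<Rightarrow>\<^sub>C 'e) set" where
    "\<S> = {f :: 'd \<Rightarrow>\<^sub>C 'e. (\<forall>s. f s \<in> cball x0 R) \<and> (\<forall>s s'. norm (f s - f s') \<le> 2 * M * norm (s - s'))}"
  define g where "g f s t = B (apply_bcontfun f (t *\<^sub>R P s)) (P s)" for f s and t :: real
  define H where "H f s = x0 + integral {0..1} (g f s)" for f s
  have contB: "continuous_on (cball x0 R) B"
    using L lipschitz_on_continuous_on[of L "cball x0 R" B] by (auto simp: lipschitz_on_def dist_norm)
  have contg: "continuous_on {0..1} (g f s)" if "f \<in> \<S>" for f s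
    unfolding g_def using that
    by (intro continuous_intros continuous_on_compose2[OF contB] continuous_on_compose2[OF continuous_on_apply_bcontfun[of UNIV]])
       (auto simp: \<S>_def)
  have bd: "norm (H f s - x0) \<le> R" if "f \<in> \<S>" for f s
  proof -
    have "norm (integral {0..1} (g f s)) \<le> (\<rho> * M) * (1 - 0)"
    proof (rule integral_bound[OF _ contg[OF that]])
      fix t :: real assume "t \<in> {0..1}"
      have "norm (g f s t) \<le> norm (B (f (t *\<^sub>R P s))) * norm (P s)" unfolding g_def by (rule norm_blinfun)
      also have "\<dots> \<le> M * \<rho>" using M P that by (intro mult_mono) (auto simp: \<S>_def)
      finally show "norm (g f s t) \<le> \<rho> * M" by (simp add: mult.commute)
    qed simp
    then show ?thesis using \<rho>(2) by (simp add: H_def)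
  qed
  have Hdiff: "norm (H f s - H f' s') \<le> c"
    if "f \<in> \<S>" "f' \<in> \<S>" "\<And>t. t \<in> {0..1} \<Longrightarrow> norm (g f s t - g f' s' t) \<le> c" for f s f' s' c
  proof -
    have "H f s - H f' s' = integral {0..1} (\<lambda>t. g f s t - g f' s' t)"
      unfolding H_def using contg that
      by (subst Henstock_Kurzweil_Integration.integral_diff) (auto intro: integrable_continuous_interval)
    also have "norm \<dots> \<le> c * (1 - 0)"
      by (rule integral_bound) (use that contg in \<open>auto intro: continuous_intros\<close>)
    finally show ?thesis by simp
  qed
  \<comment> \<open>Two sources of variation, each at most \<open>M * norm (s - s')\<close>: the
    argument of \<open>B\<close>, with factor \<open>L * (2 * M) * \<rho> \<le> M\<close>, and the
    vector to which \<open>B\<close> is applied.\<close>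
  have lip: "norm (H f s - H f s') \<le> 2 * M * norm (s - s')" if f: "f \<in> \<S>" for f s s'
  proof (rule Hdiff[OF f f])
    fix t :: real assume t: "t \<in> {0..1}"
    let ?x = "f (t *\<^sub>R P s)" and ?x' = "f (t *\<^sub>R P s')"
    have "g f s t - g f s' t = (B ?x - B ?x') (P s) + B ?x' (P s - P s')"
      by (simp add: g_def blinfun.bilinear_simps)
    also have "norm \<dots> \<le> norm (B ?x - B ?x') * norm (P s) + norm (B ?x') * norm (P s - P s')"
      by (rule order_trans[OF norm_triangle_ineq add_mono[OF norm_blinfun norm_blinfun]])
    finally have 1: "norm (g f s t - g f s' t) \<le> norm (B ?x - B ?x') * norm (P s) + norm (B ?x') * norm (P s - P s')" .
    have "norm (?x - ?x') \<le> 2 * M * norm (t *\<^sub>R P s - t *\<^sub>R P s')" using f by (auto simp: \<S>_def)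
    also have "norm (t *\<^sub>R P s - t *\<^sub>R P s') = t * norm (P s - P s')"
      using t by (simp add: scaleR_right_diff_distrib[symmetric])
    finally have "norm (?x - ?x') \<le> 2 * M * (t * norm (P s - P s'))" .
    moreover have "t * norm (P s - P s') \<le> 1 * norm (s - s')" using t P by (intro mult_mono) auto
    ultimately have x: "norm (?x - ?x') \<le> 2 * M * norm (s - s')"
      using M by (smt (verit, best) mult_left_mono)
    have "norm (B ?x - B ?x') \<le> L * norm (?x - ?x')" using L(1) f by (auto simp: \<S>_def)
    also have "\<dots> \<le> L * (2 * M * norm (s - s'))" using x L(2) by (intro mult_left_mono) auto
    finally have "norm (B ?x - B ?x') * norm (P s) \<le> (L * (2 * M * norm (s - s'))) * \<rho>"
      using P L M by (intro mult_mono) auto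
    also have "\<dots> = (\<rho> * L) * (2 * M * norm (s - s'))" by simp
    also have "\<dots> \<le> 1 / 2 * (2 * M * norm (s - s'))" using \<rho>(3) M by (intro mult_right_mono) auto
    finally have 2: "norm (B ?x - B ?x') * norm (P s) \<le> M * norm (s - s')" by simp
    have 3: "norm (B ?x') * norm (P s - P s') \<le> M * norm (s - s')"
      using M P f by (intro mult_mono) (auto simp: \<S>_def)
    show "norm (g f s t - g f s' t) \<le> 2 * M * norm (s - s')" using 1 2 3 by linarith
  qed
  have Hb: "H f \<in> bcontfun" if "f \<in> \<S>" for f
  proof (rule bcontfun_normI)
    show "continuous_on UNIV (H f)"
      by (rule lipschitz_on_continuous_on[OF lipschitz_onI[of _ _ "2 * M"]])
         (use lip[OF that] M in \<open>simp_all add: dist_norm\<close>)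
    show "norm (H f s) \<le> norm x0 + R" for s
      using bd[OF that, of s] norm_triangle_sub[of "H f s" x0] by simp
  qed
  define T where "T f = Bcontfun (H f)" for f
  have T: "apply_bcontfun (T f) = H f" if "f \<in> \<S>" for f
    using Hb[OF that] by (simp add: T_def Bcontfun_inverse)
  have "\<exists>!f\<in>\<S>. T f = f"
  proof (rule Banach_fix)
    have "closed \<S>"
      unfolding closed_sequential_limits
    proof (intro allI impI, elim conjE)
      fix F f assume F: "\<forall>n. F n \<in> \<S>" and lim: "F \<longlonglongrightarrow> f"
      have ptw: "(\<lambda>n. F n s) \<longlonglongrightarrow> f s" for s
        using lim by (rule metric_tendsto_imp_tendsto) (simp add: dist_bounded)
      have "f s \<in> cball x0 R" for s
        by (rule closed_sequentially[OF closed_cball _ ptw]) (use F in \<open>auto simp: \<S>_def\<close>)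
      moreover have "norm (f s - f s') \<le> 2 * M * norm (s - s')" for s s'
        by (rule Lim_bounded[OF tendsto_norm[OF tendsto_diff[OF ptw ptw]]]) (use F in \<open>auto simp: \<S>_def\<close>)
      ultimately show "f \<in> \<S>" by (simp add: \<S>_def)
    qed
    then show "complete \<S>" by (simp add: complete_eq_closed)
    have "const_bcontfun x0 \<in> \<S>" using R M by (simp add: \<S>_def const_bcontfun.rep_eq)
    then show "\<S> \<noteq> {}" by auto
    show "T ` \<S> \<subseteq> \<S>"
    proof
      fix h assume "h \<in> T ` \<S>"
      then obtain f where f: "f \<in> \<S>" "h = T f" by auto
      show "h \<in> \<S>" unfolding f(2) \<S>_def using T[OF f(1)] bd[OF f(1)] lip[OF f(1)]
        by (simp add: dist_norm norm_minus_commute)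
    qed
    fix f f' assume f: "f \<in> \<S>" "f' \<in> \<S>"
    show "dist (T f) (T f') \<le> 1 / 2 * dist f f'"
    proof (rule dist_bound)
      fix s
      have "norm (H f s - H f' s) \<le> 1 / 2 * dist f f'"
      proof (rule Hdiff[OF f])
        fix t :: real assume t: "t \<in> {0..1}"
        let ?x = "f (t *\<^sub>R P s)" and ?x' = "f' (t *\<^sub>R P s)"
        have "g f s t - g f' s t = (B ?x - B ?x') (P s)"
          by (simp add: g_def blinfun.bilinear_simps)
        also have "norm \<dots> \<le> norm (B ?x - B ?x') * norm (P s)" by (rule norm_blinfun)
        also have "\<dots> \<le> (L * dist f f') * \<rho>"
        proof (intro mult_mono)
          have "norm (B ?x - B ?x') \<le> L * norm (?x - ?x')" using L(1) f by (auto simp: \<S>_def)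
          also have "\<dots> \<le> L * dist f f'" using L(2) dist_bounded[of f _ f'] by (simp add: dist_norm)
          finally show "norm (B ?x - B ?x') \<le> L * dist f f'" .
        qed (use P L in auto)
        also have "\<dots> = (\<rho> * L) * dist f f'" by simp
        also have "\<dots> \<le> 1 / 2 * dist f f'" using \<rho>(3) by (intro mult_right_mono) auto
        finally show "norm (g f s t - g f' s t) \<le> 1 / 2 * dist f f'" .
      qed
      then show "dist (T f s) (T f' s) \<le> 1 / 2 * dist f f'" using T f by (simp add: dist_norm)
    qed
  qed auto
  then obtain f where f: "f \<in> \<S>" "T f = f" by auto
  show thesis
  proof (rule that[of f])
    show "f s \<in> cball x0 R" "norm (f s - f s') \<le> 2 * M * norm (s - s')" for s s'
      using f(1) by (auto simp: \<S>_def)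
    show "f s = x0 + integral {0..1} (\<lambda>t. B (f (t *\<^sub>R s)) s)" if "s \<in> cball 0 \<rho>" for s
    proof -
      have "f s = H f s" using T[OF f(1)] f(2) by simp
      also have "\<dots> = x0 + integral {0..1} (\<lambda>t. B (f (t *\<^sub>R s)) s)"
        by (simp add: H_def g_def[abs_def] P(2)[OF that])
      finally show ?thesis .
    qed
  qed
qed

lemma ray_integral_equation_vector_derivative:
  fixes B :: "'e::euclidean_space \<Rightarrow> 'd::euclidean_space \<Rightarrow>\<^sub>L 'e"
  assumes contB: "continuous_on K B" and yK: "\<And>s. y s \<in> K" and conty: "continuous_on UNIV y"
    and y: "\<And>s. s \<in> cball 0 \<rho> \<Longrightarrow> y s = x0 + integral {0..1} (\<lambda>t. B (y (t *\<^sub>R s)) s)"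
    and s: "s \<in> cball 0 \<rho>" and t: "t \<in> {0..1}"
  shows "((\<lambda>t. y (t *\<^sub>R s)) has_vector_derivative B (y (t *\<^sub>R s)) s) (at t within {0..1})"
proof -
  define k where "k t = B (y (t *\<^sub>R s)) s" for t
  define I where "I \<tau> = integral {0..\<tau>} k" for \<tau>
  have contk: "continuous_on {0..1} k" unfolding k_def
    by (intro continuous_intros continuous_on_compose2[OF contB] continuous_on_compose2[OF conty]) (use yK in auto)
  have I: "(I has_vector_derivative k \<tau>) (at \<tau> within {0..1})" if "\<tau> \<in> {0..1}" for \<tau>
    unfolding I_def by (rule integral_has_vector_derivative[OF contk that])
  \<comment> \<open>Rescaling the integration variable by \<open>\<tau>\<close> turns the equation
    at the point \<open>\<tau> s\<close> into an integral over \<open>{0..\<tau>}\<close>. Using an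
    antiderivative rather than a change of variables covers \<open>\<tau> = 0\<close> as
    well.\<close>
  have eq: "y (\<tau> *\<^sub>R s) = x0 + I \<tau>" if \<tau>: "\<tau> \<in> {0..1}" for \<tau>
  proof -
    have mem: "t * \<tau> \<in> {0..1}" if "t \<in> {0..1}" for t using \<tau> that by (auto intro: mult_le_one)
    have "((\<lambda>t. \<tau> *\<^sub>R k (t * \<tau>)) has_integral I (1 * \<tau>) - I (0 * \<tau>)) {0..1}"
    proof (rule fundamental_theorem_of_calculus)
      fix t :: real assume t: "t \<in> {0..1}"
      have "((\<lambda>t. t * \<tau>) has_vector_derivative \<tau>) (at t within {0..1})"
        by (auto intro!: derivative_eq_intros)
      moreover have "(I has_vector_derivative k (t * \<tau>)) (at (t * \<tau>) within (\<lambda>t. t * \<tau>) ` {0..1})"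
        by (rule has_vector_derivative_within_subset[OF I[OF mem[OF t]]]) (use mem in auto)
      ultimately show "((\<lambda>t. I (t * \<tau>)) has_vector_derivative \<tau> *\<^sub>R k (t * \<tau>)) (at t within {0..1})"
        using vector_diff_chain_within by (fastforce simp: o_def)
    qed simp
    moreover have "s \<in> cball 0 \<rho> \<Longrightarrow> \<tau> *\<^sub>R s \<in> cball 0 \<rho>"
      using \<tau> mult_left_le_one_le[of "norm s" \<tau>] by auto
    moreover have "(\<lambda>t. B (y (t *\<^sub>R \<tau> *\<^sub>R s)) (\<tau> *\<^sub>R s)) = (\<lambda>t. \<tau> *\<^sub>R k (t * \<tau>))"
      by (simp add: k_def blinfun.scaleR_right)
    moreover have "I 0 = 0" by (simp add: I_def)
    ultimately show ?thesis using y[of "\<tau> *\<^sub>R s"] s by (simp only: integral_unique) simp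
  qed
  have "((\<lambda>\<tau>. x0 + I \<tau>) has_vector_derivative k t) (at t within {0..1})"
    using has_vector_derivative_add[OF has_vector_derivative_const I[OF t]] by simp
  then show ?thesis unfolding k_def
    by (rule has_vector_derivative_transform[OF t, rotated]) (simp add: eq)
qed

text \<open>The integrability condition \<open>comm\<close> makes the first-order defect
  \<open>w t = y (t (s + h)) - y (t s) - t B (y (t s)) h\<close> along a ray satisfy a linear differential equation
  up to an error \<open>o(h)\<close>, so that \<open>w 1 = o(h)\<close>; this is differentiability of \<open>y\<close> at \<open>s\<close>.\<close>

lemma ray_solution_has_derivative:
  fixes B :: "'e::euclidean_space \<Rightarrow> 'd::euclidean_space \<Rightarrow>\<^sub>L 'e"
  assumes S: "open S" "cball x0 R \<subseteq> S" and B: "smooth_on S B"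
    and comm: "\<And>x v w. x \<in> S \<Longrightarrow> bderiv B x (B x v) w = bderiv B x (B x w) v"
    and L: "\<And>x. x \<in> cball x0 R \<Longrightarrow> norm (bderiv B x) \<le> L" "L > 0"
    and \<rho>: "\<rho> > 0" "\<rho> * L \<le> 1 / 2" 
    and yK: "\<And>s. y s \<in> cball x0 R" and lip: "\<And>s s'. norm (y s - y s') \<le> C * norm (s - s')" "C > 0"
    and vd: "\<And>s t. s \<in> cball 0 \<rho> \<Longrightarrow> t \<in> {0..1} \<Longrightarrow>
      ((\<lambda>t. y (t *\<^sub>R s)) has_vector_derivative B (y (t *\<^sub>R s)) s) (at t within {0..1})"
    and y0: "y 0 = x0" and s: "s \<in> ball 0 \<rho>"
  shows "(y has_derivative B (y s)) (at s)"
  unfolding has_derivative_at_alt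
proof (intro conjI allI impI)
  show "bounded_linear (B (y s))" by (rule blinfun.bounded_linear_right)
  fix e :: real assume e: "e > 0"
  \<comment> \<open>The Taylor remainder of \<open>B\<close> enters the estimate of
    \<open>w'\<close> with the factor \<open>C * \<rho>\<close>, from
    \<open>norm k \<le> C * norm h\<close> and the bound \<open>\<rho>\<close> on
    \<open>s + h\<close>; this choice makes its share \<open>e / 4\<close>.\<close>
  define \<epsilon> where "\<epsilon> = e / (4 * C * \<rho>)"
  have \<epsilon>: "\<epsilon> > 0" using e \<rho> lip(2) by (simp add: \<epsilon>_def)
  obtain \<delta> where \<delta>: "\<delta> > 0" "\<And>x y. x \<in> cball x0 R \<Longrightarrow> y \<in> cball x0 R \<Longrightarrow> norm (y - x) < \<delta> \<Longrightarrow>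
      norm (B y - B x - bderiv B x (y - x)) \<le> \<epsilon> * norm (y - x)"
    by (rule smooth_on_uniform_derivative[OF S(1) B compact_cball convex_cball S(2) \<epsilon>]) blast
  \<comment> \<open>The three bounds in turn bring \<open>z' t\<close> within
    \<open>\<delta>\<close> of \<open>z t\<close>, make the term quadratic in \<open>h\<close> at
    most \<open>e / 4 * norm h\<close>, and keep \<open>s + h\<close> in the ball where the ray
    equation holds.\<close>
  define d where "d = Min {\<delta> / C, e / (4 * L * C), \<rho> - norm s}"
  have d: "d > 0" using \<delta> e L lip(2) s by (simp add: d_def)
  show "\<exists>d>0. \<forall>s'. norm (s' - s) < d \<longrightarrow> norm (y s' - y s - B (y s) (s' - s)) \<le> e * norm (s' - s)"
  proof (intro exI[of _ d] conjI d allI impI)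
    fix s' assume s': "norm (s' - s) < d"
    define h where "h = s' - s"
    have h: "norm h < \<delta> / C" "norm h < e / (4 * L * C)" "norm h < \<rho> - norm s"
      using s' by (auto simp: d_def h_def)
    have sh: "s + h \<in> cball 0 \<rho>" using h(3) norm_triangle_ineq[of s h] by simp
    have sc: "s \<in> cball 0 \<rho>" using s by simp
    define z where "z t = y (t *\<^sub>R s)" for t
    define z' where "z' t = y (t *\<^sub>R (s + h))" for t
    define w where "w t = z' t - z t - t *\<^sub>R B (z t) h" for t
    define w' where "w' t = B (z' t) (s + h) - B (z t) s - (t *\<^sub>R bderiv B (z t) (B (z t) s) h + B (z t) h)" for t
    have zK: "z t \<in> cball x0 R" "z' t \<in> cball x0 R" for t using yK by (auto simp: z_def z'_def)
    have der: "(w has_vector_derivative w' t) (at t within {0..1})" if t: "t \<in> {0..1}" for t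
    proof -
      have dz: "(z has_vector_derivative B (z t) s) (at t within {0..1})"
        using vd[OF sc t] by (simp add: z_def[abs_def])
      have dz': "(z' has_vector_derivative B (z' t) (s + h)) (at t within {0..1})"
        using vd[OF sh t] by (simp add: z'_def[abs_def])
      have zS: "z t \<in> S" using zK S(2) by auto
      have "(B has_derivative bderiv B (z t)) (at (z t))"
        using smooth_on_has_derivative[OF B zS] by (simp add: bderiv_apply[OF B zS])
      from has_derivative_compose[OF dz[unfolded has_vector_derivative_def] this]
      have "((\<lambda>t. B (z t)) has_vector_derivative bderiv B (z t) (B (z t) s)) (at t within {0..1})"
        by (simp add: has_vector_derivative_def blinfun.scaleR_right)
      from bounded_linear.has_vector_derivative[OF blinfun.bounded_linear_left this]
      have "((\<lambda>t. B (z t) h) has_vector_derivative bderiv B (z t) (B (z t) s) h) (at t within {0..1})" .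
      from has_vector_derivative_scaleR[OF DERIV_ident this]
      have "((\<lambda>t. t *\<^sub>R B (z t) h) has_vector_derivative (t *\<^sub>R bderiv B (z t) (B (z t) s) h + B (z t) h)) (at t within {0..1})"
        by simp
      then show ?thesis unfolding w_def w'_def
        by (intro has_vector_derivative_diff dz dz')
    qed
    have est: "norm (w' t) \<le> 1 / 2 * norm (w t) + e / 2 * norm h" if t: "t \<in> {0..1}" for t
    proof -
      define k where "k = z' t - z t"
      define E where "E = B (z' t) - B (z t) - bderiv B (z t) k"
      let ?D = "bderiv B (z t)"
      have "norm k \<le> C * norm (t *\<^sub>R (s + h) - t *\<^sub>R s)" unfolding k_def z_def z'_def by (rule lip)
      also have "\<dots> = C * (t * norm h)" using t by (simp add: scaleR_right_distrib)
      also have "\<dots> \<le> C * (1 * norm h)" using t lip(2) by (intro mult_left_mono mult_right_mono) auto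
      finally have k: "norm k \<le> C * norm h" by simp
      then have "norm k < \<delta>" using h(1) lip(2) by (simp add: field_simps)
      then have E: "norm E \<le> \<epsilon> * norm k" using \<delta>(2)[OF zK, of t] by (simp add: E_def k_def)
      have "z t \<in> S" using zK(1)[of t] S(2) by blast
      \<comment> \<open>Commutation exchanges \<open>s\<close> and \<open>h\<close>. Then the terms
        of first order in \<open>h\<close> combine with those in \<open>k\<close> to
        \<open>w t\<close>; otherwise one of them would survive and spoil the estimate.\<close>
      then have "t *\<^sub>R ?D (B (z t) s) h = ?D (t *\<^sub>R B (z t) h) s"
        using comm[of "z t" s h] by (simp add: blinfun.bilinear_simps)
      moreover have "k = w t + t *\<^sub>R B (z t) h" by (simp add: w_def k_def)
      ultimately have "w' t = ?D (w t) s + (?D k h + E (s + h))"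
        by (simp add: w'_def E_def blinfun.bilinear_simps)
      also have "norm \<dots> \<le> norm (?D (w t) s) + (norm (?D k h) + norm (E (s + h)))"
        by (meson add_left_mono norm_triangle_ineq order_trans)
      also have "\<dots> \<le> (L * norm (w t)) * \<rho> + ((L * (C * norm h)) * norm h + (\<epsilon> * (C * norm h)) * \<rho>)"
      proof (intro add_mono)
        have "norm (?D (w t) s) \<le> norm (?D (w t)) * norm s" by (rule norm_blinfun)
        also have "\<dots> \<le> (norm ?D * norm (w t)) * norm s" by (intro mult_right_mono norm_blinfun) auto
        also have "\<dots> \<le> (L * norm (w t)) * \<rho>" using L zK sc by (intro mult_mono) auto
        finally show "norm (?D (w t) s) \<le> (L * norm (w t)) * \<rho>" .
        have "norm (?D k h) \<le> norm (?D k) * norm h" by (rule norm_blinfun)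
        also have "\<dots> \<le> (norm ?D * norm k) * norm h" by (intro mult_right_mono norm_blinfun) auto
        also have "\<dots> \<le> (L * (C * norm h)) * norm h" using L zK k lip(2) by (intro mult_right_mono mult_mono) auto
        finally show "norm (?D k h) \<le> (L * (C * norm h)) * norm h" .
        have "norm (E (s + h)) \<le> norm E * norm (s + h)" by (rule norm_blinfun)
        also have "\<dots> \<le> (\<epsilon> * (C * norm h)) * \<rho>"
          using order_trans[OF E mult_left_mono[OF k]] \<epsilon> sh lip(2) by (intro mult_mono) auto
        finally show "norm (E (s + h)) \<le> (\<epsilon> * (C * norm h)) * \<rho>" .
      qed
      also have "\<dots> = (\<rho> * L) * norm (w t) + ((L * C * norm h) * norm h + (\<epsilon> * C * \<rho>) * norm h)" by (simp add: algebra_simps)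
      also have "\<dots> \<le> 1 / 2 * norm (w t) + (e / 4 * norm h + e / 4 * norm h)"
      proof (intro add_mono mult_right_mono)
        show "L * C * norm h \<le> e / 4" using h(2) L(2) lip(2) by (simp add: field_simps)
        show "\<epsilon> * C * \<rho> \<le> e / 4" using \<rho>(1) lip(2) by (simp add: \<epsilon>_def)
      qed (use \<rho>(2) in auto)
      finally show ?thesis by simp
    qed
    have "continuous_on {0..1} w"
      using der has_vector_derivative_continuous continuous_on_eq_continuous_within by blast
    \<comment> \<open>A maximum of \<open>norm w\<close> replaces Gronwall's inequality: since
      \<open>w 0 = 0\<close> and the interval has length one, \<open>norm (w T)\<close> is at most
      half of itself plus \<open>e / 2 * norm h\<close>, and the half can be absorbed.\<close>
    then have "continuous_on {0..1} (\<lambda>t. norm (w t))" by (intro continuous_intros)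
    then obtain T where T: "T \<in> {0..1}" "\<And>t. t \<in> {0..1} \<Longrightarrow> norm (w t) \<le> norm (w T)"
      using continuous_attains_sup[of "{0..1::real}" "\<lambda>t. norm (w t)"] by auto
    have "norm (w T - w 0) \<le> (1 / 2 * norm (w T) + e / 2 * norm h) * norm (T - 0)"
    proof (rule differentiable_bound[of "{0..1}" w "\<lambda>t v. v *\<^sub>R w' t"])
      fix t :: real assume t: "t \<in> {0..1}"
      show "(w has_derivative (\<lambda>v. v *\<^sub>R w' t)) (at t within {0..1})"
        using der[OF t] by (simp add: has_vector_derivative_def)
      show "onorm (\<lambda>v. v *\<^sub>R w' t) \<le> 1 / 2 * norm (w T) + e / 2 * norm h"
      proof (rule onorm_le)
        fix v :: real
        have "norm (w' t) * norm v \<le> (1 / 2 * norm (w T) + e / 2 * norm h) * norm v"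
          using est[OF t] T(2)[OF t] by (intro mult_right_mono) auto
        then show "norm (v *\<^sub>R w' t) \<le> (1 / 2 * norm (w T) + e / 2 * norm h) * norm v"
          by (simp add: mult.commute)
      qed
    qed (use T in auto)
    also have "\<dots> \<le> (1 / 2 * norm (w T) + e / 2 * norm h) * 1"
      using T e by (intro mult_left_mono) auto
    also have "w 0 = 0" by (simp add: w_def z_def z'_def y0)
    finally have "norm (w T) \<le> e * norm h" by simp
    then have "norm (w 1) \<le> e * norm h" using T(2)[of 1] by simp
    then show "norm (y s' - y s - B (y s) (s' - s)) \<le> e * norm (s' - s)"
      by (simp add: w_def z_def z'_def h_def)
  qed
qed

text \<open>The hypothesis \<open>comm\<close> says that the fields \<open>B(x) v\<close> and
  \<open>B(x) w\<close> have zero bracket for all constant \<open>v\<close> and \<open>w\<close>.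
  The radius is the largest that meets both smallness conditions of the fixed point
  argument.\<close>

lemma commuting_frame_integral_chart:
  fixes B :: "'e::euclidean_space \<Rightarrow> 'd::euclidean_space \<Rightarrow>\<^sub>L 'e"
  assumes S: "open S" "x0 \<in> S" and B: "smooth_on S B"
    and comm: "\<And>x v w. x \<in> S \<Longrightarrow> bderiv B x (B x v) w = bderiv B x (B x w) v"
  obtains \<rho> y where "\<rho> > 0" "y 0 = x0" "smooth_on (ball 0 \<rho>) y" "\<And>s. y s \<in> S"
    "\<And>s. s \<in> ball 0 \<rho> \<Longrightarrow> (y has_derivative B (y s)) (at s)"
proof -
  obtain R where R: "R > 0" "cball x0 R \<subseteq> S" using S open_contains_cball by blast
  let ?K = "cball x0 R"
  have contB: "continuous_on ?K B" using smooth_on_imp_continuous_on[OF B] R continuous_on_subset by blast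
  then have "compact (B ` ?K)" by (intro compact_continuous_image) auto
  then obtain M where M: "M > 0" "\<And>x. x \<in> ?K \<Longrightarrow> norm (B x) \<le> M"
    using compact_imp_bounded bounded_pos by (metis imageI)
  obtain L where L: "L > 0" "\<And>x. x \<in> ?K \<Longrightarrow> norm (bderiv B x) \<le> L"
    using smooth_on_derivative_bound[OF S(1) B compact_cball R(2)] by blast
  have lipB: "norm (B x - B y) \<le> L * norm (x - y)" if "x \<in> ?K" "y \<in> ?K" for x y
  proof (rule differentiable_bound[OF convex_cball _ _ that(1,2)])
    fix z assume z: "z \<in> ?K"
    then have zS: "z \<in> S" using R by auto
    show "(B has_derivative bderiv B z) (at z within ?K)"
      using smooth_on_has_derivative[OF B zS] by (simp add: bderiv_apply[OF B zS] has_derivative_at_withinI)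
    show "onorm (bderiv B z) \<le> L" using L(2)[OF z] by (simp add: norm_blinfun.rep_eq)
  qed
  define \<rho> where "\<rho> = min (R / M) (1 / (2 * L))"
  have "\<rho> \<le> R / M" "\<rho> \<le> 1 / (2 * L)" by (auto simp: \<rho>_def)
  then have "\<rho> * M \<le> R" "\<rho> * L \<le> 1 / 2" using M(1) L(1) by (simp_all add: field_simps)
  moreover have "\<rho> > 0" using R M L by (simp add: \<rho>_def)
  ultimately have \<rho>: "\<rho> > 0" "\<rho> * M \<le> R" "\<rho> * L \<le> 1 / 2" by auto
  obtain y where y: "\<And>s. y s \<in> ?K" "\<And>s s'. norm (y s - y s') \<le> 2 * M * norm (s - s')"
    "\<And>s. s \<in> cball 0 \<rho> \<Longrightarrow> y s = x0 + integral {0..1} (\<lambda>t. B (y (t *\<^sub>R s)) s)"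
    using ray_integral_equation_solvable[OF R(1) M(2,1) lipB L(1) \<rho>] by blast
  have conty: "continuous_on UNIV y"
    by (rule lipschitz_on_continuous_on[OF lipschitz_onI[of _ _ "2 * M"]]) (use y M in \<open>auto simp: dist_norm\<close>)
  have y0: "y 0 = x0" using y(3)[of 0] \<rho> by (simp add: blinfun.bilinear_simps)
  have dy: "(y has_derivative B (y s)) (at s)" if "s \<in> ball 0 \<rho>" for s
    by (rule ray_solution_has_derivative[OF S(1) R(2) B comm L(2,1) \<rho>(1,3) y(1,2) _
          ray_integral_equation_vector_derivative[OF contB y(1) conty y(3)] y0 that])
       (use M in auto)
  \<comment> \<open>Bootstrapping: the derivative of \<open>y\<close> is \<open>B \<circ> y\<close>,
    which is as often differentiable as \<open>y\<close>.\<close>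
  have "Ck_on n (ball 0 \<rho>) y" for n
  proof (induction n)
    case 0
    then show ?case using conty continuous_on_subset by auto
  next
    case (Suc n)
    show ?case
    proof (rule Ck_on_SucI[OF open_ball dy])
      fix v
      have "Ck_on n (ball 0 \<rho>) (\<lambda>s. B (y s))"
        by (rule Ck_on_compose[OF open_ball S(1) _ Suc]) (use y(1) R B in \<open>auto simp: smooth_on_def\<close>)
      then show "Ck_on n (ball 0 \<rho>) (\<lambda>s. B (y s) v)"
        by (rule Ck_on_bounded_linear_comp[OF blinfun.bounded_linear_left open_ball])
    qed
  qed
  then have "smooth_on (ball 0 \<rho>) y" by (simp add: smooth_on_def)
  then show thesis by (rule that[of \<rho> y, OF \<rho>(1) y0 _ _ dy]) (use y(1) R(2) in blast)
qed

section \<open>Normalization of frames and the involutive case\<close>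

text \<open>Within distance 1/2 of the identity, \<open>norm v \<le> 2 * norm (A x v)\<close>. This
  gives injectivity, hence invertibility in finite dimension, together with the uniform bound 2 on
  the inverses that their smoothness requires.\<close>

lemma smooth_on_local_inverse:
  fixes A :: "'e::euclidean_space \<Rightarrow> 'd::euclidean_space \<Rightarrow>\<^sub>L 'd"
  assumes S: "open S" "x0 \<in> S" and A: "smooth_on S A" and id: "A x0 = id_blinfun"
  obtains S' and C :: "'e \<Rightarrow> 'd \<Rightarrow>\<^sub>L 'd" where "open S'" "x0 \<in> S'" "S' \<subseteq> S" "smooth_on S' C"
    "\<And>x v. x \<in> S' \<Longrightarrow> C x (A x v) = v" "\<And>x v. x \<in> S' \<Longrightarrow> A x (C x v) = v"
proof -
  define S' where "S' = {x \<in> S. norm (A x - id_blinfun) < 1 / 2}"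
  have "continuous_on S (\<lambda>x. norm (A x - id_blinfun))"
    by (intro continuous_intros smooth_on_imp_continuous_on[OF A])
  from continuous_open_preimage[OF this S(1) open_lessThan[of "1 / 2"]]
  have openS': "open S'" by (rule back_subst[where P = "open"]) (auto simp: S'_def)
  have "\<exists>D. (\<forall>v. blinfun_apply D (A x v) = v) \<and> (\<forall>v. A x (D v) = v) \<and> norm D \<le> 2" if x: "x \<in> S'" for x
  proof -
    have low: "norm v \<le> 2 * norm (A x v)" for v
    proof -
      have "v = A x v - (A x - id_blinfun) v" by (simp add: blinfun.bilinear_simps)
      then have "norm v \<le> norm (A x v) + norm ((A x - id_blinfun) v)" by (metis norm_triangle_ineq4)
      also have "norm ((A x - id_blinfun) v) \<le> 1 / 2 * norm v"
        using x by (intro order_trans[OF norm_blinfun] mult_right_mono) (auto simp: S'_def)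
      finally show ?thesis by simp
    qed
    have lin: "linear (blinfun_apply (A x))" using blinfun.bounded_linear_right bounded_linear.linear by blast
    have "inj (A x)"
      using low by (intro linear_injective_0[OF lin, THEN iffD2]) (metis mult_zero_right norm_le_zero_iff norm_zero)
    then obtain g where g: "linear g" "\<forall>v. g (A x v) = v" "\<forall>v. A x (g v) = v"
      using linear_injective_isomorphism[OF lin] by blast
    have bg: "blinfun_apply (Blinfun g) = g"
      by (simp add: bounded_linear_Blinfun_apply linear_conv_bounded_linear[THEN iffD1, OF g(1)])
    have "norm (Blinfun g) \<le> 2"
      by (rule norm_blinfun_bound) (use low[of "g _"] g bg in auto)
    then show ?thesis using g bg by metis
  qed
  then obtain C where C: "\<And>x v. x \<in> S' \<Longrightarrow> blinfun_apply (C x) (A x v) = v"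
    "\<And>x v. x \<in> S' \<Longrightarrow> A x (C x v) = v" "\<And>x. x \<in> S' \<Longrightarrow> norm (C x) \<le> 2" by metis
  have "smooth_on S' C"
    by (rule smooth_on_blinfun_inverse[OF openS' _ _ C(3) smooth_on_subset[OF A]])
       (auto intro!: blinfun_eqI simp: C S'_def)
  then show thesis
    using that[OF openS' _ _ _ C(1,2)] S id by (auto simp: S'_def)
qed

text \<open>A left inverse \<open>Q\<close> of \<open>G x0\<close> is held constant, so that only
  the square operator \<open>Q G(x)\<close>, near the identity, has to be inverted. Then
  \<open>C(x) Q\<close> is a left inverse of \<open>G x\<close> depending smoothly on
  \<open>x\<close>.\<close>

lemma smooth_on_local_left_inverse:
  fixes G :: "'c::euclidean_space \<Rightarrow> 'd::euclidean_space \<Rightarrow>\<^sub>L 'e::euclidean_space"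
  assumes S: "open S" "x0 \<in> S" and G: "smooth_on S G" and inj: "inj (G x0)"
  obtains S' and Q :: "'e \<Rightarrow>\<^sub>L 'd" and C :: "'c \<Rightarrow> 'd \<Rightarrow>\<^sub>L 'd" where "open S'" "x0 \<in> S'" "S' \<subseteq> S"
    "smooth_on S' C" "\<And>x v. x \<in> S' \<Longrightarrow> C x (Q (G x v)) = v" "\<And>x v. x \<in> S' \<Longrightarrow> Q (G x (C x v)) = v"
proof -
  have lin: "linear (G x0)" using blinfun.bounded_linear_right bounded_linear.linear by blast
  obtain q where q: "linear q" "q \<circ> G x0 = id" using linear_injective_left_inverse[OF lin inj] by blast
  define Q where "Q = Blinfun q"
  have Q: "blinfun_apply Q = q"
    by (simp add: Q_def bounded_linear_Blinfun_apply linear_conv_bounded_linear[THEN iffD1, OF q(1)])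
  define A where "A x = Q o\<^sub>L G x" for x
  have A: "smooth_on S A" unfolding A_def
    by (rule smooth_on_bounded_linear_comp[OF bounded_bilinear.bounded_linear_right[OF bounded_bilinear_blinfun_compose] S(1) G])
  have A0: "A x0 = id_blinfun"
    using q(2) by (auto intro!: blinfun_eqI simp: A_def Q o_def fun_eq_iff)
  obtain S' and C :: "'c \<Rightarrow> 'd \<Rightarrow>\<^sub>L 'd" where S': "open S'" "x0 \<in> S'" "S' \<subseteq> S" "smooth_on S' C"
    and C: "\<And>x v. x \<in> S' \<Longrightarrow> C x (A x v) = v" "\<And>x v. x \<in> S' \<Longrightarrow> A x (C x v) = v"
    by (rule smooth_on_local_inverse[OF S A A0]) blast
  show thesis by (rule that[OF S']) (use C in \<open>simp_all add: A_def\<close>)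
qed

text \<open>The frame \<open>B = G C\<close> spans the same spaces and satisfies
  \<open>Q B = id\<close>. Differentiating this constant shows that \<open>Q\<close> kills the
  brackets of the new frame. By involutivity these brackets also lie in the range of
  \<open>G x\<close>, where \<open>Q\<close> is injective; so they vanish. The normalization
  survives as \<open>Q (y s) = Q x0 + s\<close>, which later supplies a chart of the integral
  manifold.\<close>

lemma Frobenius_local:
  fixes G :: "'e::euclidean_space \<Rightarrow> 'd::euclidean_space \<Rightarrow>\<^sub>L 'e"
  assumes S: "open S" "x0 \<in> S" and G: "smooth_on S G" and inj: "inj (G x0)"
    and inv: "\<And>x v w. x \<in> S \<Longrightarrow> bderiv G x (G x v) w - bderiv G x (G x w) v \<in> range (G x)"
  obtains \<rho> and y :: "'d \<Rightarrow> 'e" and Q :: "'e \<Rightarrow> 'd" where "\<rho> > 0" "y 0 = x0" "smooth_on (ball 0 \<rho>) y" "\<And>s. y s \<in> S" "bounded_linear Q"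
    "\<And>s. s \<in> ball 0 \<rho> \<Longrightarrow> Q (y s) = Q x0 + s"
    "\<And>s. s \<in> ball 0 \<rho> \<Longrightarrow> range (\<D> y s) = range (G (y s))"
proof -
  obtain S' and Q :: "'e \<Rightarrow>\<^sub>L 'd" and C :: "'e \<Rightarrow> 'd \<Rightarrow>\<^sub>L 'd" where S': "open S'" "x0 \<in> S'" "S' \<subseteq> S"
    and C: "smooth_on S' C" "\<And>x v. x \<in> S' \<Longrightarrow> C x (Q (G x v)) = v" "\<And>x v. x \<in> S' \<Longrightarrow> Q (G x (C x v)) = v"
    by (rule smooth_on_local_left_inverse[OF S G inj]) blast
  define B where "B x = G x o\<^sub>L C x" for x
  have G': "smooth_on S' G" by (rule smooth_on_subset[OF G S'(3)])
  have B: "smooth_on S' B" unfolding B_def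
    by (rule smooth_on_bilinear[OF bounded_bilinear_blinfun_compose S'(1) G' C(1)])
  have QB: "Q (B x v) = v" if "x \<in> S'" for x v using C(3)[OF that] by (simp add: B_def)
  have comm: "bderiv B x (B x v) w = bderiv B x (B x w) v" if x: "x \<in> S'" for x v w
  proof -
    let ?d = "bderiv B x (B x v) w - bderiv B x (B x w) v"
    note dG = smooth_on_has_derivative[OF G' x, folded bderiv_apply[OF G' x]]
    note dC = smooth_on_has_derivative[OF C(1) x, folded bderiv_apply[OF C(1) x]]
    note dB = smooth_on_has_derivative[OF B x, folded bderiv_apply[OF B x]]
    have "(B has_derivative (\<lambda>h. (G x o\<^sub>L bderiv C x h) + (bderiv G x h o\<^sub>L C x))) (at x)"
      unfolding B_def by (rule bounded_bilinear.FDERIV[OF bounded_bilinear_blinfun_compose dG dC])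
    then have "bderiv B x h = (G x o\<^sub>L bderiv C x h) + (bderiv G x h o\<^sub>L C x)" for h
      using has_derivative_unique[OF dB] by metis
    \<comment> \<open>The terms in which \<open>C\<close> is differentiated lie in the range of
      \<open>G x\<close> anyway. The others are the involutivity expression for \<open>G\<close> at
      the vectors \<open>C x v\<close> and \<open>C x w\<close>.\<close>
    then have d: "?d = G x (bderiv C x (B x v) w - bderiv C x (B x w) v)
        + (bderiv G x (G x (C x v)) (C x w) - bderiv G x (G x (C x w)) (C x v))"
      by (simp add: blinfun.bilinear_simps B_def)
    obtain a where a: "bderiv G x (G x (C x v)) (C x w) - bderiv G x (G x (C x w)) (C x v) = G x a"
      using inv x S'(3) by blast
    obtain u where u: "?d = G x u" unfolding d a using blinfun.add_right by metis
    have "Q (bderiv B x h k) = 0" for h k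
    proof -
      have "((\<lambda>x. Q (B x k)) has_derivative (\<lambda>h. Q (bderiv B x h k))) (at x)"
        by (rule bounded_linear.has_derivative[OF blinfun.bounded_linear_right
              bounded_linear.has_derivative[OF blinfun.bounded_linear_left dB]])
      then have "((\<lambda>x. k) has_derivative (\<lambda>h. Q (bderiv B x h k))) (at x)"
        by (rule has_derivative_transform_within_open[OF _ S'(1) x]) (simp add: QB)
      then show ?thesis using has_derivative_unique[OF has_derivative_const] by metis
    qed
    then have "Q (G x u) = 0" by (simp add: blinfun.bilinear_simps flip: u)
    then have "u = 0" using C(2)[OF x, of u] by (simp add: blinfun.bilinear_simps)
    then show ?thesis using u by (simp add: blinfun.bilinear_simps)
  qed
  obtain \<rho> y where y: "\<rho> > 0" "y 0 = x0" "smooth_on (ball 0 \<rho>) y" "\<And>s. y s \<in> S'"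
    "\<And>s. s \<in> ball 0 \<rho> \<Longrightarrow> (y has_derivative B (y s)) (at s)"
    using commuting_frame_integral_chart[OF S'(1,2) B comm] by blast
  show thesis
  proof (rule that[OF y(1-3) _ blinfun.bounded_linear_right[of Q]])
    show "y s \<in> S" for s using y(4) S' by blast
    fix s :: 'd assume s: "s \<in> ball 0 \<rho>"
    have "\<exists>c. \<forall>s\<in>ball 0 \<rho>. Q (y s) - s = c"
    proof (rule has_derivative_zero_constant[OF convex_ball])
      fix s :: 'd assume "s \<in> ball 0 \<rho>"
      from bounded_linear.has_derivative[OF blinfun.bounded_linear_right[of Q] y(5)[OF this]]
      have "((\<lambda>s. Q (y s)) has_derivative (\<lambda>v. v)) (at s)" by (simp add: QB[OF y(4)])
      from has_derivative_diff[OF this has_derivative_ident]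
      show "((\<lambda>s. Q (y s) - s) has_derivative (\<lambda>h. 0)) (at s within ball 0 \<rho>)"
        by (simp add: has_derivative_at_withinI)
    qed
    then have "Q (y s) - s = Q (y 0) - 0" using s y(1) by (metis centre_in_ball)
    then show "Q (y s) = Q x0 + s" by (simp add: y(2) algebra_simps)
    have "\<D> y s = B (y s)" using frechet_derivative_at[OF y(5)[OF s]] by simp
    moreover have "range (B (y s)) = range (G (y s))"
    proof (intro equalityI subsetI)
      fix z assume "z \<in> range (G (y s))"
      then obtain v where "z = G (y s) v" by auto
      then have "z = B (y s) (Q (G (y s) v))" using C(2)[OF y(4)] by (simp add: B_def)
      then show "z \<in> range (B (y s))" by blast
    qed (auto simp: B_def)
    ultimately show "range (\<D> y s) = range (G (y s))" by simp
  qed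
qed

section \<open>Brackets along an immersion\<close>

text \<open>Injectivity at the single point \<open>u\<close> suffices: the left inverse there
  extends to a smooth one nearby, and it produces smooth lifts \<open>\<xi>\<close> and
  \<open>\<eta>\<close>. The bracket is then the image of the bracket of the lifts.\<close>

lemma bracket_tangent_to_immersion:
  fixes j :: "'d::euclidean_space \<Rightarrow> 'e::euclidean_space" and X Y :: "'e \<Rightarrow> 'e"
  assumes W: "open W" "u \<in> W" and j: "smooth_on W j" and S: "open S" "j ` W \<subseteq> S"
    and X: "smooth_on S X" and Y: "smooth_on S Y" and inj: "inj (\<D> j u)"
    and tan: "\<And>u. u \<in> W \<Longrightarrow> X (j u) \<in> range (\<D> j u)"
      "\<And>u. u \<in> W \<Longrightarrow> Y (j u) \<in> range (\<D> j u)"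
  shows "\<D> Y (j u) (X (j u)) - \<D> X (j u) (Y (j u))
    \<in> range (\<D> j u)"
proof -
  define J where "J = bderiv j"
  have J: "smooth_on W J" unfolding J_def by (rule smooth_on_bderiv[OF W(1) j])
  have Ja: "blinfun_apply (J u) = \<D> j u" if "u \<in> W" for u
    unfolding J_def by (rule bderiv_apply[OF j that])
  have injJ: "inj (J u)" using inj by (simp only: Ja[OF W(2)])
  obtain W' and Q :: "'e \<Rightarrow>\<^sub>L 'd" and C :: "'d \<Rightarrow> 'd \<Rightarrow>\<^sub>L 'd" where W': "open W'" "u \<in> W'" "W' \<subseteq> W"
    and C: "smooth_on W' C" "\<And>x v. x \<in> W' \<Longrightarrow> C x (Q (J x v)) = v"
    by (rule smooth_on_local_left_inverse[OF W J injJ]) blast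
  have j': "smooth_on W' j" and J': "smooth_on W' J" using smooth_on_subset[OF _ W'(3)] j J by auto
  have jW': "j ` W' \<subseteq> S" using S W' by auto
  have lift: "\<exists>\<xi>. smooth_on W' \<xi> \<and> (\<forall>x\<in>W'. J x (\<xi> x) = Z (j x))"
    if Z: "smooth_on S Z" "\<And>u. u \<in> W \<Longrightarrow> Z (j u) \<in> range (\<D> j u)" for Z
  proof (intro exI[of _ "\<lambda>x. C x (Q (Z (j x)))"] conjI ballI)
    show "smooth_on W' (\<lambda>x. C x (Q (Z (j x))))"
      by (intro smooth_on_bilinear[OF bounded_bilinear_blinfun_apply] W'(1) C(1)
          smooth_on_bounded_linear_comp[OF blinfun.bounded_linear_right] smooth_on_compose[OF W'(1) S(1) jW' j' Z(1)])
    fix x assume x: "x \<in> W'"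
    then have "x \<in> W" using W'(3) by blast
    then have "Z (j x) \<in> range (J x)" using Z(2) Ja by simp
    then obtain a where "Z (j x) = J x a" by blast
    then show "J x (C x (Q (Z (j x)))) = Z (j x)" using C(2)[OF x, of a] by simp
  qed
  \<comment> \<open>Differentiating \<open>Z \<circ> j = J \<xi>\<close> in two ways. The term
    \<open>bderiv J u b (\<xi> u)\<close> is a second derivative of \<open>j\<close>; it is the one
    that cancels by symmetry when the roles of the two fields are exchanged.\<close>
  have der: "\<D> Z (j u) (J u b) = bderiv J u b (\<xi> u) + J u (\<D> \<xi> u b)"
    if Z: "smooth_on S Z" and \<xi>: "smooth_on W' \<xi>" "\<forall>x\<in>W'. J x (\<xi> x) = Z (j x)" for Z \<xi> b
  proof -
    have ju: "j u \<in> S" using jW' W' by auto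
    have 1: "((\<lambda>x. Z (j x)) has_derivative (\<lambda>b. \<D> Z (j u) (J u b))) (at u)"
      using diff_chain_at[OF smooth_on_has_derivative[OF j' W'(2)] smooth_on_has_derivative[OF Z ju]]
      by (simp add: o_def Ja[OF W(2)])
    have "((\<lambda>x. J x (\<xi> x)) has_derivative (\<lambda>b. J u (\<D> \<xi> u b) + bderiv J u b (\<xi> u))) (at u)"
      by (rule bounded_bilinear.FDERIV[OF bounded_bilinear_blinfun_apply
            smooth_on_has_derivative[OF J W(2), folded bderiv_apply[OF J W(2)]] smooth_on_has_derivative[OF \<xi>(1) W'(2)]])
    then have "((\<lambda>x. Z (j x)) has_derivative (\<lambda>b. J u (\<D> \<xi> u b) + bderiv J u b (\<xi> u))) (at u)"
      by (rule has_derivative_transform_within_open[OF _ W'(1,2)]) (use \<xi>(2) in auto)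
    from has_derivative_unique[OF 1 this] show ?thesis by (metis add.commute)
  qed
  have sym: "bderiv J u b c = bderiv J u c b" for b c
  proof -
    have "bderiv J u b c = \<D> (\<lambda>x. \<D> j x c) u b" for b c
    proof -
      have "((\<lambda>x. J x c) has_derivative (\<lambda>b. bderiv J u b c)) (at u)"
        by (rule bounded_linear.has_derivative[OF blinfun.bounded_linear_left
              smooth_on_has_derivative[OF J W(2), folded bderiv_apply[OF J W(2)]]])
      then have "((\<lambda>x. \<D> j x c) has_derivative (\<lambda>b. bderiv J u b c)) (at u)"
        by (rule has_derivative_transform_within_open[OF _ W]) (simp add: Ja)
      then show ?thesis by (rule fun_cong[OF frechet_derivative_at])
    qed
    then show ?thesis using second_derivative_symmetric[OF W(1) j W(2)] by simp
  qed
  obtain \<xi> where \<xi>: "smooth_on W' \<xi>" "\<forall>x\<in>W'. J x (\<xi> x) = X (j x)" using lift[OF X tan(1)] by blast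
  obtain \<eta> where \<eta>: "smooth_on W' \<eta>" "\<forall>x\<in>W'. J x (\<eta> x) = Y (j x)" using lift[OF Y tan(2)] by blast
  have "\<D> Y (j u) (X (j u)) - \<D> X (j u) (Y (j u))
      = J u (\<D> \<eta> u (\<xi> u) - \<D> \<xi> u (\<eta> u))"
    using der[OF Y \<eta>, of "\<xi> u"] der[OF X \<xi>, of "\<eta> u"] \<xi>(2) \<eta>(2) W'(2) sym[of "\<xi> u" "\<eta> u"]
    by (simp add: blinfun.diff_right)
  then show ?thesis using Ja[OF W(2)] by (metis rangeI)
qed

section \<open>Charts and tangent spaces\<close>

locale chart =
  fixes M :: "('a, 'e::euclidean_space) manifold" and U :: "'a set" and \<phi> :: "'a \<Rightarrow> 'e"
  assumes M: "smooth_manifold M" and chart: "(U, \<phi>) \<in> atlas M"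
begin

abbreviation \<psi> where "\<psi> \<equiv> inv_into U \<phi>"

lemma openin_U: "openin (mtop M) U" and open_image: "open (\<phi> ` U)"
  and homeo: "homeomorphic_map (subtopology (mtop M) U) (top_of_set (\<phi> ` U)) \<phi>"
  using M chart unfolding smooth_manifold_def by fast+

lemma U_subset: "U \<subseteq> points M" by (rule openin_subset[OF openin_U])

lemma topspace_U: "topspace (subtopology (mtop M) U) = U"
  using U_subset by (auto simp: topspace_subtopology)

lemma inj_chart: "inj_on \<phi> U"
  using homeomorphic_imp_injective_map[OF homeo] unfolding topspace_U .

lemma inv_chart [simp]: "q \<in> U \<Longrightarrow> \<psi> (\<phi> q) = q"
  by (rule inv_into_f_f[OF inj_chart])

lemma chart_inv [simp]: "x \<in> \<phi> ` U \<Longrightarrow> \<phi> (\<psi> x) = x"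
  by (rule f_inv_into_f)

lemma inv_in [simp]: "x \<in> \<phi> ` U \<Longrightarrow> \<psi> x \<in> U"
  by (rule inv_into_into)

lemma open_chart_image:
  assumes "openin (mtop M) W" shows "open (\<phi> ` (U \<inter> W))"
proof -
  have "openin (subtopology (mtop M) U) (U \<inter> W)"
    using assms by (metis Int_commute openin_subtopology_Int)
  then have "openin (top_of_set (\<phi> ` U)) (\<phi> ` (U \<inter> W))"
    using homeomorphic_imp_open_map[OF homeo] by (simp add: open_map_def)
  then show ?thesis using open_image by (simp add: openin_open_eq)
qed

lemma continuous_chart: "continuous_map (subtopology (mtop M) U) euclidean \<phi>"
  using homeomorphic_imp_continuous_map[OF homeo] by (simp add: continuous_map_in_subtopology)

lemma openin_chart_vimage:
  assumes "open T" shows "openin (mtop M) {q \<in> U. \<phi> q \<in> T}"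
proof -
  have "openin (subtopology (mtop M) U) {q \<in> topspace (subtopology (mtop M) U). \<phi> q \<in> T}"
    by (rule openin_continuous_map_preimage[OF continuous_chart]) (simp add: assms)
  then show ?thesis unfolding topspace_U by (rule openin_trans_full[OF _ openin_U])
qed

lemma continuous_inv: "continuous_map (top_of_set (\<phi> ` U)) (mtop M) \<psi>"
  unfolding continuous_map_def
proof (intro conjI allI impI)
  show "\<psi> \<in> topspace (top_of_set (\<phi> ` U)) \<rightarrow> topspace (mtop M)" using U_subset by auto
  fix W assume "openin (mtop M) W"
  moreover have "{x \<in> topspace (top_of_set (\<phi> ` U)). \<psi> x \<in> W} = \<phi> ` (U \<inter> W)" by auto
  ultimately show "openin (top_of_set (\<phi> ` U)) {x \<in> topspace (top_of_set (\<phi> ` U)). \<psi> x \<in> W}"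
    using open_chart_image open_image by (auto simp: openin_open_eq)
qed

lemma smooth_fun_chart: "f \<in> smooth_funs M \<Longrightarrow> smooth_on (\<phi> ` U) (\<lambda>x. f (\<psi> x))"
  using chart unfolding smooth_funs_def by (auto simp: o_def)

end

section \<open>Smooth functions: locality and cutoffs\<close>

lemma chart_at:
  assumes "smooth_manifold M" "p \<in> points M"
  obtains U \<phi> where "chart M U \<phi>" "p \<in> U"
  using assms unfolding smooth_manifold_def chart_def by blast

text \<open>Smoothness is defined by testing every chart of the atlas. One suitable chart around
  each point is enough, since the transition maps carry smoothness to the others.\<close>

lemma smooth_funs_local:
  assumes M: "smooth_manifold M"
    and loc: "\<And>q. q \<in> points M \<Longrightarrow> \<exists>U \<phi> T. (U, \<phi>) \<in> atlas M \<and> q \<in> U \<and> open T \<and> \<phi> q \<in> T \<and>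
      T \<subseteq> \<phi> ` U \<and> smooth_on T (\<lambda>x. f (inv_into U \<phi> x))"
  shows "f \<in> smooth_funs M"
  unfolding smooth_funs_def mem_Collect_eq
proof (intro ballI, clarify)
  fix V \<eta> assume V: "(V, \<eta>) \<in> atlas M"
  interpret V: chart M V \<eta> using M V by unfold_locales
  show "smooth_on (\<eta> ` V) (f \<circ> V.\<psi>)"
  proof (rule smooth_on_local)
    fix x assume x: "x \<in> \<eta> ` V"
    define q where "q = V.\<psi> x"
    have q: "q \<in> V" "\<eta> q = x" using x by (simp_all add: q_def)
    obtain U \<phi> T where U: "(U, \<phi>) \<in> atlas M" "q \<in> U" "open T" "\<phi> q \<in> T" "T \<subseteq> \<phi> ` U"
      and sm: "smooth_on T (\<lambda>x. f (inv_into U \<phi> x))" using loc q V.U_subset by blast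
    interpret U: chart M U \<phi> using M U by unfold_locales
    let ?W = "{q \<in> U. \<phi> q \<in> T}"
    have W: "openin (mtop M) ?W" by (rule U.openin_chart_vimage[OF U(3)])
    have op: "open (\<eta> ` (V \<inter> ?W))" by (rule V.open_chart_image[OF W])
    have "smooth_on (\<eta> ` (V \<inter> U)) (\<phi> \<circ> V.\<psi>)"
      using M V U(1) unfolding smooth_manifold_def by fast
    then have "smooth_on (\<eta> ` (V \<inter> ?W)) (\<lambda>y. \<phi> (V.\<psi> y))"
      unfolding o_def by (rule smooth_on_subset) auto
    then have "smooth_on (\<eta> ` (V \<inter> ?W)) (\<lambda>y. f (U.\<psi> (\<phi> (V.\<psi> y))))"
      by (intro smooth_on_compose[OF op U(3) _ _ sm]) auto
    then have "smooth_on (\<eta> ` (V \<inter> ?W)) (f \<circ> V.\<psi>)"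
      by (rule smooth_on_cong[OF op]) auto
    then show "\<exists>T. open T \<and> x \<in> T \<and> smooth_on T (f \<circ> V.\<psi>)"
      using op q U by (intro exI[of _ "\<eta> ` (V \<inter> ?W)"]) auto
  qed
qed

lemma smooth_funsI:
  assumes "smooth_manifold M" "\<And>U \<phi>. chart M U \<phi> \<Longrightarrow> smooth_on (\<phi> ` U) (\<lambda>x. f (inv_into U \<phi> x))"
  shows "f \<in> smooth_funs M"
  using assms by (auto simp: smooth_funs_def o_def chart_def)

lemma smooth_funs_cong:
  assumes "smooth_manifold M" "f \<in> smooth_funs M" "\<And>q. q \<in> points M \<Longrightarrow> f q = g q"
  shows "g \<in> smooth_funs M"
proof (rule smooth_funsI[OF assms(1)])
  fix V \<eta> assume "chart M V \<eta>"
  then interpret V: chart M V \<eta> .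
  show "smooth_on (\<eta> ` V) (\<lambda>x. g (V.\<psi> x))"
    by (rule smooth_on_cong[OF V.open_image V.smooth_fun_chart[OF assms(2)]])
       (use assms(3) V.U_subset in auto)
qed

lemma smooth_funs_const: "(\<lambda>_. c) \<in> smooth_funs M"
  by (auto simp: smooth_funs_def o_def smooth_on_const)

lemma smooth_funs_add:
  assumes "smooth_manifold M" "f \<in> smooth_funs M" "g \<in> smooth_funs M"
  shows "f + g \<in> smooth_funs M"
  by (rule smooth_funsI[OF assms(1)])
     (simp add: smooth_on_add chart.open_image chart.smooth_fun_chart assms)

lemma smooth_funs_mult:
  assumes "smooth_manifold M" "f \<in> smooth_funs M" "g \<in> smooth_funs M"
  shows "f * g \<in> smooth_funs M"
  by (rule smooth_funsI[OF assms(1)])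
     (simp add: smooth_on_mult chart.open_image chart.smooth_fun_chart assms)

lemma scale_eq_mult: "c \<odot> f = (\<lambda>_. c) * f"
  by (simp add: scale_def fun_eq_iff)

lemma smooth_funs_scale:
  "smooth_manifold M \<Longrightarrow> f \<in> smooth_funs M \<Longrightarrow> c \<odot> f \<in> smooth_funs M"
  unfolding scale_eq_mult by (intro smooth_funs_mult smooth_funs_const)

lemma smooth_funs_sum:
  assumes "smooth_manifold M" "\<And>i. i \<in> I \<Longrightarrow> f i \<in> smooth_funs M"
  shows "(\<Sum>i\<in>I. f i) \<in> smooth_funs M"
  using assms(2)
proof (induction I rule: infinite_finite_induct)
  case (insert i I)
  show ?case unfolding sum.insert[OF insert(1,2)]
    by (rule smooth_funs_add[OF assms(1)]) (use insert in auto)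
qed (auto simp: zero_fun_def smooth_funs_const)

text \<open>Extension by zero is smooth at points outside the chart because the compact ball
  carrying the bump is closed in the Hausdorff space \<open>M\<close>, so its complement is an open
  set on which the extension vanishes. The bump does not depend on \<open>g\<close>.\<close>

lemma (in chart) cutoff:
  assumes T: "open T" "T \<subseteq> \<phi> ` U" "\<phi> p \<in> T"
  obtains b Z where "open Z" "\<phi> p \<in> Z" "Z \<subseteq> T" "\<And>x. x \<in> Z \<Longrightarrow> b x = (1::real)"
    "\<And>x. x \<notin> T \<Longrightarrow> b x = 0"
    "\<And>g. smooth_on T g \<Longrightarrow> (\<lambda>q. if q \<in> U then b (\<phi> q) * g (\<phi> q) else 0) \<in> smooth_funs M"
proof -
  obtain r where r: "r > 0" "cball (\<phi> p) r \<subseteq> T" using T open_contains_cball by blast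
  obtain b :: "'e \<Rightarrow> real" where b: "smooth_on UNIV b" "\<And>x. x \<in> ball (\<phi> p) (r / 2) \<Longrightarrow> b x = 1"
    "\<And>x. x \<notin> ball (\<phi> p) r \<Longrightarrow> b x = 0"
    by (rule smooth_bump[of "r / 2" r "\<phi> p"]) (use r in auto)
  have sub: "ball (\<phi> p) (r / 2) \<subseteq> cball (\<phi> p) r" "ball (\<phi> p) r \<subseteq> cball (\<phi> p) r" using r by auto
  show thesis
  proof (rule that[of "ball (\<phi> p) (r / 2)" b])
    show "ball (\<phi> p) (r / 2) \<subseteq> T" using sub r by blast
    show "b x = 0" if "x \<notin> T" for x using that b(3) r(2) sub by blast
    fix g :: "'e \<Rightarrow> real" assume g: "smooth_on T g"
    let ?f = "\<lambda>q. if q \<in> U then b (\<phi> q) * g (\<phi> q) else 0"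
    let ?C = "\<psi> ` cball (\<phi> p) r"
    have "compactin (top_of_set (\<phi> ` U)) (cball (\<phi> p) r)"
      using r T by (simp add: compactin_subtopology)
    then have "compactin (mtop M) ?C" by (rule image_compactin[OF _ continuous_inv])
    then have C: "closedin (mtop M) ?C"
      using M by (intro compactin_imp_closedin) (auto simp: smooth_manifold_def)
    show "?f \<in> smooth_funs M"
    proof (rule smooth_funs_local[OF M])
      fix q assume q: "q \<in> points M"
      show "\<exists>U' \<phi>' T. (U', \<phi>') \<in> atlas M \<and> q \<in> U' \<and> open T \<and> \<phi>' q \<in> T \<and>
          T \<subseteq> \<phi>' ` U' \<and> smooth_on T (\<lambda>x. ?f (inv_into U' \<phi>' x))"
      proof (cases "q \<in> U \<and> \<phi> q \<in> T")
        case True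
        have "smooth_on T (\<lambda>x. b x * g x)"
          by (rule smooth_on_mult[OF T(1) smooth_on_subset[OF b(1)] g]) simp
        then have "smooth_on T (\<lambda>x. ?f (\<psi> x))"
          by (rule smooth_on_cong[OF T(1)]) (use T in auto)
        then show ?thesis using True T chart by blast
      next
        case False
        have qC: "q \<notin> ?C"
        proof
          assume "q \<in> ?C"
          then obtain x where "x \<in> T" "q = \<psi> x" using r(2) by blast
          then show False using False T(2) by (auto simp: subset_iff)
        qed
        obtain V \<eta> where V: "chart M V \<eta>" "q \<in> V" using chart_at[OF M q] by blast
        interpret V: chart M V \<eta> by fact
        let ?W = "topspace (mtop M) - ?C"
        have op: "open (\<eta> ` (V \<inter> ?W))" using C by (intro V.open_chart_image) blast
        have "?f (V.\<psi> x) = 0" if x: "x \<in> \<eta> ` (V \<inter> ?W)" for x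
        proof -
          obtain y where y: "x = \<eta> y" "y \<in> V" "y \<notin> ?C" using x by blast
          have "\<phi> y \<notin> ball (\<phi> p) r" if "y \<in> U"
          proof
            assume "\<phi> y \<in> ball (\<phi> p) r"
            then have "\<psi> (\<phi> y) \<in> ?C" using sub by blast
            then show False using that y by simp
          qed
          then show ?thesis using y b(3) by auto
        qed
        then have "smooth_on (\<eta> ` (V \<inter> ?W)) (\<lambda>x. ?f (V.\<psi> x))"
          by (intro smooth_on_cong[OF op smooth_on_const[of _ 0]]) auto
        moreover have "\<eta> q \<in> \<eta> ` (V \<inter> ?W)" using V(2) q qC by blast
        moreover have "\<eta> ` (V \<inter> ?W) \<subseteq> \<eta> ` V" by blast
        ultimately show ?thesis using op V.chart V(2) by blast
      qed
    qed
  qed (use b r in auto)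
qed

section \<open>Derivations as directional derivatives\<close>

lemma tangent_space_add:
  "v \<in> tangent_space M p \<Longrightarrow> f \<in> smooth_funs M \<Longrightarrow> g \<in> smooth_funs M \<Longrightarrow> v (f + g) = v f + v g"
  by (simp add: tangent_space_def)

lemma tangent_space_scale:
  "v \<in> tangent_space M p \<Longrightarrow> f \<in> smooth_funs M \<Longrightarrow> v (c \<odot> f) = c * v f"
  by (simp add: tangent_space_def)

lemma tangent_space_mult:
  "v \<in> tangent_space M p \<Longrightarrow> f \<in> smooth_funs M \<Longrightarrow> g \<in> smooth_funs M \<Longrightarrow> v (f * g) = f p * v g + g p * v f"
  by (simp add: tangent_space_def)

lemma tangent_space_not_smooth:
  "v \<in> tangent_space M p \<Longrightarrow> f \<notin> smooth_funs M \<Longrightarrow> v f = 0"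
  by (simp add: tangent_space_def)

lemma tangent_space_const:
  assumes "v \<in> tangent_space M p" shows "v (\<lambda>_. c) = 0"
proof -
  have "v ((\<lambda>_. 1) * (\<lambda>_. 1)) = v (\<lambda>_. 1) + v (\<lambda>_. 1)"
    using tangent_space_mult[OF assms smooth_funs_const smooth_funs_const] by simp
  moreover have "(\<lambda>_. 1) * (\<lambda>_. 1) = (\<lambda>_::'a. 1::real)" by (simp add: fun_eq_iff)
  ultimately have "v (\<lambda>_. 1) = 0" by simp
  then show ?thesis using tangent_space_scale[OF assms smooth_funs_const, of c 1]
    by (simp add: scale_def)
qed

lemma sum_fun_eval: "(\<Sum>i\<in>I. f i) x = (\<Sum>i\<in>I. f i x)"
  by (induction I rule: infinite_finite_induct) auto

lemma tangent_space_sum: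
  assumes "smooth_manifold M" "v \<in> tangent_space M p" "\<And>i. i \<in> I \<Longrightarrow> f i \<in> smooth_funs M"
  shows "v (\<Sum>i\<in>I. f i) = (\<Sum>i\<in>I. v (f i))"
  using assms(3)
proof (induction I rule: infinite_finite_induct)
  case (insert i I)
  have "f i \<in> smooth_funs M" "(\<Sum>i\<in>I. f i) \<in> smooth_funs M"
    using insert smooth_funs_sum[OF assms(1), of I f] by auto
  then show ?case
    unfolding sum.insert[OF insert(1,2)] by (subst tangent_space_add[OF assms(2)]) (use insert in auto)
qed (use tangent_space_const[OF assms(2), of 0] in \<open>auto simp: zero_fun_def\<close>)

text \<open>For a cutoff \<open>k\<close> with \<open>k p = 1\<close> supported in \<open>W\<close>,
  the product of \<open>k\<close> with \<open>f - g\<close> is zero everywhere; the Leibniz rule at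
  \<open>p\<close>, where \<open>f - g\<close> vanishes, leaves
  \<open>v (f - g) = 0\<close>.\<close>

lemma tangent_space_local:
  assumes M: "smooth_manifold M" and v: "v \<in> tangent_space M p" and fg: "f \<in> smooth_funs M" "g \<in> smooth_funs M"
    and W: "openin (mtop M) W" "p \<in> W" "\<And>q. q \<in> W \<Longrightarrow> f q = g q"
  shows "v f = v g"
proof -
  have "p \<in> points M" using W openin_subset by blast
  then obtain U \<phi> where U: "chart M U \<phi>" "p \<in> U" using chart_at[OF M] by blast
  interpret chart M U \<phi> by fact
  have T: "open (\<phi> ` (U \<inter> W))" "\<phi> ` (U \<inter> W) \<subseteq> \<phi> ` U" "\<phi> p \<in> \<phi> ` (U \<inter> W)"
    using open_chart_image[OF W(1)] U W by auto
  obtain b Z where b: "\<phi> p \<in> Z" "\<And>x. x \<in> Z \<Longrightarrow> b x = (1::real)" "\<And>x. x \<notin> \<phi> ` (U \<inter> W) \<Longrightarrow> b x = 0"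
    "\<And>g. smooth_on (\<phi> ` (U \<inter> W)) g \<Longrightarrow> (\<lambda>q. if q \<in> U then b (\<phi> q) * g (\<phi> q) else 0) \<in> smooth_funs M"
    by (rule cutoff[OF T]) blast
  define k where "k q = (if q \<in> U then b (\<phi> q) * 1 else 0)" for q
  have k: "k \<in> smooth_funs M" unfolding k_def by (rule b(4)[OF smooth_on_const])
  let ?h = "f + (-1) \<odot> g"
  have h: "?h \<in> smooth_funs M" by (intro smooth_funs_add smooth_funs_scale M fg)
  have "k * ?h = (\<lambda>_. 0)"
  proof
    fix q
    show "(k * ?h) q = 0"
    proof (cases "q \<in> U \<and> \<phi> q \<in> \<phi> ` (U \<inter> W)")
      case True
      then have "q \<in> W" using inj_chart by (auto dest: inj_onD)
      then show ?thesis using W(3) by (simp add: scale_def)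
    next
      case False
      then have "k q = 0" using b(3) by (auto simp: k_def)
      then show ?thesis by simp
    qed
  qed
  then have "0 = v (k * ?h)" using tangent_space_const[OF v] by simp
  also have "\<dots> = k p * v ?h + ?h p * v k" by (rule tangent_space_mult[OF v k h])
  also have "k p = 1" using U b by (simp add: k_def)
  also have "?h p = 0" using W by (simp add: scale_def)
  also have "v ?h = v f - v g"
    using tangent_space_add[OF v fg(1) smooth_funs_scale[OF M fg(2)]] tangent_space_scale[OF v fg(2)] by simp
  finally show ?thesis by simp
qed

text \<open>The tangent vector at \<open>p\<close> whose components with respect to the coordinate
  fields of the chart are those of \<open>b\<close>.\<close>

definition chart_vec :: "('a, 'e::euclidean_space) manifold \<Rightarrow> 'a set \<Rightarrow> ('a \<Rightarrow> 'e) \<Rightarrow> 'a \<Rightarrow> 'e \<Rightarrow> 'a tvec" where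
  "chart_vec M U \<phi> p b = (\<lambda>f. if f \<in> smooth_funs M
     then \<D> (\<lambda>x. f (inv_into U \<phi> x)) (\<phi> p) b else 0)"

context chart
begin

abbreviation tv where "tv \<equiv> chart_vec M U \<phi>"

lemma smooth_fun_has_derivative:
  "f \<in> smooth_funs M \<Longrightarrow> p \<in> U \<Longrightarrow>
    ((\<lambda>x. f (\<psi> x)) has_derivative \<D> (\<lambda>x. f (\<psi> x)) (\<phi> p)) (at (\<phi> p))"
  by (rule smooth_on_has_derivative[OF smooth_fun_chart]) auto

lemma chart_vec_eqI:
  "f \<in> smooth_funs M \<Longrightarrow> ((\<lambda>x. f (\<psi> x)) has_derivative D) (at (\<phi> p)) \<Longrightarrow> tv p b f = D b"
  unfolding chart_vec_def using frechet_derivative_at by fastforce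

lemma chart_vec_linear:
  assumes "p \<in> U"
  shows "tv p (b + c) = tv p b + tv p c"
    and "tv p (r *\<^sub>R b) = r \<odot> tv p b"
  using has_derivative_linear[OF smooth_fun_has_derivative[OF _ assms]]
  by (auto simp: chart_vec_def fun_eq_iff scale_def linear_add linear_scale)

lemma chart_vec_in:
  assumes p: "p \<in> U"
  shows "tv p b \<in> tangent_space M p"
  unfolding tangent_space_def mem_Collect_eq
proof (intro conjI ballI allI impI)
  fix f g assume fg: "f \<in> smooth_funs M" "g \<in> smooth_funs M"
  note d = smooth_fun_has_derivative[OF fg(1) p] smooth_fun_has_derivative[OF fg(2) p]
  have v: "tv p b f = \<D> (\<lambda>x. f (\<psi> x)) (\<phi> p) b"
    "tv p b g = \<D> (\<lambda>x. g (\<psi> x)) (\<phi> p) b"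
    using fg by (simp_all add: chart_vec_def)
  show "tv p b (f + g) = tv p b f + tv p b g"
    unfolding v by (rule chart_vec_eqI[OF smooth_funs_add[OF M fg]]) (simp add: has_derivative_add[OF d])
  show "tv p b (f * g) = f p * tv p b g + g p * tv p b f"
    unfolding v
    by (subst chart_vec_eqI[OF smooth_funs_mult[OF M fg], where p = p and b = b])
       (use has_derivative_mult[OF d] p in \<open>simp_all add: mult.commute\<close>)
next
  fix f c assume f: "f \<in> smooth_funs M"
  show "tv p b (c \<odot> f) = c * tv p b f"
    using chart_vec_eqI[OF smooth_funs_scale[OF M f], where p = p and b = b]
      has_derivative_mult_right[OF smooth_fun_has_derivative[OF f p], of c] f
    by (simp add: scale_def chart_vec_def)
qed (simp add: chart_vec_def)

text \<open>Global smooth functions that agree with the centred coordinates on a whole neighbourhood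
  \<open>Z\<close>, so that they read off components of tangent vectors at all nearby points and not
  just at \<open>p\<close>.\<close>

lemma coordinate_functions:
  assumes "p \<in> U"
  obtains c Z where "\<And>i. c i \<in> smooth_funs M" "open Z" "\<phi> p \<in> Z" "Z \<subseteq> \<phi> ` U"
    "\<And>i x. x \<in> Z \<Longrightarrow> c i (\<psi> x) = (x - \<phi> p) \<bullet> i"
proof -
  have T: "open (\<phi> ` U)" "\<phi> ` U \<subseteq> \<phi> ` U" "\<phi> p \<in> \<phi> ` U" using open_image assms by auto
  obtain b Z where b: "open Z" "\<phi> p \<in> Z" "Z \<subseteq> \<phi> ` U" "\<And>x. x \<in> Z \<Longrightarrow> b x = (1::real)"
    "\<And>g. smooth_on (\<phi> ` U) g \<Longrightarrow> (\<lambda>q. if q \<in> U then b (\<phi> q) * g (\<phi> q) else 0) \<in> smooth_funs M"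
    by (rule cutoff[OF T]) blast
  show thesis
  proof (rule that[OF _ b(1-3)])
    show "(\<lambda>q. if q \<in> U then b (\<phi> q) * ((\<phi> q - \<phi> p) \<bullet> i) else 0) \<in> smooth_funs M" for i
      by (intro b(5) smooth_on_bounded_linear_comp[OF bounded_linear_inner_left] open_image smooth_on_diff
          smooth_on_const smooth_on_bounded_linear bounded_linear_ident)
    show "(if \<psi> x \<in> U then b (\<phi> (\<psi> x)) * ((\<phi> (\<psi> x) - \<phi> p) \<bullet> i) else 0) = (x - \<phi> p) \<bullet> i" if "x \<in> Z" for i x
      using that b(3,4) by (simp add: subset_iff)
  qed
qed

lemma chart_vec_coordinate:
  assumes "\<And>i. c i \<in> smooth_funs M" "open Z" "\<And>i x. x \<in> Z \<Longrightarrow> c i (\<psi> x) = (x - a) \<bullet> i"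
    and "\<phi> q \<in> Z"
  shows "tv q b (c i) = b \<bullet> i"
proof (rule chart_vec_eqI[OF assms(1)])
  have "((\<lambda>x. (x - a) \<bullet> i) has_derivative (\<lambda>b. b \<bullet> i)) (at (\<phi> q))"
    by (auto intro!: derivative_eq_intros)
  then show "((\<lambda>x. c i (\<psi> x)) has_derivative (\<lambda>b. b \<bullet> i)) (at (\<phi> q))"
    by (rule has_derivative_transform_within_open[OF _ assms(2,4)]) (simp add: assms(3))
qed

lemma chart_vec_inj:
  assumes "p \<in> U" "tv p b = tv p b'" shows "b = b'"
proof -
  obtain c Z where c: "\<And>i. c i \<in> smooth_funs M" "open Z" "\<phi> p \<in> Z" "Z \<subseteq> \<phi> ` U"
    "\<And>i x. x \<in> Z \<Longrightarrow> c i (\<psi> x) = (x - \<phi> p) \<bullet> i"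
    by (rule coordinate_functions[OF assms(1)]) blast
  show ?thesis
  proof (rule euclidean_eqI)
    fix i
    have "tv p b (c i) = b \<bullet> i" for b by (rule chart_vec_coordinate[OF c(1,2,5,3)])
    then show "b \<bullet> i = b' \<bullet> i" using assms(2) by metis
  qed
qed

text \<open>By Hadamard's lemma, \<open>f\<close> is locally a constant plus a sum of products of coordinate functions,
  which vanish at \<open>p\<close>, with smooth functions; hence a derivation at \<open>p\<close> is determined by its values
  on the coordinate functions.\<close>

lemma tangent_space_chart:
  assumes p: "p \<in> U" and v: "v \<in> tangent_space M p"
  shows "\<exists>b. v = tv p b"
proof -
  obtain c Z where c: "\<And>i. c i \<in> smooth_funs M" "open Z" "\<phi> p \<in> Z" "Z \<subseteq> \<phi> ` U"
    "\<And>i x. x \<in> Z \<Longrightarrow> c i (\<psi> x) = (x - \<phi> p) \<bullet> i"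
    by (rule coordinate_functions[OF p]) blast
  have cp: "c i p = 0" for i using c(5)[OF c(3), of i] p by simp
  define b where "b = (\<Sum>i\<in>Basis. v (c i) *\<^sub>R i)"
  have "v f = tv p b f" if f: "f \<in> smooth_funs M" for f
  proof -
    obtain r where r: "r > 0" "ball (\<phi> p) r \<subseteq> Z" using c(2,3) open_contains_ball by blast
    let ?B = "ball (\<phi> p) r"
    have B: "open ?B" "?B \<subseteq> \<phi> ` U" "\<phi> p \<in> ?B" using r c(4) by auto
    obtain h where h: "\<And>i. smooth_on ?B (h i)"
      "\<And>x. x \<in> ?B \<Longrightarrow> f (\<psi> x) = f (\<psi> (\<phi> p)) + (\<Sum>i\<in>Basis. ((x - \<phi> p) \<bullet> i) *\<^sub>R h i x)"
      by (rule Hadamard[OF smooth_on_subset[OF smooth_fun_chart[OF f] B(2)]]) blast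
    obtain \<beta> Z' where \<beta>: "open Z'" "\<phi> p \<in> Z'" "Z' \<subseteq> ?B" "\<And>x. x \<in> Z' \<Longrightarrow> \<beta> x = (1::real)"
      "\<And>g. smooth_on ?B g \<Longrightarrow> (\<lambda>q. if q \<in> U then \<beta> (\<phi> q) * g (\<phi> q) else 0) \<in> smooth_funs M"
      by (rule cutoff[OF B]) blast
    define H where "H i q = (if q \<in> U then \<beta> (\<phi> q) * h i (\<phi> q) else 0)" for i q
    have H: "H i \<in> smooth_funs M" for i unfolding H_def by (rule \<beta>(5)[OF h(1)])
    let ?g = "(\<lambda>_. f p) + (\<Sum>i\<in>Basis. c i * H i)"
    have s: "(\<Sum>i\<in>Basis. c i * H i) \<in> smooth_funs M" by (intro smooth_funs_sum smooth_funs_mult M c(1) H)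
    have "v f = v ?g"
    proof (rule tangent_space_local[OF M v f _ openin_chart_vimage[OF \<beta>(1)]])
      show "?g \<in> smooth_funs M" by (intro smooth_funs_add smooth_funs_const M s)
      show "p \<in> {q \<in> U. \<phi> q \<in> Z'}" using p \<beta> by simp
      fix q assume q: "q \<in> {q \<in> U. \<phi> q \<in> Z'}"
      then have "\<phi> q \<in> ?B" "\<phi> q \<in> Z" using \<beta>(3) r(2) by auto
      then have "c i q = (\<phi> q - \<phi> p) \<bullet> i" "H i q = h i (\<phi> q)" for i
        using c(5)[of "\<phi> q" i] q \<beta>(4) by (auto simp: H_def)
      then show "f q = ?g q" using h(2)[OF \<open>\<phi> q \<in> ?B\<close>] p q by (simp add: sum_fun_eval)
    qed
    also have "\<dots> = v (\<lambda>_. f p) + (\<Sum>i\<in>Basis. v (c i * H i))"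
      using tangent_space_add[OF v smooth_funs_const s] tangent_space_sum[OF M v, of Basis "\<lambda>i. c i * H i"]
        smooth_funs_mult[OF M c(1) H] by simp
    also have "\<dots> = (\<Sum>i\<in>Basis. h i (\<phi> p) * v (c i))"
      using tangent_space_const[OF v] tangent_space_mult[OF v c(1) H] p \<beta>(2,4) by (simp add: cp H_def)
    also have "\<dots> = tv p b f"
    proof -
      have "((\<lambda>x. f (\<psi> (\<phi> p)) + (\<Sum>i\<in>Basis. ((x - \<phi> p) \<bullet> i) *\<^sub>R h i x)) has_derivative
          (\<lambda>b. \<Sum>i\<in>Basis. (b \<bullet> i) * h i (\<phi> p))) (at (\<phi> p))"
        by (auto intro!: derivative_eq_intros smooth_on_has_derivative[OF h(1) B(3)])
      then have "((\<lambda>x. f (\<psi> x)) has_derivative (\<lambda>b. \<Sum>i\<in>Basis. (b \<bullet> i) * h i (\<phi> p))) (at (\<phi> p))"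
        by (rule has_derivative_transform_within_open[OF _ B(1,3)]) (simp add: h(2))
      from chart_vec_eqI[OF f this, of b] show ?thesis
        by (simp add: b_def inner_sum_left inner_Basis if_distrib sum.delta mult.commute cong: if_cong)
    qed
    finally show ?thesis .
  qed
  then have "v = tv p b"
    using tangent_space_not_smooth[OF v] by (auto simp: fun_eq_iff chart_vec_def)
  then show ?thesis by blast
qed

lemma tangent_space_eq: "p \<in> U \<Longrightarrow> tangent_space M p = range (tv p)"
  by (auto dest: tangent_space_chart intro: chart_vec_in)

end

section \<open>Vector fields in charts\<close>

definition chart_coord :: "('a, 'e::euclidean_space) manifold \<Rightarrow> 'a set \<Rightarrow> ('a \<Rightarrow> 'e) \<Rightarrow> 'a \<Rightarrow> 'a tvec \<Rightarrow> 'e" where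
  "chart_coord M U \<phi> p v = (THE b. chart_vec M U \<phi> p b = v)"

definition field_rep :: "('a, 'e::euclidean_space) manifold \<Rightarrow> 'a set \<Rightarrow> ('a \<Rightarrow> 'e) \<Rightarrow> ('a \<Rightarrow> 'a tvec) \<Rightarrow> 'e \<Rightarrow> 'e" where
  "field_rep M U \<phi> X x = chart_coord M U \<phi> (inv_into U \<phi> x) (X (inv_into U \<phi> x))"

text \<open>The real counterpart of \<open>bracket\<close>, to which the brackets of all fields in
  the conditions reduce.\<close>

definition lie :: "('a, 'e::euclidean_space) manifold \<Rightarrow> ('a \<Rightarrow> 'a tvec) \<Rightarrow> ('a \<Rightarrow> 'a tvec) \<Rightarrow> 'a \<Rightarrow> 'a tvec" where
  "lie M X Y = (\<lambda>p f. if f \<in> smooth_funs M then X p (\<lambda>q. Y q f) - Y p (\<lambda>q. X q f) else 0)"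

lemma vector_fields_tangent: "X \<in> vector_fields M \<Longrightarrow> p \<in> points M \<Longrightarrow> X p \<in> tangent_space M p"
  and vector_fields_smooth: "X \<in> vector_fields M \<Longrightarrow> f \<in> smooth_funs M \<Longrightarrow> (\<lambda>p. X p f) \<in> smooth_funs M"
  by (auto simp: vector_fields_def)

lemma tangent_space_cong:
  assumes "smooth_manifold M" "p \<in> points M" "v \<in> tangent_space M p" "f \<in> smooth_funs M"
    "\<And>q. q \<in> points M \<Longrightarrow> f q = g q"
  shows "v f = v g"
  by (rule tangent_space_local[OF assms(1,3,4) smooth_funs_cong[OF assms(1,4,5)] openin_topspace assms(2,5)])

context chart
begin

abbreviation rep where "rep \<equiv> field_rep M U \<phi>"

lemma chart_coord_vec: "p \<in> U \<Longrightarrow> chart_coord M U \<phi> p (tv p b) = b"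
  unfolding chart_coord_def by (rule the_equality) (auto dest: chart_vec_inj)

lemma chart_vec_coord: "p \<in> U \<Longrightarrow> v \<in> tangent_space M p \<Longrightarrow> tv p (chart_coord M U \<phi> p v) = v"
  using tangent_space_chart chart_coord_vec by metis

lemma chart_vec_field_rep:
  assumes "X \<in> vector_fields M" "q \<in> U"
  shows "tv q (rep X (\<phi> q)) = X q"
  using assms U_subset vector_fields_tangent[OF assms(1)]
  by (auto simp: field_rep_def chart_vec_coord)

lemma field_rep_eqI:
  "q \<in> U \<Longrightarrow> X q = tv q b \<Longrightarrow> rep X (\<phi> q) = b"
  by (simp add: field_rep_def chart_coord_vec)

text \<open>Near a point the components of \<open>rep X\<close> are the functions obtained by
  applying \<open>X\<close> to the cut-off coordinates, and these are smooth by definition of a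
  vector field.\<close>

lemma smooth_on_field_rep:
  assumes X: "X \<in> vector_fields M"
  shows "smooth_on (\<phi> ` U) (rep X)"
proof (rule smooth_on_local)
  fix x assume "x \<in> \<phi> ` U"
  then obtain p where p: "p \<in> U" "x = \<phi> p" by auto
  obtain c Z where c: "\<And>i. c i \<in> smooth_funs M" "open Z" "\<phi> p \<in> Z" "Z \<subseteq> \<phi> ` U"
    "\<And>i x. x \<in> Z \<Longrightarrow> c i (\<psi> x) = (x - \<phi> p) \<bullet> i"
    by (rule coordinate_functions[OF p(1)]) blast
  have "smooth_on Z (rep X)"
  proof (rule smooth_on_componentwise[OF c(2)])
    fix i :: 'e
    have "smooth_on Z (\<lambda>x. X (\<psi> x) (c i))"
      by (rule smooth_on_subset[OF smooth_fun_chart[OF vector_fields_smooth[OF X c(1)]] c(4)])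
    then show "smooth_on Z (\<lambda>x. rep X x \<bullet> i)"
    proof (rule smooth_on_cong[OF c(2)])
      fix y assume y: "y \<in> Z"
      then have yU: "y \<in> \<phi> ` U" using c(4) by auto
      have "X (\<psi> y) (c i) = tv (\<psi> y) (rep X (\<phi> (\<psi> y))) (c i)"
        using chart_vec_field_rep[OF X, of "\<psi> y"] yU by simp
      also have "\<dots> = rep X (\<phi> (\<psi> y)) \<bullet> i"
        by (rule chart_vec_coordinate[OF c(1,2,5)]) (assumption, subst chart_inv[OF yU], rule y)
      finally show "X (\<psi> y) (c i) = rep X y \<bullet> i" using yU by simp
    qed
  qed
  then show "\<exists>T. open T \<and> x \<in> T \<and> smooth_on T (rep X)" using c p by blast
qed

lemma vector_field_through:
  assumes p: "p \<in> U"
  obtains X where "X \<in> vector_fields M" "X p = tv p b"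
proof -
  have T: "open (\<phi> ` U)" "\<phi> ` U \<subseteq> \<phi> ` U" "\<phi> p \<in> \<phi> ` U" using open_image p by auto
  obtain \<beta> Z where \<beta>: "\<phi> p \<in> Z" "\<And>x. x \<in> Z \<Longrightarrow> \<beta> x = (1::real)"
    "\<And>g. smooth_on (\<phi> ` U) g \<Longrightarrow> (\<lambda>q. if q \<in> U then \<beta> (\<phi> q) * g (\<phi> q) else 0) \<in> smooth_funs M"
    by (rule cutoff[OF T]) blast
  \<comment> \<open>The functional \<open>tv p 0\<close> is zero, hence a derivation at every point;
    so it is a legitimate value also at \<open>q\<close> outside the chart.\<close>
  define X where "X q = (if q \<in> U then tv q (\<beta> (\<phi> q) *\<^sub>R b) else tv p 0 )" for q
  have zero: "tv p 0 f = 0" for f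
    using chart_vec_linear(2)[OF p, of 0 b] by (simp add: scale_def)
  have tan: "X q \<in> tangent_space M q" if "q \<in> points M" for q
  proof (cases "q \<in> U")
    case True
    then show ?thesis by (simp add: X_def chart_vec_in)
  next
    case False
    then show ?thesis by (simp add: X_def zero tangent_space_def)
  qed
  have "(\<lambda>q. X q f) \<in> smooth_funs M" if f: "f \<in> smooth_funs M" for f
  proof -
    have "smooth_on (\<phi> ` U) (\<lambda>x. \<D> (\<lambda>x. f (\<psi> x)) x b)"
      by (rule smooth_on_derivative[OF smooth_fun_chart[OF f]])
    note \<beta>(3)[OF this]
    moreover have "X q f = (if q \<in> U then \<beta> (\<phi> q) * \<D> (\<lambda>x. f (\<psi> x)) (\<phi> q) b else 0)" for q
    proof (cases "q \<in> U")
      case True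
      then have "X q f = (\<beta> (\<phi> q) \<odot> tv q b) f" by (simp only: X_def chart_vec_linear(2) if_True)
      then show ?thesis using True f by (simp add: scale_def chart_vec_def)
    qed (simp add: X_def zero)
    ultimately show ?thesis by simp
  qed
  then have "X \<in> vector_fields M" using tan by (simp add: vector_fields_def)
  moreover have "X p = tv p b" using p \<beta> by (simp add: X_def)
  ultimately show thesis by (rule that)
qed

end

section \<open>The Lie bracket of real vector fields\<close>

text \<open>The mixed products of first derivatives in the Leibniz rule are symmetric in the two
  fields and cancel. The rules for \<open>Z' q\<close> are available only for \<open>q\<close> in
  \<open>points M\<close>, so each is passed to \<open>Z p\<close> by
  \<open>tangent_space_cong\<close>.\<close>

lemma lie_in_tangent_space:
  assumes M: "smooth_manifold M" and X: "X \<in> vector_fields M" and Y: "Y \<in> vector_fields M" and p: "p \<in> points M"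
  shows "lie M X Y p \<in> tangent_space M p"
proof -
  have der: "Z p (\<lambda>q. Z' q (f + g)) = Z p (\<lambda>q. Z' q f) + Z p (\<lambda>q. Z' q g)"
    "Z p (\<lambda>q. Z' q (c \<odot> f)) = c * Z p (\<lambda>q. Z' q f)"
    "Z p (\<lambda>q. Z' q (f * g)) = f p * Z p (\<lambda>q. Z' q g) + Z' p g * Z p f + (g p * Z p (\<lambda>q. Z' q f) + Z' p f * Z p g)"
    if Z: "Z \<in> vector_fields M" "Z' \<in> vector_fields M" and fg: "f \<in> smooth_funs M" "g \<in> smooth_funs M" for Z Z' f g c
  proof -
    note t = vector_fields_tangent[OF Z(1) p] and t' = vector_fields_tangent[OF Z(2)]
    note s = vector_fields_smooth[OF Z(2) fg(1)] vector_fields_smooth[OF Z(2) fg(2)]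
    have "Z p ((\<lambda>q. Z' q f) + (\<lambda>q. Z' q g)) = Z p (\<lambda>q. Z' q (f + g))"
      by (rule tangent_space_cong[OF M p t smooth_funs_add[OF M s]]) (simp add: tangent_space_add[OF t' fg])
    then show "Z p (\<lambda>q. Z' q (f + g)) = Z p (\<lambda>q. Z' q f) + Z p (\<lambda>q. Z' q g)"
      by (simp only: tangent_space_add[OF t s])
    have "Z p (c \<odot> (\<lambda>q. Z' q f)) = Z p (\<lambda>q. Z' q (c \<odot> f))"
      by (rule tangent_space_cong[OF M p t smooth_funs_scale[OF M s(1)]])
         (simp add: scale_def[of c "\<lambda>q. Z' q f"] tangent_space_scale[OF t' fg(1)])
    then show "Z p (\<lambda>q. Z' q (c \<odot> f)) = c * Z p (\<lambda>q. Z' q f)"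
      by (simp only: tangent_space_scale[OF t s(1)])
    have m: "f * (\<lambda>q. Z' q g) \<in> smooth_funs M" "g * (\<lambda>q. Z' q f) \<in> smooth_funs M"
      by (intro smooth_funs_mult M fg s)+
    have "Z p (f * (\<lambda>q. Z' q g) + g * (\<lambda>q. Z' q f)) = Z p (\<lambda>q. Z' q (f * g))"
      by (rule tangent_space_cong[OF M p t smooth_funs_add[OF M m]]) (simp add: tangent_space_mult[OF t' fg])
    then show "Z p (\<lambda>q. Z' q (f * g)) = f p * Z p (\<lambda>q. Z' q g) + Z' p g * Z p f + (g p * Z p (\<lambda>q. Z' q f) + Z' p f * Z p g)"
      by (simp only: tangent_space_add[OF t m] tangent_space_mult[OF t fg(1) s(2)] tangent_space_mult[OF t fg(2) s(1)])
  qed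
  show ?thesis
    unfolding tangent_space_def mem_Collect_eq
  proof (intro conjI ballI allI impI)
    fix f g assume fg: "f \<in> smooth_funs M" "g \<in> smooth_funs M"
    note d = der(1,3)[OF X Y fg] der(1,3)[OF Y X fg]
    show "lie M X Y p (f + g) = lie M X Y p f + lie M X Y p g"
      using fg smooth_funs_add[OF M fg] d by (simp add: lie_def)
    show "lie M X Y p (f * g) = f p * lie M X Y p g + g p * lie M X Y p f"
      using fg smooth_funs_mult[OF M fg] d by (simp add: lie_def algebra_simps)
  next
    fix f c assume f: "f \<in> smooth_funs M"
    show "lie M X Y p (c \<odot> f) = c * lie M X Y p f"
      using f smooth_funs_scale[OF M f] der(2)[OF X Y f f] der(2)[OF Y X f f] by (simp add: lie_def algebra_simps)
  qed (simp add: lie_def)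
qed

lemma lie_cong:
  assumes M: "smooth_manifold M" and X: "X \<in> vector_fields M" and Y: "Y \<in> vector_fields M" and p: "p \<in> points M"
    and "\<And>q. q \<in> points M \<Longrightarrow> X q = X' q" "\<And>q. q \<in> points M \<Longrightarrow> Y q = Y' q"
  shows "lie M X Y p = lie M X' Y' p"
proof
  fix f
  have "X p (\<lambda>q. Y q f) = X p (\<lambda>q. Y' q f)" "Y p (\<lambda>q. X q f) = Y p (\<lambda>q. X' q f)" if "f \<in> smooth_funs M"
    using tangent_space_cong[OF M p vector_fields_tangent[OF X p] vector_fields_smooth[OF Y that]]
      tangent_space_cong[OF M p vector_fields_tangent[OF Y p] vector_fields_smooth[OF X that]] assms(5,6) by auto
  then show "lie M X Y p f = lie M X' Y' p f" using assms(5,6) p by (simp add: lie_def)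
qed

context chart
begin

lemma field_apply_component:
  assumes X: "X \<in> vector_fields M" and Y: "Y \<in> vector_fields M" and p: "p \<in> U"
    and c: "c \<in> smooth_funs M" "open Z" "\<phi> p \<in> Z" "Z \<subseteq> \<phi> ` U" "\<And>x. x \<in> Z \<Longrightarrow> c (\<psi> x) = (x - \<phi> p) \<bullet> i"
  shows "X p (\<lambda>q. Y q c) = \<D> (rep Y) (\<phi> p) (rep X (\<phi> p)) \<bullet> i"
proof -
  have "X p (\<lambda>q. Y q c) = tv p (rep X (\<phi> p)) (\<lambda>q. Y q c)"
    using chart_vec_field_rep[OF X p] by simp
  also have "\<dots> = \<D> (rep Y) (\<phi> p) (rep X (\<phi> p)) \<bullet> i"
  proof (rule chart_vec_eqI[OF vector_fields_smooth[OF Y c(1)]])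
    have "((\<lambda>x. rep Y x \<bullet> i) has_derivative (\<lambda>b. \<D> (rep Y) (\<phi> p) b \<bullet> i)) (at (\<phi> p))"
      using p by (intro bounded_linear.has_derivative[OF bounded_linear_inner_left]
          smooth_on_has_derivative[OF smooth_on_field_rep[OF Y]]) auto
    then show "((\<lambda>x. Y (\<psi> x) c) has_derivative (\<lambda>b. \<D> (rep Y) (\<phi> p) b \<bullet> i)) (at (\<phi> p))"
    proof (rule has_derivative_transform_within_open[OF _ c(2,3)])
      fix y assume y: "y \<in> Z"
      then have yU: "y \<in> \<phi> ` U" using c(4) by auto
      have "((\<lambda>x. (x - \<phi> p) \<bullet> i) has_derivative (\<lambda>b. b \<bullet> i)) (at (\<phi> (\<psi> y)))"
        by (auto intro!: derivative_eq_intros)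
      then have "((\<lambda>x. c (\<psi> x)) has_derivative (\<lambda>b. b \<bullet> i)) (at (\<phi> (\<psi> y)))"
        by (rule has_derivative_transform_within_open[OF _ c(2)]) (use y yU c(5) in simp_all)
      from chart_vec_eqI[OF c(1) this, of "rep Y (\<phi> (\<psi> y))"]
      show "rep Y y \<bullet> i = Y (\<psi> y) c"
        using chart_vec_field_rep[OF Y, of "\<psi> y"] yU by simp
    qed
  qed
  finally show ?thesis .
qed

text \<open>Since the bracket is already known to be a tangent vector, its components can be read
  off on coordinate functions, and no second derivatives of a general function ever appear.\<close>

lemma lie_chart:
  assumes X: "X \<in> vector_fields M" and Y: "Y \<in> vector_fields M" and p: "p \<in> U"
  shows "lie M X Y p = tv p
    (\<D> (rep Y) (\<phi> p) (rep X (\<phi> p))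
     - \<D> (rep X) (\<phi> p) (rep Y (\<phi> p)))" (is "_ = tv p ?d")
proof -
  have "p \<in> points M" using p U_subset by auto
  then obtain b where b: "lie M X Y p = tv p b"
    using tangent_space_chart[OF p lie_in_tangent_space[OF M X Y]] by blast
  obtain c Z where c: "\<And>i. c i \<in> smooth_funs M" "open Z" "\<phi> p \<in> Z" "Z \<subseteq> \<phi> ` U"
    "\<And>i x. x \<in> Z \<Longrightarrow> c i (\<psi> x) = (x - \<phi> p) \<bullet> i"
    by (rule coordinate_functions[OF p]) blast
  have eq: "b \<bullet> i = ?d \<bullet> i" for i
  proof -
    have "b \<bullet> i = lie M X Y p (c i)"
      unfolding b by (rule chart_vec_coordinate[OF c(1,2,5,3), symmetric])
    also have "\<dots> = ?d \<bullet> i"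
      using field_apply_component[OF X Y p c(1-5)] field_apply_component[OF Y X p c(1-5)] c(1)
      by (simp add: lie_def inner_diff_left)
    finally show ?thesis .
  qed
  have "b = ?d" by (rule euclidean_eqI) (rule eq)
  then show ?thesis using b by simp
qed

end

section \<open>Integral manifolds\<close>

locale immersion_charts = N: chart N V \<eta> + M: chart M U \<phi>
  for N :: "('a, 'd::euclidean_space) manifold" and V \<eta> and M :: "('a, 'e::euclidean_space) manifold" and U \<phi> +
  assumes incl: "points N \<subseteq> points M" and smooth: "smooth_map N M (\<lambda>x. x)"
begin

definition j where "j x = \<phi> (N.\<psi> x)"

lemma open_dom: "open (\<eta> ` (V \<inter> U))"
proof -
  have "openin (mtop N) {x \<in> topspace (mtop N). x \<in> U}"
    by (rule openin_continuous_map_preimage[OF _ M.openin_U]) (use smooth in \<open>simp add: smooth_map_def\<close>)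
  moreover have "V \<inter> {x \<in> topspace (mtop N). x \<in> U} = V \<inter> U" using N.U_subset by auto
  ultimately show ?thesis using N.open_chart_image by metis
qed

lemma smooth_on_j: "smooth_on (\<eta> ` (V \<inter> U)) j"
proof -
  have "smooth_on (\<eta> ` (V \<inter> (\<lambda>x. x) -` U)) (\<phi> \<circ> (\<lambda>x. x) \<circ> N.\<psi>)"
    using smooth N.chart M.chart unfolding smooth_map_def by fast
  then show ?thesis by (simp add: j_def[abs_def] o_def)
qed

lemma pullback_chart:
  assumes "f \<in> smooth_funs M"
  shows "smooth_on (\<eta> ` (V \<inter> U)) (\<lambda>x. f (N.\<psi> x))"
proof -
  have "smooth_on (\<eta> ` (V \<inter> U)) (\<lambda>x. f (M.\<psi> (j x)))"
    by (rule smooth_on_compose[OF open_dom M.open_image _ smooth_on_j M.smooth_fun_chart[OF assms]]) (auto simp: j_def)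
  then show ?thesis by (rule smooth_on_cong[OF open_dom]) (auto simp: j_def)
qed

end

text \<open>The differential of the inclusion evaluates a tangent vector of \<open>N\<close> on the
  same function \<open>f\<close>, and such a vector is set to zero on functions not smooth on
  \<open>N\<close>. The convention is harmless because of this lemma.\<close>

lemma smooth_funs_pullback:
  assumes M: "smooth_manifold M" and N: "smooth_manifold N" and incl: "points N \<subseteq> points M"
    and smooth: "smooth_map N M (\<lambda>x. x)" and f: "f \<in> smooth_funs M"
  shows "f \<in> smooth_funs N"
proof (rule smooth_funs_local[OF N])
  fix q assume q: "q \<in> points N"
  obtain V \<eta> where V: "chart N V \<eta>" "q \<in> V" using chart_at[OF N q] by blast
  obtain U \<phi> where U: "chart M U \<phi>" "q \<in> U" using chart_at[OF M] q incl by blast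
  interpret immersion_charts N V \<eta> M U \<phi> using U(1) V(1) incl smooth by (simp add: immersion_charts_def immersion_charts_axioms_def)
  have "\<eta> q \<in> \<eta> ` (V \<inter> U)" "\<eta> ` (V \<inter> U) \<subseteq> \<eta> ` V" using U V by auto
  then show "\<exists>U \<phi> T. (U, \<phi>) \<in> atlas N \<and> q \<in> U \<and> open T \<and> \<phi> q \<in> T \<and> T \<subseteq> \<phi> ` U \<and> smooth_on T (\<lambda>x. f (inv_into U \<phi> x))"
    using N.chart V(2) open_dom pullback_chart[OF f] by blast
qed

lemma (in immersion_charts) differential_chart_vec:
  assumes q: "q \<in> V" "q \<in> U"
  shows "differential N M (\<lambda>x. x) (chart_vec N V \<eta> q a) = chart_vec M U \<phi> q (\<D> j (\<eta> q) a)"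
proof
  fix f
  show "differential N M (\<lambda>x. x) (chart_vec N V \<eta> q a) f = chart_vec M U \<phi> q (\<D> j (\<eta> q) a) f"
  proof (cases "f \<in> smooth_funs M")
    case True
    then have fN: "f \<in> smooth_funs N" by (rule smooth_funs_pullback[OF M.M N.M incl smooth])
    have x: "\<eta> q \<in> \<eta> ` (V \<inter> U)" using q by auto
    have jq: "j (\<eta> q) = \<phi> q" using q by (simp add: j_def)
    have "((\<lambda>x. f (M.\<psi> (j x))) has_derivative
        (\<lambda>a. \<D> (\<lambda>x. f (M.\<psi> x)) (\<phi> q) (\<D> j (\<eta> q) a))) (at (\<eta> q))"
      using diff_chain_at[OF smooth_on_has_derivative[OF smooth_on_j x]
          M.smooth_fun_has_derivative[OF True q(2), folded jq]]
      by (simp add: o_def jq)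
    then have "((\<lambda>x. f (N.\<psi> x)) has_derivative
        (\<lambda>a. \<D> (\<lambda>x. f (M.\<psi> x)) (\<phi> q) (\<D> j (\<eta> q) a))) (at (\<eta> q))"
      by (rule has_derivative_transform_within_open[OF _ open_dom x]) (auto simp: j_def)
    from N.chart_vec_eqI[OF fN this, of a] show ?thesis
      using True fN by (simp add: differential_def o_def chart_vec_def)
  qed (simp add: differential_def chart_vec_def)
qed

text \<open>In charts, \<open>D\<close> along \<open>N\<close> is the range of the derivative of the
  local inclusion \<open>j\<close>, and this derivative is injective because \<open>N\<close> is
  immersed; this is the situation of \<open>bracket_tangent_to_immersion\<close>.\<close>

lemma lie_tangent_to_integral_manifold:
  fixes N :: "('a, 'd::euclidean_space) manifold" and M :: "('a, 'e::euclidean_space) manifold"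
  assumes M: "smooth_manifold M" and N: "immersed_submanifold M N" and p: "p \<in> points N"
    and tan: "\<And>q. q \<in> points N \<Longrightarrow> differential N M (\<lambda>x. x) ` tangent_space N q = D q"
    and X: "X \<in> vector_fields M" "\<And>q. q \<in> points N \<Longrightarrow> X q \<in> D q"
    and Y: "Y \<in> vector_fields M" "\<And>q. q \<in> points N \<Longrightarrow> Y q \<in> D q"
  shows "lie M X Y p \<in> D p"
proof -
  have N': "smooth_manifold N" "points N \<subseteq> points M" "smooth_map N M (\<lambda>x. x)"
    and inj: "\<And>q. q \<in> points N \<Longrightarrow> inj_on (differential N M (\<lambda>x. x)) (tangent_space N q)"
    using N by (auto simp: immersed_submanifold_def)
  obtain V \<eta> where V: "chart N V \<eta>" "p \<in> V" using chart_at[OF N'(1) p] by blast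
  obtain U \<phi> where U: "chart M U \<phi>" "p \<in> U" using chart_at[OF M] p N'(2) by blast
  interpret immersion_charts N V \<eta> M U \<phi> using U(1) V(1) N' by (simp add: immersion_charts_def immersion_charts_axioms_def)
  let ?Dj = "\<lambda>u. \<D> j u"
  have VN: "V \<subseteq> points N" by (rule N.U_subset)
  have Dq: "D q = chart_vec M U \<phi> q ` range (?Dj (\<eta> q))" if "q \<in> V" "q \<in> U" for q
    using tan[of q] that VN unfolding N.tangent_space_eq[OF that(1)]
    by (auto simp: image_image differential_chart_vec[OF that])
  have rep: "field_rep M U \<phi> Z (j u) \<in> range (?Dj u)"
    if Z: "\<And>q. q \<in> points N \<Longrightarrow> Z q \<in> D q" and u: "u \<in> \<eta> ` (V \<inter> U)" for Z u
  proof -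
    obtain q where q: "q \<in> V" "q \<in> U" "u = \<eta> q" using u by auto
    obtain a where a: "Z q = chart_vec M U \<phi> q (?Dj u a)" using Z[of q] VN q Dq by auto
    have "field_rep M U \<phi> Z (\<phi> q) = ?Dj u a" by (rule M.field_rep_eqI[of q Z, OF q(2) a])
    moreover have "j u = \<phi> q" using q by (simp add: j_def)
    ultimately show ?thesis by simp
  qed
  have pW: "\<eta> p \<in> \<eta> ` (V \<inter> U)" using U V by auto
  have jp: "j (\<eta> p) = \<phi> p" using V by (simp add: j_def)
  have "inj (?Dj (\<eta> p))"
  proof (rule injI)
    fix a b assume "?Dj (\<eta> p) a = ?Dj (\<eta> p) b"
    then have "differential N M (\<lambda>x. x) (chart_vec N V \<eta> p a) = differential N M (\<lambda>x. x) (chart_vec N V \<eta> p b)"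
      using differential_chart_vec[OF V(2) U(2)] by simp
    then have "chart_vec N V \<eta> p a = chart_vec N V \<eta> p b"
      using inj_onD[OF inj[OF p]] N.chart_vec_in[OF V(2)] by blast
    then show "a = b" by (rule N.chart_vec_inj[OF V(2)])
  qed
  moreover have "j ` (\<eta> ` (V \<inter> U)) \<subseteq> \<phi> ` U" by (auto simp: j_def)
  ultimately have "\<D> (field_rep M U \<phi> Y) (j (\<eta> p)) (field_rep M U \<phi> X (j (\<eta> p))) -
      \<D> (field_rep M U \<phi> X) (j (\<eta> p)) (field_rep M U \<phi> Y (j (\<eta> p))) \<in> range (?Dj (\<eta> p))"
    by (intro bracket_tangent_to_immersion[OF open_dom pW smooth_on_j M.open_image _ M.smooth_on_field_rep[OF X(1)]
      M.smooth_on_field_rep[OF Y(1)] _ rep[OF X(2)] rep[OF Y(2)]])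
  then have "\<D> (field_rep M U \<phi> Y) (\<phi> p) (field_rep M U \<phi> X (\<phi> p)) -
      \<D> (field_rep M U \<phi> X) (\<phi> p) (field_rep M U \<phi> Y (\<phi> p)) \<in> range (?Dj (\<eta> p))"
    by (simp only: jp)
  then show ?thesis using Dq[OF V(2) U(2)] M.lie_chart[OF X(1) Y(1) U(2)] by auto
qed

section \<open>Construction of the integral manifold\<close>

text \<open>The set is a graph over the ball, and the affine map \<open>Q - a\<close> inverts
  \<open>y\<close> continuously. Hence the subspace topology is the right one, and an atlas with a
  single chart suffices.\<close>

lemma (in chart) graph_submanifold:
  fixes y :: "'d::euclidean_space \<Rightarrow> 'e" and Q :: "'e \<Rightarrow> 'd"
  assumes y: "smooth_on (ball 0 \<rho>) y" "\<And>s. s \<in> ball 0 \<rho> \<Longrightarrow> y s \<in> \<phi> ` U"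
    and Q: "bounded_linear Q" "\<And>s. s \<in> ball 0 \<rho> \<Longrightarrow> Q (y s) = a + s"
  defines "S \<equiv> (\<lambda>s. \<psi> (y s)) ` ball 0 \<rho>"
  defines "N \<equiv> Manifold (subtopology (mtop M) S) {(S, \<lambda>q. Q (\<phi> q) - a)}"
  shows "points N = S" and "immersed_submanifold M N"
    and "\<And>s. s \<in> ball 0 \<rho> \<Longrightarrow> differential N M (\<lambda>x. x) ` tangent_space N (\<psi> (y s)) =
      tv (\<psi> (y s)) ` range (\<D> y s)"
proof -
  let ?B = "ball (0::'d) \<rho>"
  define \<eta> where "\<eta> q = Q (\<phi> q) - a" for q
  have N: "mtop N = subtopology (mtop M) S" "atlas N = {(S, \<eta>)}" by (simp_all add: N_def \<eta>_def[abs_def])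
  have SU: "S \<subseteq> U" using y(2) by (auto simp: S_def)
  have SM: "S \<subseteq> points M" using SU U_subset by blast
  show pts: "points N = S" using SM by (auto simp: N(1))
  have eta: "\<eta> (\<psi> (y s)) = s" if "s \<in> ?B" for s
    using y(2)[OF that] Q(2)[OF that] by (simp add: \<eta>_def)
  have mem: "\<psi> (y s) \<in> S" if "s \<in> ?B" for s using that by (simp add: S_def)
  have im: "\<eta> ` S = ?B" using eta by (auto simp: S_def image_image)
  have inj: "inj_on \<eta> S" using eta by (auto simp: S_def inj_on_def)
  have inv: "inv_into S \<eta> s = \<psi> (y s)" if "s \<in> ?B" for s
    by (rule inv_into_f_eq[OF inj _ eta[OF that]]) (use that in \<open>simp add: S_def\<close>)
  have "homeomorphic_maps (subtopology (mtop N) S) (top_of_set (\<eta> ` S)) \<eta> (\<lambda>s. \<psi> (y s))"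
    unfolding homeomorphic_maps_def
  proof (intro conjI ballI)
    have c1: "continuous_map (subtopology (mtop M) S) euclidean \<phi>"
      using continuous_map_from_subtopology_mono[OF continuous_chart SU] .
    have c2: "continuous_map euclidean euclidean (\<lambda>x. Q x - a)"
      by (intro continuous_map_diff) (use linear_continuous_on[OF Q(1)] in auto)
    from continuous_map_compose[OF c1 c2] have "continuous_map (subtopology (mtop M) S) euclidean \<eta>"
      by (simp add: o_def \<eta>_def[abs_def])
    then show "continuous_map (subtopology (mtop N) S) (top_of_set (\<eta> ` S)) \<eta>"
      using SM by (auto simp: N(1) continuous_map_in_subtopology subtopology_subtopology)
    have "continuous_map (top_of_set ?B) (top_of_set (\<phi> ` U)) y"
      using smooth_on_imp_continuous_on[OF y(1)] y(2) by (auto simp: continuous_map_in_subtopology)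
    from continuous_map_compose[OF this continuous_inv]
    show "continuous_map (top_of_set (\<eta> ` S)) (subtopology (mtop N) S) (\<lambda>s. \<psi> (y s))"
      by (auto simp: N(1) continuous_map_in_subtopology im o_def mem)
    show "\<psi> (y (\<eta> q)) = q" if "q \<in> topspace (subtopology (mtop N) S)" for q
      using that eta by (auto simp: S_def)
    show "\<eta> (\<psi> (y s)) = s" if "s \<in> topspace (top_of_set (\<eta> ` S))" for s
      using that eta by (simp add: im)
  qed
  then have homeo: "homeomorphic_map (subtopology (mtop N) S) (top_of_set (\<eta> ` S)) \<eta>"
    by (auto simp: homeomorphic_map_maps)
  have N_M: "smooth_manifold N"
    unfolding smooth_manifold_def N(2)
  proof (intro conjI)
    show "Hausdorff_space (mtop N)" "second_countable (mtop N)"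
      using M by (auto simp: N(1) smooth_manifold_def Hausdorff_space_subtopology second_countable_subtopology)
    have "smooth_on (\<eta> ` S) (\<eta> \<circ> inv_into S \<eta>)"
      by (rule smooth_on_cong[OF _ smooth_on_bounded_linear[OF bounded_linear_ident]])
         (auto simp: im inv eta)
    then show "\<forall>(U, \<phi>)\<in>{(S, \<eta>)}. \<forall>(V, \<psi>)\<in>{(S, \<eta>)}. smooth_on (\<phi> ` (U \<inter> V)) (\<psi> \<circ> inv_into U \<phi>)"
      by simp
    show "\<forall>(U, \<phi>)\<in>{(S, \<eta>)}. openin (mtop N) U \<and> open (\<phi> ` U) \<and>
        homeomorphic_map (subtopology (mtop N) U) (top_of_set (\<phi> ` U)) \<phi>"
      using homeo pts by (auto simp: im)
  qed (simp add: pts)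
  have smooth: "smooth_map N M (\<lambda>x. x)"
    unfolding smooth_map_def N(2)
  proof (intro conjI)
    show "continuous_map (mtop N) (mtop M) (\<lambda>x. x)"
      by (simp add: N(1) continuous_map_from_subtopology)
    have "smooth_on (\<eta> ` (S \<inter> V)) (\<theta> \<circ> inv_into S \<eta>)" if V: "(V, \<theta>) \<in> atlas M" for V \<theta>
    proof -
      interpret V: chart M V \<theta> using M V by unfold_locales
      have op: "open (\<phi> ` (U \<inter> V))" by (rule open_chart_image[OF V.openin_U])
      \<comment> \<open>In the chart of \<open>N\<close> the overlap is a preimage under the
        continuous map \<open>y\<close>; this yields its openness.\<close>
      have eq: "\<eta> ` (S \<inter> V) = ?B \<inter> y -` (\<phi> ` (U \<inter> V))"
      proof (intro equalityI subsetI)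
        fix s assume "s \<in> \<eta> ` (S \<inter> V)"
        then obtain t where t: "t \<in> ?B" "\<psi> (y t) \<in> V" "s = t" using eta by (auto simp: S_def)
        then show "s \<in> ?B \<inter> y -` (\<phi> ` (U \<inter> V))"
          using y(2)[OF t(1)] by (auto intro!: image_eqI[of _ _ "\<psi> (y t)"])
      next
        fix s assume s: "s \<in> ?B \<inter> y -` (\<phi> ` (U \<inter> V))"
        then have "\<psi> (y s) \<in> S \<inter> V" by (auto simp: S_def)
        then show "s \<in> \<eta> ` (S \<inter> V)" using eta[of s] s by (metis IntE image_eqI)
      qed
      have opS: "open (\<eta> ` (S \<inter> V))" unfolding eq
        by (rule continuous_open_preimage[OF smooth_on_imp_continuous_on[OF y(1)] open_ball op])
      have "smooth_on (\<phi> ` (U \<inter> V)) (\<theta> \<circ> \<psi>)"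
        using M chart V unfolding smooth_manifold_def by fast
      then have sm: "smooth_on (\<phi> ` (U \<inter> V)) (\<lambda>x. \<theta> (\<psi> x))" unfolding o_def .
      have "smooth_on (\<eta> ` (S \<inter> V)) (\<lambda>s. \<theta> (\<psi> (y s)))"
        by (rule smooth_on_compose[OF opS op _ smooth_on_subset[OF y(1)] sm]) (auto simp: eq)
      then show ?thesis by (rule smooth_on_cong[OF opS]) (auto simp: eq inv)
    qed
    then show "\<forall>(U, \<phi>)\<in>{(S, \<eta>)}. \<forall>(V, \<psi>)\<in>atlas M.
        smooth_on (\<phi> ` (U \<inter> (\<lambda>x. x) -` V)) (\<psi> \<circ> (\<lambda>x. x) \<circ> inv_into U \<phi>)"
      by (auto simp: o_def)
  qed
  interpret I: immersion_charts N S \<eta> M U \<phi>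
    by unfold_locales (use N_M smooth pts SM N(2) in auto)
  have SU': "S \<inter> U = S" using SU by blast
  have Dj: "\<D> I.j s = \<D> y s" if "s \<in> ?B" for s
    by (rule frechet_derivative_cong_open[OF open_ball that]) (use y(2) in \<open>simp add: I.j_def inv\<close>)
  have diff: "differential N M (\<lambda>x. x) (chart_vec N S \<eta> (\<psi> (y s)) b) =
      tv (\<psi> (y s)) (\<D> y s b)" if s: "s \<in> ?B" for s b
    using I.differential_chart_vec[OF mem[OF s] inv_in[OF y(2)[OF s]], of b] by (simp only: eta[OF s] Dj[OF s])
  have tan: "tangent_space N (\<psi> (y s)) = range (chart_vec N S \<eta> (\<psi> (y s)))" if "s \<in> ?B" for s
    by (rule I.N.tangent_space_eq) (use that in \<open>simp add: S_def\<close>)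
  show "differential N M (\<lambda>x. x) ` tangent_space N (\<psi> (y s)) =
      tv (\<psi> (y s)) ` range (\<D> y s)" if "s \<in> ?B" for s
    by (simp add: tan[OF that] image_image diff[OF that])
  have "inj_on (differential N M (\<lambda>x. x)) (tangent_space N q)" if q: "q \<in> points N" for q
  proof -
    obtain s where s: "s \<in> ?B" "q = \<psi> (y s)" using q unfolding pts S_def by blast
    \<comment> \<open>Differentiating \<open>Q (y s) = a + s\<close> exhibits \<open>Q\<close> as a
      left inverse of the derivative of \<open>y\<close>, so the inclusion is an immersion.\<close>
    have Qdy: "Q (\<D> y s b) = b" for b
    proof -
      have "((\<lambda>s. Q (y s)) has_derivative (\<lambda>b. Q (\<D> y s b))) (at s)"
        by (rule bounded_linear.has_derivative[OF Q(1) smooth_on_has_derivative[OF y(1) s(1)]])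
      then have "((\<lambda>s. a + s) has_derivative (\<lambda>b. Q (\<D> y s b))) (at s)"
        by (rule has_derivative_transform_within_open[OF _ open_ball s(1)]) (simp add: Q(2))
      moreover have "((\<lambda>s. a + s) has_derivative (\<lambda>b. b)) (at s)" by (auto intro!: derivative_eq_intros)
      ultimately show ?thesis by (metis has_derivative_unique)
    qed
    have qU: "\<psi> (y s) \<in> U" using y(2)[OF s(1)] by simp
    have "b = b'" if "tv (\<psi> (y s)) (\<D> y s b) =
        tv (\<psi> (y s)) (\<D> y s b')" for b b'
      using chart_vec_inj[OF qU that] Qdy by metis
    then show ?thesis unfolding s(2) tan[OF s(1)] inj_on_def by (auto simp: diff[OF s(1)])
  qed
  then show "immersed_submanifold M N"
    using N_M smooth pts SM by (simp add: immersed_submanifold_def)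
qed

lemma vector_space_scale: "vector_space ((\<odot>) :: real \<Rightarrow> ('b \<Rightarrow> real) \<Rightarrow> 'b \<Rightarrow> real)"
  by unfold_locales (auto simp: scale_def fun_eq_iff algebra_simps)

text \<open>Translates \<open>rank_at\<close>, a dimension in the space of functionals with scalars
  acting by \<open>\<odot>\<close>, into the dimension of a Euclidean subspace.\<close>

lemma (in chart) dim_chart_vec_image:
  assumes "p \<in> U"
  shows "vector_space.dim (\<odot>) (tv p ` S) = dim S"
proof -
  interpret tv: vector_space "(\<odot>) :: real \<Rightarrow> 'a tvec \<Rightarrow> 'a tvec" by (rule vector_space_scale)
  interpret vp: finite_dimensional_vector_space_pair_1 "(*\<^sub>R) :: real \<Rightarrow> 'e \<Rightarrow> 'e" Basis "(\<odot>) :: real \<Rightarrow> 'a tvec \<Rightarrow> 'a tvec" ..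
  have "Vector_Spaces.linear (*\<^sub>R) (\<odot>) (tv p)"
    by unfold_locales (simp_all add: chart_vec_linear[OF assms])
  from vp.dim_image_eq[OF this] show ?thesis
    using chart_vec_inj[OF assms] by (auto simp: inj_on_def dim_raw_def)
qed

lemma tensor_field_linear:
  assumes "tensor_field M F" "p \<in> points M" "v \<in> tangent_space M p"
  shows "F p v \<in> tangent_space M p" "F p (c \<odot> v) = c \<odot> F p v"
    and "w \<in> tangent_space M p \<Longrightarrow> F p (v + w) = F p v + F p w"
  using assms by (auto simp: tensor_field_def)

lemma tensor_field_app: "tensor_field M F \<Longrightarrow> X \<in> vector_fields M \<Longrightarrow> F \<cdot> X \<in> vector_fields M"
  by (simp add: tensor_field_def)

lemma (in chart) subspace_image_tensor:
  assumes F: "tensor_field M F" and p: "p \<in> U"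
  shows "subspace {b. tv p b \<in> F p ` tangent_space M p}"
proof -
  have pM: "p \<in> points M" using p U_subset by auto
  note lin = tensor_field_linear[OF F pM]
  have T: "tangent_space M p = range (tv p)" by (rule tangent_space_eq[OF p])
  show ?thesis
  proof (rule subspaceI; unfold mem_Collect_eq)
    have "F p (tv p (0 *\<^sub>R 0)) = tv p (0 *\<^sub>R 0)"
      unfolding chart_vec_linear(2)[OF p] lin(2)[OF chart_vec_in[OF p]] by (simp add: scale_def)
    then show "tv p 0 \<in> F p ` tangent_space M p"
      using chart_vec_in[OF p, of 0] by (metis image_eqI scaleR_zero_left)
  next
    fix b c assume "tv p b \<in> F p ` tangent_space M p" "tv p c \<in> F p ` tangent_space M p"
    then obtain b' c' where "tv p b = F p (tv p b')"
      "tv p c = F p (tv p c')" unfolding T by auto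
    then have "tv p (b + c) = F p (tv p (b' + c'))"
      using lin(3)[OF chart_vec_in[OF p] chart_vec_in[OF p]] by (simp only: chart_vec_linear(1)[OF p])
    then show "tv p (b + c) \<in> F p ` tangent_space M p" using chart_vec_in[OF p] by blast
  next
    fix r b assume "tv p b \<in> F p ` tangent_space M p"
    then obtain b' where "tv p b = F p (tv p b')" unfolding T by auto
    then have "tv p (r *\<^sub>R b) = F p (tv p (r *\<^sub>R b'))"
      using lin(2)[OF chart_vec_in[OF p]] by (simp only: chart_vec_linear(2)[OF p])
    then show "tv p (r *\<^sub>R b) \<in> F p ` tangent_space M p" using chart_vec_in[OF p] by blast
  qed
qed

text \<open>In a chart the distribution becomes the family of subspaces \<open>E q\<close> of
  constant dimension. A frame is made from global fields \<open>F \<cdot> X i\<close>, because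
  involutivity is assumed only for brackets of fields of this form.\<close>

lemma integral_manifold_through:
  fixes M :: "('a, 'e::euclidean_space) manifold"
  assumes M: "smooth_manifold M" and F: "tensor_field M F"
    and rank: "\<And>q. q \<in> points M \<Longrightarrow> rank_at M F q = DIM('d::euclidean_space)"
    and inv: "\<And>X Y q. X \<in> vector_fields M \<Longrightarrow> Y \<in> vector_fields M \<Longrightarrow> q \<in> points M \<Longrightarrow>
      lie M (F \<cdot> X) (F \<cdot> Y) q \<in> F q ` tangent_space M q"
    and p: "p \<in> points M"
  obtains N :: "('a, 'd::euclidean_space) manifold" where "p \<in> points N" "immersed_submanifold M N"
    "\<And>q. q \<in> points N \<Longrightarrow> differential N M (\<lambda>x. x) ` tangent_space N q = F q ` tangent_space M q"
proof -
  obtain U \<phi> where U: "chart M U \<phi>" "p \<in> U" using chart_at[OF M p] by blast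
  interpret chart M U \<phi> by (rule U(1))
  define E where "E q = {b. tv q b \<in> F q ` tangent_space M q}" for q
  have UM: "q \<in> points M" if "q \<in> U" for q using that U_subset by auto
  have subE: "subspace (E q)" if "q \<in> U" for q unfolding E_def by (rule subspace_image_tensor[OF F that])
  have imE: "tv q ` E q = F q ` tangent_space M q" if q: "q \<in> U" for q
  proof -
    have *: "F q ` tangent_space M q \<subseteq> range (tv q)"
      using tensor_field_linear(1)[OF F UM[OF q]] tangent_space_eq[OF q] by auto
    show ?thesis
    proof (intro equalityI subsetI)
      fix v assume v: "v \<in> F q ` tangent_space M q"
      then obtain b where "v = tv q b" using * by blast
      with v show "v \<in> tv q ` E q" by (simp add: E_def)
    qed (auto simp: E_def)
  qed
  have dimE: "dim (E q) = DIM('d)" if q: "q \<in> U" for q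
    using rank[OF UM[OF q]] dim_chart_vec_image[OF q, of "E q"] by (simp add: rank_at_def imE[OF q])
  obtain J :: "'d \<Rightarrow> 'e" where J: "linear J" "J ` UNIV = E p" "inj_on J UNIV"
    using subspace_isomorphism[OF subspace_UNIV subE[OF U(2)]] dimE[OF U(2)] by auto
  \<comment> \<open>Each frame vector at \<open>p\<close> is the value of \<open>F\<close> on some
    tangent vector, and that vector extends to a global field.\<close>
  have "\<exists>X. X \<in> vector_fields M \<and> (F \<cdot> X) p = tv p (J i)" for i
  proof -
    have "J i \<in> E p" using J(2) by auto
    then obtain a where a: "tv p (J i) = F p (tv p a)"
      unfolding E_def tangent_space_eq[OF U(2)] by auto
    obtain X where "X \<in> vector_fields M" "X p = tv p a"
      by (rule vector_field_through[OF U(2)])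
    then show ?thesis using a by (auto simp: field_app_def)
  qed
  then obtain X where X: "\<And>i. X i \<in> vector_fields M" "\<And>i. (F \<cdot> X i) p = tv p (J i)" by metis
  define f where "f i = rep (F \<cdot> X i)" for i
  have FX: "F \<cdot> X i \<in> vector_fields M" for i by (rule tensor_field_app[OF F X(1)])
  have f: "smooth_on (\<phi> ` U) (f i)" for i unfolding f_def by (rule smooth_on_field_rep[OF FX])
  have fE: "f i (\<phi> q) \<in> E q" if q: "q \<in> U" for i q
  proof -
    have "tv q (f i (\<phi> q)) = F q (X i q)"
      using chart_vec_field_rep[OF FX q] by (simp add: f_def field_app_def)
    then show ?thesis using vector_fields_tangent[OF X(1) UM[OF q]] by (auto simp: E_def)
  qed
  define G :: "'e \<Rightarrow> 'd \<Rightarrow>\<^sub>L 'e" where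
    "G x = (\<Sum>i\<in>Basis. blinfun_scaleR_left (f i x) o\<^sub>L blinfun_inner_left i)" for x
  have G: "G x v = (\<Sum>i\<in>Basis. (v \<bullet> i) *\<^sub>R f i x)" for x v
    by (simp add: G_def blinfun.sum_left inner_commute)
  have smG: "smooth_on (\<phi> ` U) G"
  proof (rule smooth_on_blinfun_componentwise[OF open_image])
    fix i :: 'd assume "i \<in> Basis"
    then have "G x i = f i x" for x
      by (simp add: G inner_Basis if_distrib[of "\<lambda>c. c *\<^sub>R _"] cong: if_cong)
    then show "smooth_on (\<phi> ` U) (\<lambda>x. G x i)" using f by simp
  qed
  have "f i (\<phi> p) = J i" for i unfolding f_def by (rule field_rep_eqI[of p "F \<cdot> X i", OF U(2) X(2)])
  then have GJ: "G (\<phi> p) v = J v" for v using linear_Basis_expansion[OF J(1), of v] by (simp add: G)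
  have pI: "\<phi> p \<in> \<phi> ` U" using U(2) by auto
  have injGp: "inj (G (\<phi> p))" using J(3) by (simp add: inj_on_def GJ)
  obtain S' and Q :: "'e \<Rightarrow>\<^sub>L 'd" and C :: "'e \<Rightarrow> 'd \<Rightarrow>\<^sub>L 'd" where S': "open S'" "\<phi> p \<in> S'" "S' \<subseteq> \<phi> ` U"
    and C: "\<And>x v. x \<in> S' \<Longrightarrow> C x (Q (G x v)) = v"
    by (rule smooth_on_local_left_inverse[OF open_image pI smG injGp]) blast
  have injG: "inj (G x)" if "x \<in> S'" for x
    by (rule inj_on_inverseI[of _ "\<lambda>z. C x (Q z)"]) (use C[OF that] in simp)
  \<comment> \<open>Near \<open>p\<close> the frame stays independent, so its span has dimension
    \<open>DIM('d)\<close>. Constant rank gives \<open>E\<close> the same dimension, and inclusion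
    becomes equality.\<close>
  have rangeG: "range (G x) = E (\<psi> x)" if x: "x \<in> S'" for x
  proof (rule subspace_dim_equal)
    have xU: "x \<in> \<phi> ` U" "\<psi> x \<in> U" using x S'(3) by auto
    have lin: "linear (G x)" using blinfun.bounded_linear_right bounded_linear.linear by blast
    show "subspace (range (G x))" by (rule linear_subspace_image[OF lin subspace_UNIV])
    show sE: "subspace (E (\<psi> x))" by (rule subE[OF xU(2)])
    have fx: "f i x \<in> E (\<psi> x)" for i using fE[OF xU(2), of i] xU(1) by simp
    show "range (G x) \<subseteq> E (\<psi> x)"
    proof (rule image_subsetI)
      show "G x v \<in> E (\<psi> x)" for v unfolding G by (intro subspace_sum[OF sE] subspace_scale[OF sE] fx)
    qed
    have "dim (range (G x)) = DIM('d)"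
      using dim_image_eq[OF lin, of UNIV] injG[OF x] by (simp add: inj_on_def)
    then show "dim (E (\<psi> x)) \<le> dim (range (G x))" using dimE[OF xU(2)] by simp
  qed
  \<comment> \<open>\<open>G x v\<close> combines the frame fields with constant coefficients
    \<open>v \<bullet> i\<close>, so the expression is a bilinear combination of their pairwise
    brackets.\<close>
  have invG: "bderiv G x (G x v) w - bderiv G x (G x w) v \<in> range (G x)" if x: "x \<in> S'" for x v w
  proof -
    have xU: "x \<in> \<phi> ` U" "\<psi> x \<in> U" using x S'(3) by auto
    have sE: "subspace (E (\<psi> x))" by (rule subE[OF xU(2)])
    let ?D = "\<lambda>i. \<D> (f i) x"
    have linD: "linear (?D i)" for i by (rule has_derivative_linear[OF smooth_on_has_derivative[OF f xU(1)]])
    have dG: "bderiv G x u w = (\<Sum>i\<in>Basis. (w \<bullet> i) *\<^sub>R ?D i u)" for u w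
    proof -
      have 1: "((\<lambda>x. G x w) has_derivative (\<lambda>u. bderiv G x u w)) (at x)"
        by (rule bounded_linear.has_derivative[OF blinfun.bounded_linear_left
              smooth_on_has_derivative[OF smG xU(1), folded bderiv_apply[OF smG xU(1)]]])
      have 2: "((\<lambda>x. G x w) has_derivative (\<lambda>u. \<Sum>i\<in>Basis. (w \<bullet> i) *\<^sub>R ?D i u)) (at x)"
        unfolding G
        by (intro has_derivative_sum has_derivative_scaleR_right smooth_on_has_derivative[OF f xU(1)])
      show ?thesis using fun_cong[OF has_derivative_unique[OF 1 2], of u] .
    qed
    have dGG: "bderiv G x (G x v) w = (\<Sum>i\<in>Basis. \<Sum>k\<in>Basis. ((w \<bullet> i) * (v \<bullet> k)) *\<^sub>R ?D i (f k x))" for v w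
      unfolding dG G by (simp add: linear_sum[OF linD] linear_scale[OF linD] scaleR_sum_right)
    have "bderiv G x (G x w) v = (\<Sum>i\<in>Basis. \<Sum>k\<in>Basis. ((w \<bullet> i) * (v \<bullet> k)) *\<^sub>R ?D k (f i x))"
      unfolding dGG by (subst sum.swap) (simp add: mult.commute)
    then have "bderiv G x (G x v) w - bderiv G x (G x w) v =
        (\<Sum>i\<in>Basis. \<Sum>k\<in>Basis. ((w \<bullet> i) * (v \<bullet> k)) *\<^sub>R (?D i (f k x) - ?D k (f i x)))"
      unfolding dGG by (simp add: sum_subtractf scaleR_diff_right)
    also have "\<dots> \<in> E (\<psi> x)"
    proof (intro subspace_sum[OF sE] subspace_scale[OF sE])
      fix i k
      have "lie M (F \<cdot> X k) (F \<cdot> X i) (\<psi> x) = tv (\<psi> x) (?D i (f k x) - ?D k (f i x))"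
        using lie_chart[OF FX[of k] FX[of i] xU(2)] xU(1) by (simp add: f_def)
      then show "?D i (f k x) - ?D k (f i x) \<in> E (\<psi> x)"
        using inv[OF X(1) X(1) UM[OF xU(2)], of k i] by (simp add: E_def)
    qed
    finally show ?thesis unfolding rangeG[OF x] .
  qed
  show thesis
  proof (rule Frobenius_local[OF S'(1,2) smooth_on_subset[OF smG S'(3)] injG[OF S'(2)] invG])
    fix \<rho> and y :: "'d \<Rightarrow> 'e" and P :: "'e \<Rightarrow> 'd"
    assume y: "\<rho> > 0" "y 0 = \<phi> p" "smooth_on (ball 0 \<rho>) y" "\<And>s. y s \<in> S'"
      and P: "bounded_linear P" "\<And>s. s \<in> ball 0 \<rho> \<Longrightarrow> P (y s) = P (\<phi> p) + s"
      and dy: "\<And>s. s \<in> ball 0 \<rho> \<Longrightarrow> range (\<D> y s) = range (G (y s))"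
    have yU: "y s \<in> \<phi> ` U" for s using y(4) S'(3) by blast
    let ?S = "(\<lambda>s. \<psi> (y s)) ` ball 0 \<rho>"
    let ?N = "Manifold (subtopology (mtop M) ?S) {(?S, \<lambda>q. P (\<phi> q) - P (\<phi> p))}"
    have pts: "points ?N = ?S" by (rule graph_submanifold(1)[OF y(3) yU P(1)]) (use P(2) in auto)
    have imm: "immersed_submanifold M ?N" by (rule graph_submanifold(2)[OF y(3) yU P(1)]) (use P(2) in auto)
    have dif: "differential ?N M (\<lambda>x. x) ` tangent_space ?N (\<psi> (y s)) =
        tv (\<psi> (y s)) ` range (\<D> y s)" if "s \<in> ball 0 \<rho>" for s
      by (rule graph_submanifold(3)[OF y(3) yU P(1)]) (use P(2) that in auto)
    show thesis
    proof (rule that[of ?N])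
      have "p = \<psi> (y 0)" using y(2) U(2) by simp
      then show "p \<in> points ?N" unfolding pts using y(1) by auto
      show "immersed_submanifold M ?N" by (rule imm)
      fix q assume "q \<in> points ?N"
      then obtain s where s: "s \<in> ball 0 \<rho>" "q = \<psi> (y s)" unfolding pts by auto
      have "\<psi> (y s) \<in> U" using yU by simp
      then show "differential ?N M (\<lambda>x. x) ` tangent_space ?N q = F q ` tangent_space M q"
        unfolding s(2) dif[OF s(1)] dy[OF s(1)] rangeG[OF y(4)] by (rule imE)
    qed
  qed
qed

section \<open>The projection l is real\<close>

text \<open>The algebra in a single fibre: \<open>T\<close> is a real tangent space and
  \<open>f\<close> the value of \<open>F\<close>. The two equations are the real and imaginary parts
  of the structure equation on real vectors.\<close>

locale structure_endomorphism =
  fixes T :: "'b tvec set" and f :: "'b tvec \<Rightarrow> 'b tvec" and K :: nat and \<alpha> \<beta> :: complex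
  assumes T: "0 \<in> T" "\<And>v w. v \<in> T \<Longrightarrow> w \<in> T \<Longrightarrow> v + w \<in> T" "\<And>v c. v \<in> T \<Longrightarrow> c \<odot> v \<in> T"
    and f: "\<And>v. v \<in> T \<Longrightarrow> f v \<in> T" "\<And>v w. v \<in> T \<Longrightarrow> w \<in> T \<Longrightarrow> f (v + w) = f v + f w"
      "\<And>v c. v \<in> T \<Longrightarrow> f (c \<odot> v) = c \<odot> f v"
    and K: "K \<ge> 3"
    and eqRe: "\<And>v. v \<in> T \<Longrightarrow> Re \<alpha> \<odot> (f ^^ (K + 1)) v + Re \<beta> \<odot> (f ^^ K) v + f v = 0"
    and eqIm: "\<And>v. v \<in> T \<Longrightarrow> Im \<alpha> \<odot> (f ^^ (K + 1)) v + Im \<beta> \<odot> (f ^^ K) v = 0"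
begin

definition comb :: "real \<Rightarrow> real \<Rightarrow> nat \<Rightarrow> 'b tvec \<Rightarrow> 'b tvec" where
  "comb a b k v = a \<odot> (f ^^ Suc k) v + b \<odot> (f ^^ k) v"

definition L :: "'b tvec \<Rightarrow> 'b tvec" where "L = comb (- Re \<alpha>) (- Re \<beta>) (K - 1)"

text \<open>One power of \<open>f\<close> below \<open>L\<close>, so that \<open>f\<close> composed
  with \<open>pre\<close> is \<open>L\<close>. It witnesses that the image of \<open>L\<close> lies
  in the image of \<open>f\<close>, by a polynomial that also preserves smooth fields.\<close>

definition pre :: "'b tvec \<Rightarrow> 'b tvec" where "pre = comb (- Re \<alpha>) (- Re \<beta>) (K - 2)"

lemma pow: "v \<in> T \<Longrightarrow> (f ^^ k) v \<in> T" "v \<in> T \<Longrightarrow> w \<in> T \<Longrightarrow> (f ^^ k) (v + w) = (f ^^ k) v + (f ^^ k) w"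
  "v \<in> T \<Longrightarrow> (f ^^ k) (c \<odot> v) = c \<odot> (f ^^ k) v"
proof -
  show 1: "(f ^^ k) v \<in> T" if "v \<in> T" for v k using that by (induction k) (auto simp: f)
  show "(f ^^ k) (v + w) = (f ^^ k) v + (f ^^ k) w" if "v \<in> T" "w \<in> T"
    using that by (induction k) (auto simp: f(2) 1)
  show "(f ^^ k) (c \<odot> v) = c \<odot> (f ^^ k) v" if "v \<in> T"
    using that by (induction k) (auto simp: f(3) 1)
qed

lemma scale_add: "c \<odot> (v + w) = c \<odot> v + c \<odot> w" for c :: real and v w :: "'b tvec"
  by (simp add: scale_def fun_eq_iff algebra_simps)

lemma comb_in: "v \<in> T \<Longrightarrow> comb a b k v \<in> T"
  unfolding comb_def by (intro T pow)

lemma comb_add: "v \<in> T \<Longrightarrow> w \<in> T \<Longrightarrow> comb a b k (v + w) = comb a b k v + comb a b k w"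
  unfolding comb_def pow(2) scale_add by (simp add: algebra_simps)

lemma f_comb: "v \<in> T \<Longrightarrow> f (comb a b k v) = comb a b (Suc k) v"
  unfolding comb_def by (simp add: f pow T(3) f(3)[OF f(1)[OF pow(1)]])

lemma comb_f: "comb a b k (f v) = comb a b (Suc k) v"
  unfolding comb_def by (simp add: funpow_swap1)

lemma f_zero: "f 0 = 0"
  using f(3)[OF T(1), of 0] by (simp add: scale_def zero_fun_def)

lemma comb_zero: "comb a b k 0 = 0"
proof -
  have "(f ^^ k) 0 = 0" for k
    by (induction k) (simp_all only: funpow.simps o_apply id_apply f_zero)
  from this[of k] this[of "Suc k"] show ?thesis unfolding comb_def by (simp only:) (simp add: scale_def zero_fun_def)
qed

lemma comb_K: "v \<in> T \<Longrightarrow> comb (- Re \<alpha>) (- Re \<beta>) K v = f v" "v \<in> T \<Longrightarrow> comb (Im \<alpha>) (Im \<beta>) K v = 0"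
  using eqRe[of v] eqIm[of v] unfolding comb_def by (simp_all add: scale_def fun_eq_iff) (smt (verit))

lemma K_Suc: "Suc (K - 1) = K" "Suc (K - 2) = K - 1" "Suc (K - 3) = K - 2"
  using K by auto

lemma L_in: "v \<in> T \<Longrightarrow> L v \<in> T" and L_zero: "L 0 = 0" and pre_in: "v \<in> T \<Longrightarrow> pre v \<in> T"
  and L_add: "v \<in> T \<Longrightarrow> w \<in> T \<Longrightarrow> L (v + w) = L v + L w"
  unfolding L_def pre_def by (simp_all add: comb_in comb_zero comb_add)

text \<open>Composition with \<open>f\<close> on either side raises the exponent in
  \<open>comb\<close> by one; at exponent \<open>K\<close> the real structure equation turns
  \<open>comb\<close> into \<open>f\<close>.\<close>

lemma L_f: "v \<in> T \<Longrightarrow> L (f v) = f v" and f_L: "v \<in> T \<Longrightarrow> f (L v) = f v" and f_pre: "v \<in> T \<Longrightarrow> f (pre v) = L v"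
  unfolding L_def pre_def by (simp_all only: comb_f f_comb K_Suc comb_K)

lemma L_L: "v \<in> T \<Longrightarrow> L (L v) = L v"
  using L_f[OF pre_in] f_pre by metis

lemma L_image: "L ` T = f ` T"
proof (intro equalityI subsetI)
  fix v assume "v \<in> L ` T"
  then show "v \<in> f ` T" using f_pre pre_in by force
next
  fix v assume "v \<in> f ` T"
  then show "v \<in> L ` T" using L_f f(1) by force
qed

lemma scale_minus_one: "(- 1) \<odot> v = - v" for v :: "'b tvec"
  by (simp add: scale_def fun_eq_iff)

lemma L_diff: "v \<in> T \<Longrightarrow> w \<in> T \<Longrightarrow> v - w \<in> T \<and> L (v - w) = L v - L w"
proof -
  assume vw: "v \<in> T" "w \<in> T"
  have d: "v - w \<in> T" using T(2)[OF vw(1) T(3)[OF vw(2), of "- 1"]] by (simp add: scale_minus_one)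
  show ?thesis using d L_add[OF d vw(2)] by (simp add: algebra_simps)
qed

text \<open>The imaginary part of \<open>l\<close> vanishes on the image and on the kernel of \<open>F\<close>, and these span.\<close>

lemma imaginary_part_zero:
  assumes v: "v \<in> T" shows "comb (Im \<alpha>) (Im \<beta>) (K - 1) v = 0"
proof -
  let ?g = "comb (Im \<alpha>) (Im \<beta>) (K - 1)"
  have d: "v - L v \<in> T" using L_diff[OF v L_in[OF v]] by blast
  have "f (v - L v) + f (L v) = f v" using f(2)[OF d L_in[OF v]] by simp
  then have fm: "f (v - L v) = 0" using f_L[OF v] by simp
  have "?g (v - L v) = comb (Im \<alpha>) (Im \<beta>) (K - 2) (f (v - L v))" by (simp only: comb_f K_Suc)
  then have 1: "?g (v - L v) = 0" by (simp add: fm comb_zero)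
  have "?g (L v) = comb (Im \<alpha>) (Im \<beta>) K (pre v)" using f_pre[OF v] comb_f[of _ _ "K - 1" "pre v"] by (simp only: K_Suc)
  then have 2: "?g (L v) = 0" using comb_K(2)[OF pre_in[OF v]] by simp
  show ?thesis using comb_add[OF d L_in[OF v], of "Im \<alpha>" "Im \<beta>" "K - 1"] 1 2 by simp
qed

text \<open>Expanding the complex products, the terms with \<open>Im \<alpha>\<close> and
  \<open>Im \<beta>\<close> group into the polynomial of \<open>imaginary_part_zero\<close>,
  evaluated at the real and at the imaginary part of \<open>w\<close>.\<close>

lemma l_formula:
  assumes "Re_vec w \<in> T" "Im_vec w \<in> T"
  shows "- (\<alpha> * Complex ((f ^^ K) (Re_vec w) h) ((f ^^ K) (Im_vec w) h)
      + \<beta> * Complex ((f ^^ (K - 1)) (Re_vec w) h) ((f ^^ (K - 1)) (Im_vec w) h))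
    = Complex (L (Re_vec w) h) (L (Im_vec w) h)"
  using fun_cong[OF imaginary_part_zero[OF assms(1)], of h] fun_cong[OF imaginary_part_zero[OF assms(2)], of h]
  unfolding L_def comb_def K_Suc
  by (simp add: complex_eq_iff scale_def)

end

lemma tangent_space_subspace:
  "0 \<in> tangent_space M p"
  "v \<in> tangent_space M p \<Longrightarrow> w \<in> tangent_space M p \<Longrightarrow> v + w \<in> tangent_space M p"
  "v \<in> tangent_space M p \<Longrightarrow> c \<odot> v \<in> tangent_space M p"
  by (auto simp: tangent_space_def scale_def algebra_simps)

lemma vector_fields_add:
  assumes "smooth_manifold M" "X \<in> vector_fields M" "Y \<in> vector_fields M"
  shows "(\<lambda>p. X p + Y p) \<in> vector_fields M"
  unfolding vector_fields_def mem_Collect_eq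
proof (intro conjI ballI)
  show "X p + Y p \<in> tangent_space M p" if "p \<in> points M" for p
    by (rule tangent_space_subspace(2)[OF vector_fields_tangent[OF assms(2) that] vector_fields_tangent[OF assms(3) that]])
  show "(\<lambda>p. (X p + Y p) f) \<in> smooth_funs M" if "f \<in> smooth_funs M" for f
    using smooth_funs_add[OF assms(1) vector_fields_smooth[OF assms(2) that] vector_fields_smooth[OF assms(3) that]]
    by (simp add: plus_fun_def)
qed

lemma vector_fields_scale:
  assumes "smooth_manifold M" "X \<in> vector_fields M"
  shows "(\<lambda>p. c \<odot> X p) \<in> vector_fields M"
  unfolding vector_fields_def mem_Collect_eq
proof (intro conjI ballI)
  show "c \<odot> X p \<in> tangent_space M p" if "p \<in> points M" for p
    by (rule tangent_space_subspace(3)[OF vector_fields_tangent[OF assms(2) that]])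
  show "(\<lambda>p. (c \<odot> X p) f) \<in> smooth_funs M" if "f \<in> smooth_funs M" for f
    using smooth_funs_scale[OF assms(1) vector_fields_smooth[OF assms(2) that], of c]
    by (simp add: scale_def)
qed

section \<open>Complexification\<close>

definition of_real_vec :: "'a tvec \<Rightarrow> 'a ctvec" where
  "of_real_vec v = (\<lambda>f. complex_of_real (v f))"

lemma Re_of_real_vec [simp]: "Re_vec (of_real_vec v) = v"
  and Im_of_real_vec [simp]: "Im_vec (of_real_vec v) = 0"
  by (auto simp: Re_vec_def Im_vec_def of_real_vec_def)

lemma of_real_vec_diff: "of_real_vec (v - w) = of_real_vec v - of_real_vec w"
  and of_real_vec_add: "of_real_vec (v + w) = of_real_vec v + of_real_vec w"
  by (auto simp: of_real_vec_def)

lemma of_real_vec_eq_0: "of_real_vec v = 0 \<longleftrightarrow> v = 0"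
  by (auto simp: of_real_vec_def fun_eq_iff)

lemma of_real_vec_complexify:
  "v \<in> tangent_space M p \<Longrightarrow> of_real_vec v \<in> complexify_space (tangent_space M p)"
  by (simp only: complexify_space_def mem_Collect_eq Re_of_real_vec Im_of_real_vec tangent_space_subspace(1) simp_thms)

lemma complexify_tensor_of_real: "F p 0 = 0 \<Longrightarrow> complexify_tensor F p (of_real_vec v) = of_real_vec (F p v)"
  by (simp add: complexify_tensor_def) (simp add: of_real_vec_def complex_eq_iff fun_eq_iff)

lemma complexify_tensor_power:
  "(complexify_tensor F p ^^ k) w = (\<lambda>f. Complex ((F p ^^ k) (Re_vec w) f) ((F p ^^ k) (Im_vec w) f))"
  by (induction k) (auto simp: complexify_tensor_def Re_vec_def Im_vec_def)

text \<open>Integral manifolds are defined by complexified tangent spaces; this recovers the real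
  equality. Zero must lie in both sets because real vectors have imaginary part zero.\<close>

lemma complexify_space_inject:
  assumes "complexify_space A = complexify_space B" "0 \<in> A" "0 \<in> B"
  shows "A = B"
proof -
  have "v \<in> A \<longleftrightarrow> of_real_vec v \<in> complexify_space A" "v \<in> B \<longleftrightarrow> of_real_vec v \<in> complexify_space B" for v
    by (simp_all only: complexify_space_def mem_Collect_eq Re_of_real_vec Im_of_real_vec assms(2,3) simp_thms)
  then show ?thesis using assms(1) by auto
qed

text \<open>The imaginary part of \<open>Z q f\<close> is known to vanish only for \<open>q\<close>
  in \<open>points M\<close>, so it is compared there with the zero function, which derivations
  annihilate.\<close>

lemma bracket_real:
  assumes M: "smooth_manifold M" and p: "p \<in> points M"
    and X: "X \<in> vector_fields M" "\<And>q. q \<in> points M \<Longrightarrow> W q = of_real_vec (X q)"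
    and Y: "Y \<in> vector_fields M" "\<And>q. q \<in> points M \<Longrightarrow> Z q = of_real_vec (Y q)"
  shows "bracket M W Z p = of_real_vec (lie M X Y p)"
proof
  fix f
  have "cderiv (W p) (\<lambda>q. Z q f) = complex_of_real (X p (\<lambda>q. Y q f))"
    if f: "f \<in> smooth_funs M" and X: "X \<in> vector_fields M" "\<And>q. q \<in> points M \<Longrightarrow> W q = of_real_vec (X q)"
    and Y: "Y \<in> vector_fields M" "\<And>q. q \<in> points M \<Longrightarrow> Z q = of_real_vec (Y q)" for X Y W Z
  proof -
    note t = vector_fields_tangent[OF X(1) p]
    have "X p (\<lambda>q. Y q f) = X p (\<lambda>q. Re (Z q f))"
      by (rule tangent_space_cong[OF M p t vector_fields_smooth[OF Y(1) f]]) (simp add: Y(2) of_real_vec_def)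
    moreover have "X p (\<lambda>q. 0) = X p (\<lambda>q. Im (Z q f))"
      by (rule tangent_space_cong[OF M p t smooth_funs_const]) (simp add: Y(2) of_real_vec_def)
    ultimately show ?thesis using tangent_space_const[OF t, of 0]
      by (simp add: cderiv_def X(2)[OF p] of_real_vec_def)
  qed
  from this[OF _ X Y] this[OF _ Y X]
  show "bracket M W Z p f = of_real_vec (lie M X Y p) f"
    by (simp add: bracket_def lie_def of_real_vec_def)
qed

text \<open>Used for \<open>F\<close> with its complexification and for \<open>L\<close> with
  \<open>l\<close>: a complex tensor that acts on real vectors as the real tensor
  \<open>t\<close>.\<close>

lemma nijenhuis_real:
  assumes M: "smooth_manifold M" and p: "p \<in> points M"
    and X: "X \<in> vector_fields M" "\<And>q. q \<in> points M \<Longrightarrow> W q = of_real_vec (X q)"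
    and Y: "Y \<in> vector_fields M" "\<And>q. q \<in> points M \<Longrightarrow> Z q = of_real_vec (Y q)"
    and T: "\<And>q v. q \<in> points M \<Longrightarrow> v \<in> tangent_space M q \<Longrightarrow> T q (of_real_vec v) = of_real_vec (t q v)"
      "\<And>q v. q \<in> points M \<Longrightarrow> v \<in> tangent_space M q \<Longrightarrow> t q v \<in> tangent_space M q"
      "\<And>X. X \<in> vector_fields M \<Longrightarrow> t \<cdot> X \<in> vector_fields M"
  shows "nijenhuis M T W Z p = of_real_vec (lie M (t \<cdot> X) (t \<cdot> Y) p - t p (lie M (t \<cdot> X) Y p)
    - t p (lie M X (t \<cdot> Y) p) + t p (t p (lie M X Y p)))"
proof -
  have TW: "(T \<cdot> W) q = of_real_vec ((t \<cdot> X) q)" "(T \<cdot> Z) q = of_real_vec ((t \<cdot> Y) q)" if "q \<in> points M" for q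
    using T(1)[OF that vector_fields_tangent[OF X(1) that]] T(1)[OF that vector_fields_tangent[OF Y(1) that]]
    by (simp_all add: field_app_def X(2)[OF that] Y(2)[OF that])
  note tX = T(3)[OF X(1)] and tY = T(3)[OF Y(1)]
  have app: "(T \<cdot> B) p = T p (B p)" for B by (simp add: field_app_def)
  note br = bracket_real[OF M p]
  have lt: "lie M A B p \<in> tangent_space M p" if "A \<in> vector_fields M" "B \<in> vector_fields M" for A B
    by (rule lie_in_tangent_space[OF M that p])
  show ?thesis
    unfolding nijenhuis_def
    using br[OF tX TW(1) tY TW(2)] br[OF tX TW(1) Y] br[OF X tY TW(2)] br[OF X Y]
    by (simp add: app T(1)[OF p] T(2)[OF p] lt tX tY X(1) Y(1) of_real_vec_diff of_real_vec_add)
qed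

section \<open>F-structures\<close>

locale F_structure =
  fixes M :: "('a, 'e::euclidean_space) manifold" and F :: "'a \<Rightarrow> 'a tvec \<Rightarrow> 'a tvec"
    and K r :: nat and \<alpha> \<beta> :: complex
  assumes F_structure: "F_structure_manifold M K \<alpha> \<beta> r F"
begin

lemma M: "smooth_manifold M" and K3: "K \<ge> 3" and F: "tensor_field M F"
  and rank: "p \<in> points M \<Longrightarrow> rank_at M F p = r"
  using F_structure by (auto simp: F_structure_manifold_def)

lemma F_zero: "p \<in> points M \<Longrightarrow> F p 0 = 0"
  using tensor_field_linear(2)[OF F _ tangent_space_subspace(1), of p 0]
  by (simp add: scale_def zero_fun_def)

lemma structure_endomorphism: 
  assumes p: "p \<in> points M"
  shows "structure_endomorphism (tangent_space M p) (F p) K \<alpha> \<beta>"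
proof -
  note lin = tensor_field_linear[OF F p]
  have eq: "\<alpha> * complex_of_real ((F p ^^ (K + 1)) v f) + \<beta> * complex_of_real ((F p ^^ K) v f) + complex_of_real (F p v f) = 0"
    if v: "v \<in> tangent_space M p" for v f
  proof -
    have F0: "(F p ^^ k) 0 = 0" for k
      by (induction k) (simp_all only: funpow.simps o_apply id_apply F_zero[OF p])
    have "of_real_vec v \<in> complexify_space (tangent_space M p)"
      using v by (rule of_real_vec_complexify)
    \<comment> \<open>The last summand is written as a first power, so that one formula for powers
      of the complexified tensor splits all three terms into real and imaginary parts.\<close>
    then have "\<alpha> \<odot> (complexify_tensor F p ^^ (K + 1)) (of_real_vec v) + \<beta> \<odot> (complexify_tensor F p ^^ K) (of_real_vec v)
        + (complexify_tensor F p ^^ 1) (of_real_vec v) = 0"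
      using F_structure p by (simp add: F_structure_manifold_def)
    from fun_cong[OF this, of f] show ?thesis
      unfolding complexify_tensor_power Re_of_real_vec Im_of_real_vec F0
      by (simp add: scale_def complex_of_real_def)
  qed
  show ?thesis
  proof
    fix v assume v: "v \<in> tangent_space M p"
    show "Re \<alpha> \<odot> (F p ^^ (K + 1)) v + Re \<beta> \<odot> (F p ^^ K) v + F p v = 0"
      using arg_cong[OF eq[OF v], of Re] by (simp add: fun_eq_iff scale_def)
    show "Im \<alpha> \<odot> (F p ^^ (K + 1)) v + Im \<beta> \<odot> (F p ^^ K) v = 0"
      using arg_cong[OF eq[OF v], of Im] by (simp add: fun_eq_iff scale_def)
  qed (use K3 lin tangent_space_subspace in auto)
qed

abbreviation l where "l \<equiv> l_tensor K \<alpha> \<beta> F"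
abbreviation m where "m \<equiv> m_tensor K \<alpha> \<beta> F"
abbreviation F\<^sub>c where "F\<^sub>c \<equiv> complexify_tensor F"
abbreviation comb where "comb a b k p \<equiv> structure_endomorphism.comb (F p) a b k"
abbreviation L where "L p \<equiv> structure_endomorphism.L (F p) K \<alpha> \<beta>"
abbreviation pre where "pre p \<equiv> structure_endomorphism.pre (F p) K \<alpha> \<beta>"

lemma comb_field:
  assumes X: "X \<in> vector_fields M" shows "comb a b k \<cdot> X \<in> vector_fields M"
proof -
  have pow: "(\<lambda>p. (F p ^^ k) (X p)) \<in> vector_fields M" for k
  proof (induction k)
    case (Suc k)
    then show ?case using tensor_field_app[OF F Suc] by (simp add: field_app_def)
  qed (simp add: X)
  have "(\<lambda>p. a \<odot> (F p ^^ Suc k) (X p) + b \<odot> (F p ^^ k) (X p)) \<in> vector_fields M"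
    by (intro vector_fields_add vector_fields_scale M pow)
  moreover have "comb a b k p (X p) = a \<odot> (F p ^^ Suc k) (X p) + b \<odot> (F p ^^ k) (X p)" if "p \<in> points M" for p
    using structure_endomorphism.comb_def[OF structure_endomorphism[OF that]] by simp
  ultimately show ?thesis
    unfolding vector_fields_def field_app_def mem_Collect_eq
    by (auto intro: smooth_funs_cong[OF M])
qed

lemma L_field: "X \<in> vector_fields M \<Longrightarrow> L \<cdot> X \<in> vector_fields M"
  and pre_field: "X \<in> vector_fields M \<Longrightarrow> pre \<cdot> X \<in> vector_fields M"
proof -
  \<comment> \<open>The defining equations of \<open>L\<close> and \<open>pre\<close> come from the
    fibrewise locale and hold only at points of \<open>M\<close>.\<close>
  have cong: "A \<cdot> X \<in> vector_fields M" if "B \<cdot> X \<in> vector_fields M" "\<And>p. p \<in> points M \<Longrightarrow> A p = B p" for A B and X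
    using that unfolding vector_fields_def field_app_def mem_Collect_eq
    by (auto intro: smooth_funs_cong[OF M])
  show "L \<cdot> X \<in> vector_fields M" if X: "X \<in> vector_fields M"
    by (rule cong[OF comb_field[OF X]])
       (simp add: structure_endomorphism.L_def[OF structure_endomorphism])
  show "pre \<cdot> X \<in> vector_fields M" if X: "X \<in> vector_fields M"
    by (rule cong[OF comb_field[OF X]])
       (simp add: structure_endomorphism.pre_def[OF structure_endomorphism])
qed

lemmas F_field = tensor_field_app[OF F]

lemma l_tensor_eq:
  assumes p: "p \<in> points M" and w: "w \<in> complexify_space (tangent_space M p)"
  shows "l p w = complexify_tensor L p w"
  using structure_endomorphism.l_formula[OF structure_endomorphism[OF p], of w] w
  unfolding l_tensor_def complexify_tensor_power complexify_space_def
  by (simp add: complexify_tensor_def scale_def fun_eq_iff)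

lemma l_real:
  assumes "p \<in> points M" "v \<in> tangent_space M p"
  shows "l p (of_real_vec v) = of_real_vec (L p v)"
  unfolding l_tensor_eq[OF assms(1) of_real_vec_complexify[OF assms(2)]]
  by (rule complexify_tensor_of_real[of L, OF structure_endomorphism.L_zero[OF structure_endomorphism[OF assms(1)]]])

lemma m_tensor_eq: "m p w = w - l p w"
  by (simp add: m_tensor_def l_tensor_def)

lemma m_real:
  assumes "p \<in> points M" "v \<in> tangent_space M p"
  shows "m p (of_real_vec v) = of_real_vec (v - L p v)"
  by (simp only: m_tensor_eq l_real[OF assms] of_real_vec_diff)

lemma F_real: "p \<in> points M \<Longrightarrow> F\<^sub>c p (of_real_vec v) = of_real_vec (F p v)"
  by (rule complexify_tensor_of_real[of F, OF F_zero])

lemma image_distribution_eq: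
  assumes p: "p \<in> points M"
  shows "image_distribution M (l) p = complexify_space (F p ` tangent_space M p)"
proof -
  interpret pt: structure_endomorphism "tangent_space M p" "F p" K \<alpha> \<beta> by (rule structure_endomorphism[OF p])
  let ?T = "tangent_space M p"
  have "image_distribution M (l) p = complexify_tensor (\<lambda>p. L p) p ` complexify_space ?T"
    unfolding image_distribution_def by (rule image_cong[OF refl l_tensor_eq[OF p]])
  also have "\<dots> = complexify_space (L p ` ?T)"
  proof (intro equalityI subsetI)
    fix w assume "w \<in> complexify_space (L p ` ?T)"
    then obtain u v where uv: "u \<in> ?T" "v \<in> ?T" "Re_vec w = L p u" "Im_vec w = L p v"
      by (auto simp: complexify_space_def)
    let ?w = "\<lambda>f. Complex (u f) (v f)"
    have R: "Re_vec ?w = u" "Im_vec ?w = v" by (auto simp: Re_vec_def Im_vec_def)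
    have "w = complexify_tensor (\<lambda>p. L p) p ?w"
      unfolding complexify_tensor_def R using fun_cong[OF uv(3)] fun_cong[OF uv(4)]
      by (simp add: fun_eq_iff complex_eq_iff Re_vec_def Im_vec_def)
    then show "w \<in> complexify_tensor (\<lambda>p. L p) p ` complexify_space ?T"
      using uv(1,2) R by (auto simp: complexify_space_def)
  qed (auto simp: complexify_tensor_def complexify_space_def Re_vec_def Im_vec_def)
  finally show ?thesis by (simp only: pt.L_image)
qed

section \<open>Involutivity and the operators generating sections of Im F\<close>

text \<open>As \<open>L\<close> projects onto the image of \<open>F\<close>, this says that the
  bracket is a section of the distribution; as an equation it is the vanishing of \<open>m\<close>
  on the bracket.\<close>

definition involutive_pair :: "('a \<Rightarrow> 'a tvec) \<Rightarrow> ('a \<Rightarrow> 'a tvec) \<Rightarrow> bool" where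
  "involutive_pair X Y \<longleftrightarrow> (\<forall>p\<in>points M. L p (lie M X Y p) = lie M X Y p)"

definition involutive :: bool where
  "involutive \<longleftrightarrow> (\<forall>X\<in>vector_fields M. \<forall>Y\<in>vector_fields M. involutive_pair (F \<cdot> X) (F \<cdot> Y))"

lemma involutive_pair_cong:
  assumes "X \<in> vector_fields M" "Y \<in> vector_fields M"
    "\<And>p. p \<in> points M \<Longrightarrow> X p = X' p" "\<And>p. p \<in> points M \<Longrightarrow> Y p = Y' p"
  shows "involutive_pair X Y \<longleftrightarrow> involutive_pair X' Y'"
  unfolding involutive_pair_def using lie_cong[OF M assms(1,2) _ assms(3,4)] by simp

text \<open>Involutivity may be tested on values of another operator \<open>G\<close>, provided
  every \<open>F \<cdot> X\<close> is a value of \<open>G\<close> on a smooth field.\<close>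

lemma involutiveI:
  assumes G: "\<And>X. X \<in> vector_fields M \<Longrightarrow> \<exists>X'\<in>vector_fields M. \<forall>p\<in>points M. F p (X p) = G p (X' p)"
    and inv: "\<And>X Y. X \<in> vector_fields M \<Longrightarrow> Y \<in> vector_fields M \<Longrightarrow> involutive_pair (G \<cdot> X) (G \<cdot> Y)"
  shows involutive
  unfolding involutive_def
proof (intro ballI)
  fix X Y assume X: "X \<in> vector_fields M" and Y: "Y \<in> vector_fields M"
  obtain X' where X': "X' \<in> vector_fields M" "\<forall>p\<in>points M. F p (X p) = G p (X' p)" using G[OF X] by blast
  obtain Y' where Y': "Y' \<in> vector_fields M" "\<forall>p\<in>points M. F p (Y p) = G p (Y' p)" using G[OF Y] by blast
  show "involutive_pair (F \<cdot> X) (F \<cdot> Y)"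
    using inv[OF X'(1) Y'(1)] involutive_pair_cong[OF F_field[OF X] F_field[OF Y], of "G \<cdot> X'" "G \<cdot> Y'"] X'(2) Y'(2)
    by (simp add: field_app_def)
qed

lemma at_point:
  assumes p: "p \<in> points M" and X: "X \<in> vector_fields M"
  shows "L p (F p (X p)) = F p (X p)" "F p (L p (X p)) = F p (X p)" "F p (pre p (X p)) = L p (X p)"
    "L p (L p (X p)) = L p (X p)"
  using structure_endomorphism.L_f[OF structure_endomorphism[OF p]] structure_endomorphism.f_L[OF structure_endomorphism[OF p]]
    structure_endomorphism.f_pre[OF structure_endomorphism[OF p]] structure_endomorphism.L_L[OF structure_endomorphism[OF p]]
    vector_fields_tangent[OF X p] by auto

text \<open>The relations \<open>L X = F (pre X)\<close> and \<open>F X = L (F X)\<close> show that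
  both operators produce the same fields.\<close>

lemma involutive_L: "involutive \<longleftrightarrow> (\<forall>X\<in>vector_fields M. \<forall>Y\<in>vector_fields M. involutive_pair (L \<cdot> X) (L \<cdot> Y))"
proof
  assume inv: involutive
  show "\<forall>X\<in>vector_fields M. \<forall>Y\<in>vector_fields M. involutive_pair (L \<cdot> X) (L \<cdot> Y)"
  proof (intro ballI)
    fix X Y assume X: "X \<in> vector_fields M" and Y: "Y \<in> vector_fields M"
    have "involutive_pair (F \<cdot> pre \<cdot> X) (F \<cdot> pre \<cdot> Y)"
      using inv pre_field X Y by (simp add: involutive_def)
    then show "involutive_pair (L \<cdot> X) (L \<cdot> Y)"
      using involutive_pair_cong[OF F_field[OF pre_field[OF X]] F_field[OF pre_field[OF Y]], of "L \<cdot> X" "L \<cdot> Y"]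
        at_point(3)[OF _ X] at_point(3)[OF _ Y] by (simp add: field_app_def)
  qed
next
  assume inv: "\<forall>X\<in>vector_fields M. \<forall>Y\<in>vector_fields M. involutive_pair (L \<cdot> X) (L \<cdot> Y)"
  show involutive
  proof (rule involutiveI)
    show "\<exists>X'\<in>vector_fields M. \<forall>p\<in>points M. F p (X p) = L p (X' p)" if X: "X \<in> vector_fields M" for X
      using F_field[OF X] at_point(1)[OF _ X] by (intro bexI[of _ "F \<cdot> X"]) (auto simp: field_app_def)
  qed (use inv in blast)
qed

text \<open>Every \<open>F X\<close> equals \<open>F (L X) = F (F (pre X))\<close>, so applying
  \<open>F\<close> twice loses no fields.\<close>

lemma involutive_FF:
  "involutive \<longleftrightarrow> (\<forall>X\<in>vector_fields M. \<forall>Y\<in>vector_fields M. involutive_pair (F \<cdot> F \<cdot> X) (F \<cdot> F \<cdot> Y))"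
proof
  assume "\<forall>X\<in>vector_fields M. \<forall>Y\<in>vector_fields M. involutive_pair (F \<cdot> F \<cdot> X) (F \<cdot> F \<cdot> Y)"
  then show involutive
  proof (intro involutiveI[of "\<lambda>p v. F p (F p v)"])
    fix X assume X: "X \<in> vector_fields M"
    show "\<exists>X'\<in>vector_fields M. \<forall>p\<in>points M. F p (X p) = F p (F p (X' p))"
      using pre_field[OF X] at_point(2,3)[OF _ X] by (intro bexI[of _ "pre \<cdot> X"]) (auto simp: field_app_def)
  qed (simp add: field_app_def)
qed (use F_field in \<open>auto simp: involutive_def\<close>)

lemma involutive_FL:
  "involutive \<longleftrightarrow> (\<forall>X\<in>vector_fields M. \<forall>Y\<in>vector_fields M. involutive_pair (F \<cdot> L \<cdot> X) (F \<cdot> L \<cdot> Y))"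
proof -
  have "involutive_pair (F \<cdot> L \<cdot> X) (F \<cdot> L \<cdot> Y) \<longleftrightarrow> involutive_pair (F \<cdot> X) (F \<cdot> Y)"
    if "X \<in> vector_fields M" "Y \<in> vector_fields M" for X Y
    using at_point(2) that
    by (intro involutive_pair_cong F_field L_field) (auto simp: field_app_def)
  then show ?thesis by (simp add: involutive_def)
qed

section \<open>Nijenhuis tensors modulo the distribution\<close>

text \<open>All terms of the Nijenhuis tensor of \<open>F\<close> except the first are values of
  \<open>F\<close>; they are fixed by \<open>L\<close> and drop out of
  \<open>v - L p v\<close>.\<close>

lemma nijenhuis_F:
  assumes p: "p \<in> points M"
    and X: "X \<in> vector_fields M" "\<And>q. q \<in> points M \<Longrightarrow> W q = of_real_vec (X q)"
    and Y: "Y \<in> vector_fields M" "\<And>q. q \<in> points M \<Longrightarrow> Z q = of_real_vec (Y q)"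
  shows "\<exists>v\<in>tangent_space M p. nijenhuis M (F\<^sub>c) W Z p = of_real_vec v \<and>
    v - L p v = lie M (F \<cdot> X) (F \<cdot> Y) p - L p (lie M (F \<cdot> X) (F \<cdot> Y) p)"
proof -
  interpret pt: structure_endomorphism "tangent_space M p" "F p" K \<alpha> \<beta> by (rule structure_endomorphism[OF p])
  note lt = lie_in_tangent_space[OF M _ _ p]
  note FX = F_field[OF X(1)] and FY = F_field[OF Y(1)]
  let ?a = "lie M (F \<cdot> X) (F \<cdot> Y) p" and ?b = "lie M (F \<cdot> X) Y p" and ?c = "lie M X (F \<cdot> Y) p" and ?d = "lie M X Y p"
  let ?v = "?a - F p ?b - F p ?c + F p (F p ?d)"
  have in_T: "?a \<in> tangent_space M p" "?b \<in> tangent_space M p" "?c \<in> tangent_space M p" "?d \<in> tangent_space M p"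
    using lt FX FY X(1) Y(1) by auto
  have eq: "nijenhuis M (F\<^sub>c) W Z p = of_real_vec ?v"
    by (rule nijenhuis_real[OF M p X Y]) (auto simp: F_real F_field tensor_field_linear(1)[OF F])
  have s: "?a - F p ?b \<in> tangent_space M p" "?a - F p ?b - F p ?c \<in> tangent_space M p" "?v \<in> tangent_space M p"
    using in_T pt.L_diff pt.f(1) pt.T(2) by auto
  have "L p ?v = L p ?a - F p ?b - F p ?c + F p (F p ?d)"
    using in_T s by (simp add: pt.L_add pt.f(1) pt.L_f pt.L_diff[THEN conjunct2])
  then have "?v - L p ?v = ?a - L p ?a" by simp
  then show ?thesis using eq s(3) by blast
qed

text \<open>On fields fixed by \<open>L\<close> the four terms involve the same bracket, and
  idempotence of \<open>L\<close> collapses them to the bracket minus its projection.\<close>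

lemma nijenhuis_l:
  assumes p: "p \<in> points M"
    and X: "X \<in> vector_fields M" "\<And>q. q \<in> points M \<Longrightarrow> W q = of_real_vec (X q)" "\<And>q. q \<in> points M \<Longrightarrow> L q (X q) = X q"
    and Y: "Y \<in> vector_fields M" "\<And>q. q \<in> points M \<Longrightarrow> Z q = of_real_vec (Y q)" "\<And>q. q \<in> points M \<Longrightarrow> L q (Y q) = Y q"
  shows "nijenhuis M (l) W Z p = of_real_vec (lie M X Y p - L p (lie M X Y p))"
proof -
  have "nijenhuis M (l) W Z p = of_real_vec (lie M (L \<cdot> X) (L \<cdot> Y) p - L p (lie M (L \<cdot> X) Y p)
    - L p (lie M X (L \<cdot> Y) p) + L p (L p (lie M X Y p)))"
    by (rule nijenhuis_real[OF M p X(1,2) Y(1,2)])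
       (auto simp: l_real L_field structure_endomorphism.L_in[OF structure_endomorphism])
  moreover have "lie M (L \<cdot> X) (L \<cdot> Y) p = lie M X Y p" "lie M (L \<cdot> X) Y p = lie M X Y p" "lie M X (L \<cdot> Y) p = lie M X Y p"
    using X(3) Y(3) by (auto intro!: lie_cong[OF M _ _ p, symmetric] simp: X(1) Y(1) field_app_def)
  moreover have "L p (L p (lie M X Y p)) = L p (lie M X Y p)"
    by (rule structure_endomorphism.L_L[OF structure_endomorphism[OF p] lie_in_tangent_space[OF M X(1) Y(1) p]])
  ultimately show ?thesis by simp
qed

lemma integrable_iff_involutive:
  assumes r: "r = DIM('d::euclidean_space)"
  shows "integrable_distribution TYPE('d) M (image_distribution M (l)) \<longleftrightarrow> involutive"
proof
  assume int: "integrable_distribution TYPE('d) M (image_distribution M (l))"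
  show involutive
    unfolding involutive_def involutive_pair_def
  proof (intro ballI)
    fix X Y p assume X: "X \<in> vector_fields M" and Y: "Y \<in> vector_fields M" and p: "p \<in> points M"
    obtain N :: "('a, 'd) manifold" where N: "p \<in> points N" "immersed_submanifold M N"
      and tan: "\<And>q. q \<in> points N \<Longrightarrow> complexify_space (differential N M (\<lambda>x. x) ` tangent_space N q)
        = image_distribution M (l) q"
      using int p unfolding integrable_distribution_def integral_manifold_def by blast
    have NM: "q \<in> points M" if "q \<in> points N" for q using N(2) that by (auto simp: immersed_submanifold_def)
    have D: "differential N M (\<lambda>x. x) ` tangent_space N q = F q ` tangent_space M q" if q: "q \<in> points N" for q
    proof (rule complexify_space_inject)
      show "complexify_space (differential N M (\<lambda>x. x) ` tangent_space N q) = complexify_space (F q ` tangent_space M q)"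
        using tan[OF q] image_distribution_eq[OF NM[OF q]] by simp
      have "differential N M (\<lambda>x. x) 0 = 0" by (auto simp: differential_def)
      then show "0 \<in> differential N M (\<lambda>x. x) ` tangent_space N q" using tangent_space_subspace(1) by (metis image_eqI)
      show "0 \<in> F q ` tangent_space M q" using F_zero[OF NM[OF q]] tangent_space_subspace(1) by (metis image_eqI)
    qed
    have FD: "(F \<cdot> Z) q \<in> F q ` tangent_space M q" if "Z \<in> vector_fields M" "q \<in> points N" for Z q
      using vector_fields_tangent[OF that(1) NM[OF that(2)]] by (simp add: field_app_def)
    have "lie M (F \<cdot> X) (F \<cdot> Y) p \<in> F p ` tangent_space M p"
      by (rule lie_tangent_to_integral_manifold[OF M N(2,1) D F_field[OF X] FD[OF X] F_field[OF Y] FD[OF Y]])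
    then show "L p (lie M (F \<cdot> X) (F \<cdot> Y) p) = lie M (F \<cdot> X) (F \<cdot> Y) p"
      using structure_endomorphism.L_f[OF structure_endomorphism[OF p]] by auto
  qed
next
  assume inv: involutive
  show "integrable_distribution TYPE('d) M (image_distribution M (l))"
    unfolding integrable_distribution_def
  proof
    fix p assume p: "p \<in> points M"
    have "lie M (F \<cdot> X) (F \<cdot> Y) q \<in> F q ` tangent_space M q"
      if X: "X \<in> vector_fields M" and Y: "Y \<in> vector_fields M" and q: "q \<in> points M" for X Y q
    proof -
      \<comment> \<open>Being fixed by \<open>L\<close>, the bracket is its own preimage under
        \<open>L\<close>.\<close>
      have "lie M (F \<cdot> X) (F \<cdot> Y) q \<in> L q ` tangent_space M q"
        using inv X Y q lie_in_tangent_space[OF M F_field[OF X] F_field[OF Y] q]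
        unfolding involutive_def involutive_pair_def by (metis image_eqI)
      then show ?thesis by (simp only: structure_endomorphism.L_image[OF structure_endomorphism[OF q]])
    qed
    from integral_manifold_through[OF M F rank[unfolded r] this p]
    obtain N :: "('a, 'd) manifold" where N: "p \<in> points N" "immersed_submanifold M N"
      "\<And>q. q \<in> points N \<Longrightarrow> differential N M (\<lambda>x. x) ` tangent_space N q = F q ` tangent_space M q" by blast
    have "integral_manifold M (image_distribution M (l)) N"
      unfolding integral_manifold_def
    proof (intro conjI ballI N(2))
      fix q assume q: "q \<in> points N"
      then have "q \<in> points M" using N(2) by (auto simp: immersed_submanifold_def)
      then show "complexify_space (differential N M (\<lambda>x. x) ` tangent_space N q) = image_distribution M (l) q"
        by (simp add: N(3)[OF q] image_distribution_eq)
    qed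
    then show "\<exists>N :: ('a, 'd) manifold. p \<in> points N \<and> integral_manifold M (image_distribution M (l)) N"
      using N(1) by blast
  qed
qed

section \<open>Reduction of the six identities to involutivity\<close>

lemma for_all_fields_involutive_pair:
  assumes "\<And>X Y p. X \<in> vector_fields M \<Longrightarrow> Y \<in> vector_fields M \<Longrightarrow> p \<in> points M \<Longrightarrow>
    P (complexify_field X) (complexify_field Y) p \<longleftrightarrow> lie M (G \<cdot> X) (G \<cdot> Y) p - L p (lie M (G \<cdot> X) (G \<cdot> Y) p) = 0"
  shows "for_all_fields M P \<longleftrightarrow> (\<forall>X\<in>vector_fields M. \<forall>Y\<in>vector_fields M. involutive_pair (G \<cdot> X) (G \<cdot> Y))"
  using assms by (simp add: for_all_fields_def involutive_pair_def eq_commute[of "L _ _"])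

lemma complexify_field_real: "complexify_field X q = of_real_vec (X q)"
  by (simp add: complexify_field_def of_real_vec_def)

lemma F_field_real: "q \<in> points M \<Longrightarrow> (F\<^sub>c \<cdot> complexify_field X) q = of_real_vec ((F \<cdot> X) q)"
  by (simp add: field_app_def complexify_field_real F_real)

lemma l_field_real:
  "q \<in> points M \<Longrightarrow> X \<in> vector_fields M \<Longrightarrow> (l \<cdot> complexify_field X) q = of_real_vec ((L \<cdot> X) q)"
  by (simp add: field_app_def complexify_field_real l_real vector_fields_tangent)

text \<open>Stated for any fields that are real on \<open>points M\<close>, so that it covers
  \<open>X\<close> itself, its image under \<open>F\<close> and its image under \<open>l\<close>,
  that is, (iv), (v) and (vi).\<close>

lemma m_nijenhuis_F:
  assumes p: "p \<in> points M"
    and X: "X \<in> vector_fields M" "\<And>q. q \<in> points M \<Longrightarrow> W q = of_real_vec (X q)"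
    and Y: "Y \<in> vector_fields M" "\<And>q. q \<in> points M \<Longrightarrow> Z q = of_real_vec (Y q)"
  shows "(m \<cdot> nijenhuis M (F\<^sub>c) W Z) p = 0 \<longleftrightarrow>
    lie M (F \<cdot> X) (F \<cdot> Y) p - L p (lie M (F \<cdot> X) (F \<cdot> Y) p) = 0"
proof -
  obtain v where v: "v \<in> tangent_space M p" "nijenhuis M (F\<^sub>c) W Z p = of_real_vec v"
    "v - L p v = lie M (F \<cdot> X) (F \<cdot> Y) p - L p (lie M (F \<cdot> X) (F \<cdot> Y) p)"
    using nijenhuis_F[OF p X Y] by blast
  show ?thesis unfolding field_app_def[of "m"] v(2) m_real[OF p v(1)] v(3)[symmetric] by (rule of_real_vec_eq_0)
qed

lemma condition_ii:
  "for_all_fields M (\<lambda>X Y p. nijenhuis M (l) (l \<cdot> X) (l \<cdot> Y) p = 0)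
    \<longleftrightarrow> involutive"
  unfolding involutive_L
proof (rule for_all_fields_involutive_pair)
  fix X Y p assume X: "X \<in> vector_fields M" and Y: "Y \<in> vector_fields M" and p: "p \<in> points M"
  have LL: "L q ((L \<cdot> Z) q) = (L \<cdot> Z) q" if "Z \<in> vector_fields M" "q \<in> points M" for Z q
    using at_point(4)[OF that(2,1)] by (simp add: field_app_def)
  show "nijenhuis M (l) (l \<cdot> complexify_field X) (l \<cdot> complexify_field Y) p = 0
    \<longleftrightarrow> lie M (L \<cdot> X) (L \<cdot> Y) p - L p (lie M (L \<cdot> X) (L \<cdot> Y) p) = 0"
    unfolding of_real_vec_eq_0[symmetric]
    by (subst nijenhuis_l[OF p L_field[OF X] l_field_real[OF _ X] LL[OF X] L_field[OF Y] l_field_real[OF _ Y] LL[OF Y]]) simp_all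
qed

lemma condition_vii:
  "for_all_fields M (\<lambda>X Y p. nijenhuis M (l) (F\<^sub>c \<cdot> X) (F\<^sub>c \<cdot> Y) p = 0)
    \<longleftrightarrow> involutive"
  unfolding involutive_def
proof (rule for_all_fields_involutive_pair)
  fix X Y p assume X: "X \<in> vector_fields M" and Y: "Y \<in> vector_fields M" and p: "p \<in> points M"
  have LF: "L q ((F \<cdot> Z) q) = (F \<cdot> Z) q" if "Z \<in> vector_fields M" "q \<in> points M" for Z q
    using at_point(1)[OF that(2,1)] by (simp add: field_app_def)
  show "nijenhuis M (l) (F\<^sub>c \<cdot> complexify_field X) (F\<^sub>c \<cdot> complexify_field Y) p = 0
    \<longleftrightarrow> lie M (F \<cdot> X) (F \<cdot> Y) p - L p (lie M (F \<cdot> X) (F \<cdot> Y) p) = 0"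
    unfolding of_real_vec_eq_0[symmetric]
    by (subst nijenhuis_l[OF p F_field[OF X] F_field_real LF[OF X] F_field[OF Y] F_field_real LF[OF Y]]) simp_all
qed

lemma condition_iv:
  "for_all_fields M (\<lambda>X Y p. (m \<cdot> nijenhuis M (F\<^sub>c) X Y) p = 0) \<longleftrightarrow> involutive"
  unfolding involutive_def
  by (rule for_all_fields_involutive_pair) (rule m_nijenhuis_F; simp add: complexify_field_real)

lemma condition_iii:
  "for_all_fields M (\<lambda>X Y p. nijenhuis M (F\<^sub>c) X Y p =
    (l \<cdot> nijenhuis M (F\<^sub>c) X Y) p) \<longleftrightarrow> involutive"
proof -
  have "v = l p v \<longleftrightarrow> m p v = 0" for p v
    unfolding m_tensor_eq by (rule eq_iff_diff_eq_0)
  then show ?thesis unfolding condition_iv[symmetric] by (simp add: field_app_def)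
qed

lemma condition_v:
  "for_all_fields M (\<lambda>X Y p. (m \<cdot>
    nijenhuis M (F\<^sub>c) (F\<^sub>c \<cdot> X) (F\<^sub>c \<cdot> Y)) p = 0) \<longleftrightarrow> involutive"
proof -
  \<comment> \<open>The reduction lemma expects one operator applied to \<open>X\<close>, so the
    iterated application is rewritten as a single composite operator.\<close>
  have eq: "F \<cdot> F \<cdot> X = (\<lambda>p v. F p (F p v)) \<cdot> X" for X by (simp add: field_app_def)
  show ?thesis
    unfolding involutive_FF eq
  proof (rule for_all_fields_involutive_pair, unfold eq[symmetric])
    fix X Y p assume "X \<in> vector_fields M" "Y \<in> vector_fields M" "p \<in> points M"
    then show "(m \<cdot> nijenhuis M (F\<^sub>c) (F\<^sub>c \<cdot> complexify_field X)
        (F\<^sub>c \<cdot> complexify_field Y)) p = 0 \<longleftrightarrow>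
      lie M (F \<cdot> F \<cdot> X) (F \<cdot> F \<cdot> Y) p - L p (lie M (F \<cdot> F \<cdot> X) (F \<cdot> F \<cdot> Y) p) = 0"
      by (intro m_nijenhuis_F F_field F_field_real)
  qed
qed

lemma condition_vi:
  "for_all_fields M (\<lambda>X Y p. (m \<cdot>
    nijenhuis M (F\<^sub>c) (l \<cdot> X) (l \<cdot> Y)) p = 0) \<longleftrightarrow> involutive"
proof -
  have eq: "F \<cdot> L \<cdot> X = (\<lambda>p v. F p (L p v)) \<cdot> X" for X by (simp add: field_app_def)
  show ?thesis
    unfolding involutive_FL eq
  proof (rule for_all_fields_involutive_pair, unfold eq[symmetric])
    fix X Y p assume "X \<in> vector_fields M" "Y \<in> vector_fields M" "p \<in> points M"
    then show "(m \<cdot> nijenhuis M (F\<^sub>c) (l \<cdot> complexify_field X)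
        (l \<cdot> complexify_field Y)) p = 0 \<longleftrightarrow>
      lie M (F \<cdot> L \<cdot> X) (F \<cdot> L \<cdot> Y) p - L p (lie M (F \<cdot> L \<cdot> X) (F \<cdot> L \<cdot> Y) p) = 0"
      by (intro m_nijenhuis_F L_field l_field_real)
  qed
qed

end

theorem theorem5p5:
  fixes M :: "('a, 'e::euclidean_space) manifold"
    and F :: "'a \<Rightarrow> 'a tvec \<Rightarrow> 'a tvec"
    and K r :: nat and \<alpha> \<beta> :: complex
  assumes "F_structure_manifold M K \<alpha> \<beta> r F"
    and "r = DIM('d::euclidean_space)"
  shows
   "let l = l_tensor K \<alpha> \<beta> F;
        m = m_tensor K \<alpha> \<beta> F;
        N\<^sub>F = nijenhuis M (complexify_tensor F);
        N\<^sub>l = nijenhuis M l;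
        i = integrable_distribution TYPE('d) M (image_distribution M l);
        ii = for_all_fields M (\<lambda>X Y p. N\<^sub>l (l \<cdot> X) (l \<cdot> Y) p = 0);
        iii = for_all_fields M (\<lambda>X Y p. N\<^sub>F X Y p = (l \<cdot> N\<^sub>F X Y) p);
        iv = for_all_fields M (\<lambda>X Y p. (m \<cdot> N\<^sub>F X Y) p = 0);
        v = for_all_fields M (\<lambda>X Y p.
              (m \<cdot> N\<^sub>F (complexify_tensor F \<cdot> X) (complexify_tensor F \<cdot> Y)) p = 0);
        vi = for_all_fields M (\<lambda>X Y p. (m \<cdot> N\<^sub>F (l \<cdot> X) (l \<cdot> Y)) p = 0);
        vii = for_all_fields M (\<lambda>X Y p.
              N\<^sub>l (complexify_tensor F \<cdot> X) (complexify_tensor F \<cdot> Y) p = 0)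
    in (i \<longleftrightarrow> ii) \<and> (i \<longleftrightarrow> iii) \<and> (i \<longleftrightarrow> iv) \<and> (i \<longleftrightarrow> v) \<and> (i \<longleftrightarrow> vi) \<and> (i \<longleftrightarrow> vii)"
proof -
  interpret F_structure M F K r \<alpha> \<beta> by unfold_locales (rule assms(1))
  show ?thesis
    unfolding Let_def integrable_iff_involutive[OF assms(2)] condition_ii condition_iii condition_iv
      condition_v condition_vi condition_vii by simp
qed

end
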